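(* Let $p$ be a prime and let $e_1,e_2,e_3,e_4$ be positive integers, all less than $p$, with $\sum_{i=1}^4 e_i=2p+2$. Then $$h_p(p;e_1,e_2,e_3,e_4)=h(p;e_1,e_2,e_3,e_4)-p.$$
   Context: A cover of ramification type $(d;C_1,\dots,C_r)$ over an algebraically closed field, with $C_i$ conjugacy classes of $S_d$ and ordered distinct branch points $Q_1,\dots,Q_r\in\mathbb{P}^1$, is a finite separable degree-$d$ morphism $f:\mathbb{P}^1\to\mathbb{P}^1$, étale away from the $Q_i$, such that the ramification indices of the points in $f^{-1}(Q_i)$ are the cycle lengths of $C_i$. Covers are counted up to isomorphism over the fixed target $\mathbb{P}^1$. Writing $C_i=e_i$ means that $C_i$ is the class of a single $e_i$-cycle (all other points over $Q_i$ are unramified). The Hurwitz number $h(d;C_1,\dots,C_r)$ is the number of covers $\mathbb{P}^1\to\mathbb{P}^1$ of this type over $\mathbb{C}$ (independent of the choice of the $Q_i$). For a prime $p$ dividing none of the ramification indices, the $p$-Hurwitz number $h_p(d;C_1,\dots,C_r)$ is the number of covers $\mathbb{P}^1\to\mathbb{P}^1$ of this type over an algebraically closed field of characteristic $p$ when the branch points $Q_1,\dots,Q_r$ are generic.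
   Formalization: The e_i are assumed to be at least 2 rather than merely positive: if some e_i = 1, then h is the three-point number 1, so h − p is negative and the claimed identity fails (e.g. p = 5, e = (1,3,4,4)). *)

theory Defs
  imports Complex_Main "HOL-Library.Multiset" "HOL-Computational_Algebra.Computational_Algebra"
begin

section \<open>Morphisms from the projective line to itself\<close>

text \<open>\<^term>\<open>Fin x\<close> is the point $[x:1]$ and \<^term>\<open>Infty\<close> is $[1:0]$.\<close>

datatype 'a proj_line = Fin 'a | Infty

fun hcoords :: "'a::field proj_line \<Rightarrow> 'a \<times> 'a" where
  "hcoords (Fin x) = (x, 1)"
| "hcoords Infty = (1, 0)"

definition proj_pt :: "'a::field \<Rightarrow> 'a \<Rightarrow> 'a proj_line" where
  "proj_pt u v = (if v = 0 then Infty else Fin (u / v))"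

text \<open>
  A pair of coprime polynomials $(a, b)$ represents the morphism $x \mapsto [a(x) : b(x)]$, i.e.
  $[x:y] \mapsto [y^d a(x/y) : y^d b(x/y)]$ with $d = \max(\deg a, \deg b)$. Two pairs represent the
  same morphism iff they are proportional; over an algebraically closed field this
  is the case iff they induce the same map on points.
\<close>

type_synonym 'a ratpair = "'a poly \<times> 'a poly"

definition is_morphism :: "'a::field ratpair \<Rightarrow> bool" where
  "is_morphism f \<longleftrightarrow> coprime (fst f) (snd f)"

definition mdegree :: "'a::field ratpair \<Rightarrow> nat" where
  "mdegree f = max (degree (fst f)) (degree (snd f))"

fun mapply :: "'a::field ratpair \<Rightarrow> 'a proj_line \<Rightarrow> 'a proj_line" where
  "mapply f (Fin x) = proj_pt (poly (fst f) x) (poly (snd f) x)"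
| "mapply f Infty = proj_pt (coeff (fst f) (mdegree f)) (coeff (snd f) (mdegree f))"

text \<open>
  The pullback under $f$ of the linear form vanishing at $Q$: a binary form of
  degree \<^term>\<open>mdegree f\<close>, here dehomogenized. Its order of vanishing at $P$ is the valuation at
  $P$ of the pullback of a local parameter at $Q$ if $f(P) = Q$; at \<^term>\<open>Infty\<close> this order is the
  drop in degree.
\<close>

fun pullback_form :: "'a::field ratpair \<Rightarrow> 'a proj_line \<Rightarrow> 'a poly" where
  "pullback_form f (Fin c) = fst f - smult c (snd f)"
| "pullback_form f Infty = snd f"

fun ram_index :: "'a::field ratpair \<Rightarrow> 'a proj_line \<Rightarrow> nat" where
  "ram_index f (Fin x) = order x (pullback_form f (mapply f (Fin x)))"
| "ram_index f Infty = mdegree f - degree (pullback_form f (mapply f Infty))"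

text \<open>
  The function field of the source is $K(x)$, the type \<^typ>\<open>'a poly fract\<close>; the function field
  of the target is embedded by pullback as the subfield $K(f)$.
\<close>

inductive_set gen_subfield :: "'a::field poly fract \<Rightarrow> 'a poly fract set"
  for t :: "'a poly fract" where
  const: "Fract [:c:] 1 \<in> gen_subfield t"
| gen: "t \<in> gen_subfield t"
| diff: "u \<in> gen_subfield t \<Longrightarrow> v \<in> gen_subfield t \<Longrightarrow> u - v \<in> gen_subfield t"
| mult: "u \<in> gen_subfield t \<Longrightarrow> v \<in> gen_subfield t \<Longrightarrow> u * v \<in> gen_subfield t"
| inverse: "u \<in> gen_subfield t \<Longrightarrow> inverse u \<in> gen_subfield t"

text \<open>
  Every element of $K(x)$ is a root of a separable polynomial over $K(f)$. Coprimality with the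
  derivative does not depend on the field containing the coefficients. For a nonconstant
  morphism the denominator below is nonzero.
\<close>

definition separable_morphism :: "'a::field ratpair \<Rightarrow> bool" where
  "separable_morphism f \<longleftrightarrow>
     (\<forall>z :: 'a poly fract. \<exists>g :: 'a poly fract poly.
        (\<forall>i. coeff g i \<in> gen_subfield (Fract (fst f) (snd f))) \<and>
        g \<noteq> 0 \<and> poly g z = 0 \<and> coprime g (pderiv g))"


section \<open>Covers of given ramification type\<close>

text \<open>
  A conjugacy class of $S_d$ is given by its cycle type, the multiset of all cycle lengths
  (fixed points included). A morphism between smooth curves over an algebraically closed field is
  etale at a point iff its ramification index there is 1; it is finite iff it is nonconstant.
\<close>

definition single_cycle :: "nat \<Rightarrow> nat \<Rightarrow> nat multiset" where
  "single_cycle d e = {#e#} + replicate_mset (d - e) 1"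

definition is_cover ::
    "nat \<Rightarrow> nat multiset list \<Rightarrow> 'a::field proj_line list \<Rightarrow> 'a ratpair \<Rightarrow> bool" where
  "is_cover d Cs Qs f \<longleftrightarrow>
     is_morphism f \<and> mdegree f = d \<and> 0 < d \<and> separable_morphism f \<and>
     (\<forall>P. mapply f P \<notin> set Qs \<longrightarrow> ram_index f P = 1) \<and>
     (\<forall>i<length Cs.
        image_mset (ram_index f) (mset_set {P. mapply f P = Qs ! i}) = Cs ! i)"

definition cover_iso :: "('a::field ratpair \<times> 'a ratpair) set" where
  "cover_iso = {(f, g). is_morphism f \<and> is_morphism g \<and>
     (\<exists>s t. is_morphism s \<and> is_morphism t \<and>
        mapply s \<circ> mapply t = id \<and> mapply t \<circ> mapply s = id \<and>
        mapply f = mapply g \<circ> mapply s)}"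

definition iso_classes ::
    "nat \<Rightarrow> nat multiset list \<Rightarrow> 'a::field proj_line list \<Rightarrow> 'a ratpair set set" where
  "iso_classes d Cs Qs = {f. is_cover d Cs Qs f} // cover_iso"

definition num_covers ::
    "nat \<Rightarrow> nat multiset list \<Rightarrow> 'a::field proj_line list \<Rightarrow> nat \<Rightarrow> bool" where
  "num_covers d Cs Qs n \<longleftrightarrow> finite (iso_classes d Cs Qs) \<and> card (iso_classes d Cs Qs) = n"


section \<open>The Zariski topology on powers of the projective line\<close>

text \<open>
  The multihomogeneous polynomial of multidegree $(\delta_0,\dots,\delta_{r-1})$ with coefficients
  $c$, evaluated at the standard homogeneous coordinates of the given points. Its vanishing does
  not depend on the choice of homogeneous coordinates.
\<close>

definition multiform ::
    "nat \<Rightarrow> (nat \<Rightarrow> nat) \<Rightarrow> ((nat \<Rightarrow> nat) \<Rightarrow> 'a::field) \<Rightarrow> 'a proj_line list \<Rightarrow> 'a" where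
  "multiform r \<delta> c Qs =
     (\<Sum>m \<in> (\<Pi>\<^sub>E i\<in>{..<r}. {..\<delta> i}).
        c m * (\<Prod>i<r. fst (hcoords (Qs ! i)) ^ m i * snd (hcoords (Qs ! i)) ^ (\<delta> i - m i)))"

definition zariski_open :: "nat \<Rightarrow> 'a::field proj_line list set \<Rightarrow> bool" where
  "zariski_open r U \<longleftrightarrow>
     (\<exists>F. U = {Qs. length Qs = r} -
              {Qs. length Qs = r \<and> (\<forall>(\<delta>, c)\<in>F. multiform r \<delta> c Qs = 0)})"


section \<open>Hurwitz numbers\<close>

definition hurwitz :: "nat \<Rightarrow> nat multiset list \<Rightarrow> nat" where
  "hurwitz d Cs =
     (THE n. \<forall>Qs :: complex proj_line list.
        length Qs = length Cs \<and> distinct Qs \<longrightarrow> num_covers d Cs Qs n)"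

text \<open>
  ``Generic branch points'' means: all tuples of distinct points in some nonempty Zariski open set
  of tuples over the given field. The type argument is the algebraically closed base field; the
  definition is meant for fields whose characteristic divides none of the ramification indices.
\<close>

definition p_hurwitz :: "'a::alg_closed_field itself \<Rightarrow> nat \<Rightarrow> nat multiset list \<Rightarrow> nat" where
  "p_hurwitz _ d Cs =
     (THE n. \<exists>U :: 'a proj_line list set. zariski_open (length Cs) U \<and> U \<noteq> {} \<and>
        (\<forall>Qs\<in>U. distinct Qs \<longrightarrow> num_covers d Cs Qs n))"

end

theory Submission
  imports Defs "Jordan_Normal_Form.Determinant"
begin

text \<open>
  Put the four ramification points at $0, \infty, 1, \lambda$ and the branch points at
  $0, \infty, 1, \mu$. The pairs $(A, B)$ such that $f = A / B$ has the prescribed ramification over the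
  first three branch points form a space of dimension $e_4$, and the fourth condition says that
  $A - \mu B$ has a zero of order $e_4$ at $\lambda$. So the covers correspond to the zeros of the Wronskian
  determinant $D$ of the polynomials $A - \mu B$, which has degree $e_4 (d + 1 - e_4)$. If $e_4$ is the index
  that minimises $e (d + 1 - e)$, then the Riemann-Hurwitz bound, applied to the Wronskian $A' B - A B'$, excludes
  zeros of $D$ at $0$, $1$ and $\infty$. The zeros of $D$ are simple because tame covers are rigid. In
  characteristic $p = d$ the inseparable pencil $(x^p, 1)$ belongs to the space as well. The
  corresponding factor $x^p - \mu$ of $D$ has a single zero, which does not come from a cover for generic $\mu$,
  and this accounts for the difference $p$ of the two counts.
\<close>

text \<open>The dimension count is \<open>(d + 1 - e1) + (d + 1 - e2) - e3 = e4\<close>: the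
  coefficients of A and B left free by the conditions at 0 and infinity, minus the conditions at 1.
  That these conditions are independent is read off from the absence of a zero of D at infinity,
  which also fixes the degree of D. Two obstacles shape the argument. Riemann-Hurwitz controls only
  pairs with nonzero Wronskian. Otherwise the pair is the inseparable one, or A and B are multiples
  of one polynomial. In the latter case two conditions meeting at one point do not add up; only the
  larger order counts, and exactly there the minimality of \<open>e (d + 1 - e)\<close> enters. The
  second obstacle is the zero of \<open>x ^ p - mu\<close> in characteristic p. It is a p-fold zero
  of this factor, and D must not vanish there to higher order. A polynomial function
  \<open>phi\<close> of the zero is exhibited whose nonvanishing guarantees this; its value is a
  coefficient that no derivative can have in characteristic p. In characteristic 0 or d the numbers
  below d are invertible, so iterated derivatives detect orders of vanishing up to d.\<close>

hide_const (open) Module.smult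

section \<open>Determinants and linear systems\<close>

definition fdet :: "nat \<Rightarrow> (nat \<Rightarrow> nat \<Rightarrow> 'a::comm_ring_1) \<Rightarrow> 'a" where
  "fdet n M = det (mat n n (\<lambda>(i, j). M i j))"

lemma fdet_altdef:
  "fdet n M = (\<Sum>p | p permutes {0..<n}. signof p * (\<Prod>i = 0..<n. M i (p i)))"
  unfolding fdet_def by (subst det_def'[of _ n]) (auto intro!: sum.cong prod.cong simp: permutes_in_image)

lemma fdet_cong:
  assumes "\<And>i j. i < n \<Longrightarrow> j < n \<Longrightarrow> M i j = M' i j"
  shows "fdet n M = fdet n M'"
  unfolding fdet_def using assms by (intro arg_cong[where f = det]) auto

lemma fdet_eq_0_iff:
  fixes M :: "nat \<Rightarrow> nat \<Rightarrow> 'a::field"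
  shows "fdet n M = 0 \<longleftrightarrow> (\<exists>c. (\<exists>j<n. c j \<noteq> 0) \<and> (\<forall>i<n. (\<Sum>j<n. M i j * c j) = 0))"
proof -
  let ?A = "mat n n (\<lambda>(i, j). M i j)"
  have mv: "?A *\<^sub>v v = 0\<^sub>v n \<longleftrightarrow> (\<forall>i<n. (\<Sum>j<n. M i j * (v $ j)) = 0)" if "v \<in> carrier_vec n" for v
    using that by (auto simp: vec_eq_iff scalar_prod_def lessThan_atLeast0)
  have "fdet n M = 0 \<longleftrightarrow> (\<exists>v. v \<in> carrier_vec n \<and> v \<noteq> 0\<^sub>v n \<and> ?A *\<^sub>v v = 0\<^sub>v n)"
    unfolding fdet_def by (rule det_0_iff_vec_prod_zero_field) simp
  also have "\<dots> \<longleftrightarrow> (\<exists>c. (\<exists>j<n. c j \<noteq> 0) \<and> (\<forall>i<n. (\<Sum>j<n. M i j * c j) = 0))"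
  proof
    assume "\<exists>v. v \<in> carrier_vec n \<and> v \<noteq> 0\<^sub>v n \<and> ?A *\<^sub>v v = 0\<^sub>v n"
    then obtain v where v: "v \<in> carrier_vec n" "v \<noteq> 0\<^sub>v n" "?A *\<^sub>v v = 0\<^sub>v n" by blast
    show "\<exists>c. (\<exists>j<n. c j \<noteq> 0) \<and> (\<forall>i<n. (\<Sum>j<n. M i j * c j) = 0)"
      using v mv[OF v(1)] by (intro exI[of _ "\<lambda>j. v $ j"]) (auto simp: vec_eq_iff)
  next
    assume "\<exists>c. (\<exists>j<n. c j \<noteq> 0) \<and> (\<forall>i<n. (\<Sum>j<n. M i j * c j) = 0)"
    then obtain c where c: "\<exists>j<n. c j \<noteq> 0" "\<forall>i<n. (\<Sum>j<n. M i j * c j) = 0" by blast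
    show "\<exists>v. v \<in> carrier_vec n \<and> v \<noteq> 0\<^sub>v n \<and> ?A *\<^sub>v v = 0\<^sub>v n"
      using c mv[of "vec n c"] by (intro exI[of _ "vec n c"]) (auto simp: vec_eq_iff)
  qed
  finally show ?thesis .
qed

text \<open>Injectivity of a square system gives solvability. In this way the existence of pencils
  with prescribed coefficients follows from a uniqueness bound, without computing
  dimensions.\<close>

lemma square_system_solvable:
  fixes M :: "nat \<Rightarrow> nat \<Rightarrow> 'a::field"
  assumes inj: "\<And>c j. (\<And>i. i < n \<Longrightarrow> (\<Sum>j<n. M i j * c j) = 0) \<Longrightarrow> j < n \<Longrightarrow> c j = 0"
  obtains c where "\<And>i. i < n \<Longrightarrow> (\<Sum>j<n. M i j * c j) = b i"
proof -
  let ?A = "mat n n (\<lambda>(i, j). M i j)"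
  have A: "?A \<in> carrier_mat n n" by simp
  have "det ?A \<noteq> 0"
    using inj fdet_eq_0_iff[of n M] unfolding fdet_def by blast
  from det_non_zero_imp_unit[OF A this, of "()"]
  obtain B where B: "B \<in> carrier_mat n n" "?A * B = 1\<^sub>m n"
    unfolding Units_def ring_mat_def by auto
  have "?A *\<^sub>v (B *\<^sub>v vec n b) = vec n b"
    using B by (subst assoc_mult_mat_vec[symmetric, of _ n n _ n]) auto
  then have "(\<Sum>j<n. M i j * ((B *\<^sub>v vec n b) $ j)) = b i" if "i < n" for i
    using that B(1) by (auto simp: vec_eq_iff scalar_prod_def lessThan_atLeast0)
  then show ?thesis using that by blast
qed

lemma homogeneous_system_nontrivial:
  fixes M :: "nat \<Rightarrow> nat \<Rightarrow> 'a::field"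
  assumes "m < n"
  obtains c where "\<exists>j<n. c j \<noteq> 0" "\<And>i. i < m \<Longrightarrow> (\<Sum>j<n. M i j * c j) = 0"
proof -
  \<comment> \<open>Zero rows make the system square; since \<open>m < n\<close>, every Leibniz
    summand then contains a zero factor.\<close>
  define M' where "M' = (\<lambda>i j. if i < m then M i j else 0)"
  have "fdet n M' = 0"
  proof -
    have "\<exists>i\<in>{0..<n}. M' i (p i) = 0" for p
      using assms by (intro bexI[of _ m]) (auto simp: M'_def)
    then have pz: "(\<Prod>i = 0..<n. M' i (p i)) = 0" for p
      by (intro prod_zero) auto
    show ?thesis unfolding fdet_altdef pz by simp
  qed
  then obtain c where c: "\<exists>j<n. c j \<noteq> 0" "\<forall>i<n. (\<Sum>j<n. M' i j * c j) = 0"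
    unfolding fdet_eq_0_iff by blast
  have "(\<Sum>j<n. M i j * c j) = 0" if "i < m" for i
    using c(2)[rule_format, of i] that assms by (simp add: M'_def)
  then show ?thesis using that c(1) by blast
qed

section \<open>Determinants of polynomial matrices\<close>

lemma poly_signof [simp]: "poly (signof p) x = signof p"
  by (simp add: sign_def)

lemma poly_fdet: "poly (fdet n M) x = fdet n (\<lambda>i j. poly (M i j) x)"
  unfolding fdet_altdef by (simp add: poly_sum poly_prod)

lemma fdet_row_scale: "fdet n (\<lambda>i j. r i * M i j) = (\<Prod>i<n. r i) * fdet n M"
  unfolding fdet_altdef
  by (simp add: prod.distrib sum_distrib_left mult.left_commute lessThan_atLeast0)

lemma fdet_col_scale: "fdet n (\<lambda>i j. r j * M i j) = (\<Prod>j<n. r j) * fdet n M"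
proof -
  have "(\<Prod>i = 0..<n. r (p i)) = (\<Prod>j<n. r j)" if "p permutes {0..<n}" for p
    using prod.permute[OF that, of r] by (simp add: lessThan_atLeast0 o_def)
  then show ?thesis
    unfolding fdet_altdef by (simp add: prod.distrib sum_distrib_left mult.left_commute)
qed

lemma signof_mult_degree: "degree (signof p * q :: 'a::comm_ring_1 poly) = degree q"
  by (simp add: sign_def)

lemma coeff_signof_mult: "coeff (signof p * q) k = signof p * coeff (q :: 'a::comm_ring_1 poly) k"
  by (simp add: sign_def)

lemma coeff_mult_le_degrees:
  assumes "degree p \<le> m" "degree q \<le> n"
  shows "coeff (p * q) (m + n) = coeff p m * coeff q n"
proof -
  have "coeff (p * q) (m + n) = (\<Sum>i\<le>m + n. coeff p i * coeff q (m + n - i))"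
    by (simp add: coeff_mult)
  also have "\<dots> = (\<Sum>i\<in>{m}. coeff p i * coeff q (m + n - i))"
  proof (intro sum.mono_neutral_right ballI)
    fix i assume "i \<in> {..m + n} - {m}"
    then have "degree p < i \<or> degree q < m + n - i" using assms by auto
    then show "coeff p i * coeff q (m + n - i) = 0" by (auto simp: coeff_eq_0)
  qed auto
  finally show ?thesis by simp
qed

lemma degree_prod_le_coeff:
  fixes f :: "'b \<Rightarrow> 'a::comm_semiring_1 poly"
  assumes "finite I" "\<And>i. i \<in> I \<Longrightarrow> degree (f i) \<le> k i"
  shows "degree (prod f I) \<le> sum k I \<and> coeff (prod f I) (sum k I) = (\<Prod>i\<in>I. coeff (f i) (k i))"
  using assms
proof (induction I)
  case (insert a I)
  then have IH: "degree (prod f I) \<le> sum k I" "coeff (prod f I) (sum k I) = (\<Prod>i\<in>I. coeff (f i) (k i))"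
    and a: "degree (f a) \<le> k a" by auto
  have "coeff (f a * prod f I) (k a + sum k I) = coeff (f a) (k a) * coeff (prod f I) (sum k I)"
    using a IH(1) by (rule coeff_mult_le_degrees)
  moreover have "degree (f a * prod f I) \<le> k a + sum k I"
    using degree_mult_le[of "f a" "prod f I"] a IH(1) by linarith
  ultimately show ?case using insert IH by simp
qed auto

text \<open>A permutation meets every column exactly once, so the column bounds \<open>k\<close> add
  up to the same total in each Leibniz summand, and the top coefficients again form a
  determinant.\<close>

lemma fdet_degree_coeff:
  fixes M :: "nat \<Rightarrow> nat \<Rightarrow> 'a::comm_ring_1 poly"
  assumes deg: "\<And>i j. i < n \<Longrightarrow> j < n \<Longrightarrow> degree (M i j) \<le> k j"
  shows "degree (fdet n M) \<le> (\<Sum>j<n. k j)"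
    and "coeff (fdet n M) (\<Sum>j<n. k j) = fdet n (\<lambda>i j. coeff (M i j) (k j))"
proof -
  have *: "degree (\<Prod>i = 0..<n. M i (p i)) \<le> (\<Sum>j<n. k j) \<and>
      coeff (\<Prod>i = 0..<n. M i (p i)) (\<Sum>j<n. k j) = (\<Prod>i = 0..<n. coeff (M i (p i)) (k (p i)))"
    if p: "p permutes {0..<n}" for p
  proof -
    have "(\<Sum>i = 0..<n. k (p i)) = (\<Sum>j<n. k j)"
      using sum.permute[OF p, of k] by (simp add: lessThan_atLeast0 o_def)
    moreover have "degree (M i (p i)) \<le> k (p i)" if "i \<in> {0..<n}" for i
      using that p by (intro deg) (auto simp: permutes_in_image)
    ultimately show ?thesis
      using degree_prod_le_coeff[of "{0..<n}" "\<lambda>i. M i (p i)" "\<lambda>i. k (p i)"] by simp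
  qed
  show "degree (fdet n M) \<le> (\<Sum>j<n. k j)"
    unfolding fdet_altdef using * by (intro degree_sum_le) (auto simp: signof_mult_degree finite_permutations)
  show "coeff (fdet n M) (\<Sum>j<n. k j) = fdet n (\<lambda>i j. coeff (M i j) (k j))"
    unfolding fdet_altdef using * by (simp add: coeff_sum coeff_signof_mult)
qed

lemma fdet_eq_rows:
  assumes "i < n" "i' < n" "i \<noteq> i'" "\<And>j. j < n \<Longrightarrow> M i j = M i' j"
  shows "fdet n M = 0"
  unfolding fdet_def using assms
  by (intro det_identical_rows[of _ n i i']) auto

lemma pderiv_signof_mult: "pderiv (signof p * q) = signof p * pderiv (q :: 'a::idom poly)"
  by (simp add: sign_def pderiv_minus)

lemma pderiv_fdet:
  fixes M :: "nat \<Rightarrow> nat \<Rightarrow> 'a::idom poly"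
  shows "pderiv (fdet n M) = (\<Sum>r<n. fdet n (\<lambda>i j. if i = r then pderiv (M i j) else M i j))"
proof -
  have *: "pderiv (\<Prod>i = 0..<n. M i (p i)) =
      (\<Sum>r<n. \<Prod>i = 0..<n. if i = r then pderiv (M i (p i)) else M i (p i))" for p
  proof -
    have "(\<Prod>i = 0..<n. if i = r then pderiv (M i (p i)) else M i (p i)) =
      (\<Prod>i\<in>{0..<n} - {r}. M i (p i)) * pderiv (M r (p r))" if "r < n" for r
      using that by (subst prod.remove[of _ r]) (auto simp: mult.commute intro!: prod.cong)
    then show ?thesis
      by (subst pderiv_prod) (auto simp: lessThan_atLeast0 intro!: sum.cong)
  qed
  have "pderiv (fdet n M) = (\<Sum>p | p permutes {0..<n}. signof p * pderiv (\<Prod>i = 0..<n. M i (p i)))"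
    unfolding fdet_altdef by (simp add: higher_pderiv_sum[of 1, simplified] pderiv_signof_mult)
  also have "\<dots> = (\<Sum>p | p permutes {0..<n}. \<Sum>r<n. signof p *
      (\<Prod>i = 0..<n. if i = r then pderiv (M i (p i)) else M i (p i)))"
    unfolding * by (simp add: sum_distrib_left)
  also have "\<dots> = (\<Sum>r<n. fdet n (\<lambda>i j. if i = r then pderiv (M i j) else M i j))"
    unfolding fdet_altdef by (subst sum.swap) (simp add: if_distrib cong: if_cong)
  finally show ?thesis .
qed

text \<open>Differentiating any row but the last produces two equal rows. Only the last row
  contributes, and its order rises from \<open>n - 1\<close> to \<open>n\<close>.\<close>

lemma pderiv_wronskian:
  fixes F :: "nat \<Rightarrow> 'a::idom poly"
  assumes "n > 0"
  shows "pderiv (fdet n (\<lambda>i j. (pderiv ^^ i) (F j))) =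
    fdet n (\<lambda>i j. (pderiv ^^ (if i = n - 1 then n else i)) (F j))"
proof -
  let ?R = "\<lambda>r. fdet n (\<lambda>i j. if i = r then pderiv ((pderiv ^^ i) (F j)) else (pderiv ^^ i) (F j))"
  have "?R r = 0" if "r < n" "r \<noteq> n - 1" for r
    using that by (intro fdet_eq_rows[of r _ "Suc r"]) auto
  then have "(\<Sum>r<n. ?R r) = (\<Sum>r\<in>{n - 1}. ?R r)"
    using assms by (intro sum.mono_neutral_right) auto
  also have "\<dots> = fdet n (\<lambda>i j. (pderiv ^^ (if i = n - 1 then n else i)) (F j))"
  proof -
    have "pderiv ((pderiv ^^ (n - 1)) q) = (pderiv ^^ n) q" for q :: "'a poly"
      using assms by (cases n) simp_all
    then show ?thesis by (auto intro!: fdet_cong)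
  qed
  finally show ?thesis by (simp add: pderiv_fdet)
qed

section \<open>Polynomials over a field\<close>

lemma coprime_poly_bezout:
  fixes a b :: "'a::field poly"
  assumes "coprime a b"
  obtains u v where "u * a + v * b = 1"
proof -
  have "coprime a b \<Longrightarrow> \<exists>u v. u * a + v * b = 1"
  \<comment> \<open>The measure shifts degrees by one, so that in Euclid's algorithm the zero
    polynomial ranks below the nonzero constants.\<close>
  proof (induction "if b = 0 then 0 else Suc (degree b)" arbitrary: a b rule: less_induct)
    case less
    show ?case
    proof (cases "b = 0")
      case True
      with less.prems have "a dvd 1" by simp
      then obtain u where "1 = a * u" by (elim dvdE)
      then show ?thesis by (intro exI[of _ u] exI[of _ 0]) (simp add: mult.commute)
    next
      case False
      have "coprime b (a mod b)"
        using less.prems False by (simp add: coprime_commute)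
      moreover have "(if a mod b = 0 then 0 else Suc (degree (a mod b))) < (if b = 0 then 0 else Suc (degree b))"
        using degree_mod_less[OF False, of a] False by auto
      ultimately obtain u v where uv: "u * b + v * (a mod b) = 1"
        using less.hyps by blast
      have "v * a + (u - v * (a div b)) * b = u * b + v * (a - a div b * b)"
        by (simp add: algebra_simps)
      also have "a - a div b * b = a mod b"
        by (simp add: minus_div_mult_eq_mod)
      finally show ?thesis using uv by metis
    qed
  qed
  with assms that show ?thesis by blast
qed

lemma coprime_poly_dvd_mult:
  fixes a b c :: "'a::field poly"
  assumes "coprime a b" "a dvd b * c"
  shows "a dvd c"
proof -
  obtain u v where uv: "u * a + v * b = 1" using coprime_poly_bezout[OF assms(1)] .
  have "c = (u * c) * a + v * (b * c)"
    using arg_cong[OF uv, of "\<lambda>w. w * c"] by (simp add: algebra_simps)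
  moreover have "a dvd (u * c) * a + v * (b * c)"
    by (rule dvd_add[OF dvd_triv_right dvd_mult[OF assms(2)]])
  ultimately show ?thesis by simp
qed

lemma coprime_polyI_root:
  fixes a b :: "'a::alg_closed_field poly"
  assumes "a \<noteq> 0 \<or> b \<noteq> 0" "\<And>x. poly a x = 0 \<Longrightarrow> poly b x = 0 \<Longrightarrow> False"
  shows "coprime a b"
proof (rule coprimeI)
  fix c assume c: "c dvd a" "c dvd b"
  with assms(1) have "c \<noteq> 0" by auto
  have "degree c = 0"
  proof (rule ccontr)
    assume "degree c \<noteq> 0"
    then obtain x where "poly c x = 0" using alg_closed_imp_poly_has_root[of c] by auto
    with c assms(2)[of x] show False by (auto elim!: dvdE)
  qed
  with \<open>c \<noteq> 0\<close> show "is_unit c" by (simp add: is_unit_iff_degree)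
qed

lemma coprime_poly_no_common_root:
  fixes a b :: "'a::field poly"
  assumes "coprime a b" "poly a x = 0" "poly b x = 0"
  shows False
proof -
  obtain u v where "u * a + v * b = 1" using coprime_poly_bezout[OF assms(1)] .
  then have "poly (u * a + v * b) x = 1" by simp
  with assms show False by simp
qed

lemma coprime_decomposition:
  fixes a b :: "'a::field poly"
  assumes "a \<noteq> 0"
  obtains g a' b' where "a = g * a'" "b = g * b'" "coprime a' b'"
proof -
  have "a \<noteq> 0 \<Longrightarrow> \<exists>g a' b'. a = g * a' \<and> b = g * b' \<and> coprime a' b'"
  proof (induction "degree a" arbitrary: a b rule: less_induct)
    case less
    show ?case
    proof (cases "coprime a b")
      case True
      then show ?thesis by (intro exI[of _ 1] exI[of _ a] exI[of _ b]) auto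
    next
      case False
      then obtain c where c: "c dvd a" "c dvd b" "\<not> is_unit c"
        by (auto simp: coprime_def)
      then obtain a1 b1 where ab: "a = c * a1" "b = c * b1" by (elim dvdE)
      have "degree c \<noteq> 0" using c less.prems ab(1) by (auto simp: is_unit_iff_degree)
      then have "degree a1 < degree a" "a1 \<noteq> 0"
        using less.prems ab(1) by (auto simp: degree_mult_eq)
      then obtain g a' b' where "a1 = g * a'" "b1 = g * b'" "coprime a' b'"
        using less.hyps by blast
      then show ?thesis by (intro exI[of _ "c * g"] exI[of _ a'] exI[of _ b']) (simp add: ab mult.assoc)
    qed
  qed
  with assms that show ?thesis by blast
qed

section \<open>Zeros counted by degree\<close>

lemma prod_linear_power_dvd:
  fixes N :: "'a::field poly"
  assumes "finite S" "\<And>c. c \<in> S \<Longrightarrow> [:-c, 1:] ^ m c dvd N"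
  shows "(\<Prod>c\<in>S. [:-c, 1:] ^ m c) dvd N"
proof (cases "N = 0")
  case False
  from assms show ?thesis
  proof (induction S)
    case (insert a S)
    then have "(\<Prod>c\<in>S. [:-c, 1:] ^ m c) dvd N" by auto
    then obtain Q where Q: "N = (\<Prod>c\<in>S. [:-c, 1:] ^ m c) * Q" by (elim dvdE)
    have "(\<Prod>c\<in>S. [:-c, 1:] ^ m c) \<noteq> 0" "Q \<noteq> 0" using False Q by auto
    have "order a (\<Prod>c\<in>S. [:-c, 1:] ^ m c) = 0"
      using insert.hyps by (intro order_0I) (auto simp: poly_prod)
    then have "order a N = order a Q"
      using False Q by (simp add: order_mult)
    moreover have "m a \<le> order a N"
      using insert.prems[of a] False by (simp add: order_divides)
    ultimately have "[:-a, 1:] ^ m a dvd Q"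
      using \<open>Q \<noteq> 0\<close> by (simp add: order_divides)
    then have "(\<Prod>c\<in>S. [:-c, 1:] ^ m c) * [:-a, 1:] ^ m a dvd N"
      unfolding Q by (intro mult_dvd_mono) auto
    then show ?case using insert.hyps by (simp add: mult.commute)
  qed auto
qed auto

text \<open>All Riemann-Hurwitz contradictions below come from this count, applied to the Wronskian
  of a pencil or to a common factor of its members.\<close>

lemma sum_mult_le_degree:
  fixes N :: "'a::field poly"
  assumes "finite S" "\<And>c. c \<in> S \<Longrightarrow> [:-c, 1:] ^ m c dvd N" "N \<noteq> 0"
  shows "(\<Sum>c\<in>S. m c) \<le> degree N"
proof -
  have "degree (\<Prod>c\<in>S. [:-c, 1:] ^ m c) = (\<Sum>c\<in>S. m c)"
    by (subst degree_prod_sum_eq) (auto simp: degree_power_eq)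
  with dvd_imp_degree_le[OF prod_linear_power_dvd[OF assms(1,2)]] assms(3) show ?thesis by auto
qed

lemma mult_le_degree2:
  fixes N :: "'a::field poly"
  assumes "[:-a, 1:] ^ i dvd N" "[:-b, 1:] ^ j dvd N" "a \<noteq> b" "N \<noteq> 0"
  shows "i + j \<le> degree N"
proof -
  let ?m = "\<lambda>x. if x = a then i else j"
  have "[:-x, 1:] ^ ?m x dvd N" if "x \<in> {a, b}" for x
    using that assms by auto
  from sum_mult_le_degree[OF _ this assms(4), of "{a, b}"] show ?thesis using assms(3) by simp
qed

lemma mult_le_degree3:
  fixes N :: "'a::field poly"
  assumes "[:-a, 1:] ^ i dvd N" "[:-b, 1:] ^ j dvd N" "[:-c, 1:] ^ k dvd N"
    "a \<noteq> b" "a \<noteq> c" "b \<noteq> c" "N \<noteq> 0"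
  shows "i + j + k \<le> degree N"
proof -
  let ?m = "\<lambda>x. if x = a then i else if x = b then j else k"
  have "[:-x, 1:] ^ ?m x dvd N" if "x \<in> {a, b, c}" for x
    using that assms by auto
  from sum_mult_le_degree[OF _ this assms(7), of "{a, b, c}"] show ?thesis using assms(4-6) by simp
qed

lemma mult_le_degree4:
  fixes N :: "'a::field poly"
  assumes "[:-a, 1:] ^ i dvd N" "[:-b, 1:] ^ j dvd N" "[:-c, 1:] ^ k dvd N" "[:-d, 1:] ^ l dvd N"
    "a \<noteq> b" "a \<noteq> c" "b \<noteq> c" "a \<noteq> d" "b \<noteq> d" "c \<noteq> d" "N \<noteq> 0"
  shows "i + j + k + l \<le> degree N"
proof -
  let ?m = "\<lambda>x. if x = a then i else if x = b then j else if x = c then k else l"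
  have "[:-x, 1:] ^ ?m x dvd N" if "x \<in> {a, b, c, d}" for x
    using that assms by auto
  from sum_mult_le_degree[OF _ this assms(11), of "{a, b, c, d}"] show ?thesis using assms(5-10) by simp
qed

lemma power_dvd_pderiv:
  fixes A :: "'a::idom poly"
  assumes "l ^ n dvd A"
  shows "l ^ (n - 1) dvd pderiv A"
proof (cases n)
  case (Suc m)
  obtain B where A: "A = l ^ n * B" using assms by (elim dvdE)
  have "pderiv A = l ^ m * (l * pderiv B + smult (of_nat n) (pderiv l) * B)"
    unfolding A Suc pderiv_mult pderiv_power_Suc by (simp add: algebra_simps del: of_nat_Suc)
  then show ?thesis by (simp add: Suc)
qed auto

text \<open>The numerator of the derivative of A / B; for coprime A and B its zeros are the finite
  ramification points. A change of basis of the pencil only multiplies it by a scalar, so at each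
  point it can be evaluated with the member that vanishes there.\<close>

definition wr :: "'a::idom poly \<Rightarrow> 'a poly \<Rightarrow> 'a poly" where
  "wr A B = pderiv A * B - A * pderiv B"

text \<open>Each summand of the Wronskian differentiates only one of its two factors, so only one
  power of \<open>l\<close> is lost altogether.\<close>

lemma wr_dvd:
  assumes "l ^ a dvd A" "l ^ b dvd B"
  shows "l ^ (a + b - 1) dvd wr A B"
proof -
  have 1: "l ^ (a + b - 1) dvd pderiv A * B"
  proof (cases "a = 0")
    case True
    then show ?thesis
      using dvd_mult[OF dvd_trans[OF le_imp_power_dvd[of "b - 1" b l] assms(2)]] by simp
  next
    case False
    then have "a + b - 1 = (a - 1) + b" by auto
    then show ?thesis
      using mult_dvd_mono[OF power_dvd_pderiv[OF assms(1)] assms(2)] by (simp add: power_add)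
  qed
  have 2: "l ^ (a + b - 1) dvd A * pderiv B"
  proof (cases "b = 0")
    case True
    then show ?thesis
      using dvd_mult2[OF dvd_trans[OF le_imp_power_dvd[of "a - 1" a l] assms(1)]] by simp
  next
    case False
    then have "a + b - 1 = a + (b - 1)" by auto
    then show ?thesis
      using mult_dvd_mono[OF assms(1) power_dvd_pderiv[OF assms(2)]] by (simp add: power_add)
  qed
  show ?thesis unfolding wr_def using 1 2 by (rule dvd_diff)
qed

lemma wr_dvd_root:
  assumes "poly A x = 0" "poly B x = 0"
  shows "poly (wr A B) x = 0"
  using assms by (simp add: wr_def)

lemma degree_pderiv_le_diff: "degree (pderiv p) \<le> degree p - 1"
  by (rule degree_le) (auto simp: coeff_pderiv coeff_eq_0)

lemma degree_wr_le:
  assumes "degree A \<le> a" "degree B \<le> b"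
  shows "degree (wr A B) \<le> a + b - 1"
proof -
  have pd: "degree (pderiv p * q) \<le> i + j - 1" if "degree p \<le> i" "degree q \<le> j" for p q :: "'a poly" and i j
  proof (cases "pderiv p = 0")
    case False
    then have "degree p \<noteq> 0" by (metis degree_eq_zeroE pderiv_singleton)
    with that degree_mult_le[of "pderiv p" q] degree_pderiv_le_diff[of p] show ?thesis by linarith
  qed auto
  show ?thesis unfolding wr_def
    using pd[OF assms] pd[OF assms(2,1)] by (intro degree_diff_le) (auto simp: ac_simps)
qed

lemma wr_minus_left: "wr (A - B) B = wr A B"
  by (simp add: wr_def pderiv_diff algebra_simps)

lemma wr_pencil: "wr (A - B) (A - smult m B) = smult (1 - m) (wr A B)"
  by (simp add: wr_def pderiv_diff pderiv_smult algebra_simps smult_diff_left smult_diff_right)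

lemma wr_pencil': "wr A (A - smult m B) = smult (- m) (wr A B)"
  by (simp add: wr_def pderiv_diff pderiv_smult algebra_simps smult_diff_right)

lemma wr_pencil'': "wr (A - smult m B) B = wr A B"
  by (simp add: wr_def pderiv_diff pderiv_smult algebra_simps)

lemma wr_mult: "wr (g * A) (g * B) = g^2 * wr A B"
  by (simp add: wr_def pderiv_mult algebra_simps power2_eq_square)

text \<open>Translation moves the root to 0. Divisibility then becomes \<open>k\<close> linear
  equations for the coefficients, in any characteristic.\<close>

lemma dvd_iff_coeff_pcompose:
  fixes p :: "'a::idom poly"
  shows "[:-a, 1:] ^ k dvd p \<longleftrightarrow> (\<forall>i<k. coeff (pcompose p [:a, 1:]) i = 0)"
proof -
  have hom: "pcompose (q * r) s = pcompose q s * pcompose r s" for q r s :: "'a poly"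
    by (rule pcompose_mult)
  have pw: "pcompose (q ^ k) s = pcompose q s ^ k" for q s :: "'a poly" and k
    by (induction k) (simp_all add: hom one_pCons)
  have "[:-a, 1:] ^ k dvd p \<longleftrightarrow> monom 1 k dvd pcompose p [:a, 1:]"
  proof
    assume "[:-a, 1:] ^ k dvd p"
    then obtain q where "p = [:-a, 1:] ^ k * q" by (elim dvdE)
    then have "pcompose p [:a, 1:] = monom 1 k * pcompose q [:a, 1:]"
      by (simp add: hom pw pcompose_pCons monom_altdef)
    then show "monom 1 k dvd pcompose p [:a, 1:]" by simp
  next
    assume "monom 1 k dvd pcompose p [:a, 1:]"
    then obtain q where "pcompose p [:a, 1:] = [:0, 1:] ^ k * q"
      by (elim dvdE) (simp add: monom_altdef)
    then have "pcompose (pcompose p [:a, 1:]) [:-a, 1:] = [:-a, 1:] ^ k * pcompose q [:-a, 1:]"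
      by (simp add: hom pw pcompose_pCons)
    moreover have "pcompose (pcompose p [:a, 1:]) [:-a, 1:] = p"
      by (simp add: pcompose_assoc[symmetric] pcompose_pCons)
    ultimately show "[:-a, 1:] ^ k dvd p" by simp
  qed
  then show ?thesis by (simp add: monom_1_dvd_iff')
qed

text \<open>Differentiation lowers a positive order \<open>m\<close> of vanishing by exactly one if
  \<open>m\<close> is invertible, and the second hypothesis guarantees this for every
  \<open>m\<close> below \<open>n\<close>.\<close>

lemma higher_pderiv_zero_imp_dvd:
  fixes F :: "'a::field poly"
  assumes "\<And>i. i < n \<Longrightarrow> poly ((pderiv ^^ i) F) x = 0"
    and "\<And>i. 0 < i \<Longrightarrow> i < n \<Longrightarrow> of_nat i \<noteq> (0::'a)"
  shows "[:-x, 1:] ^ n dvd F"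
  using assms
proof (induction n arbitrary: F)
  case (Suc n)
  have 1: "[:-x, 1:] ^ n dvd pderiv F"
  proof (rule Suc.IH)
    fix i assume "i < n"
    then show "poly ((pderiv ^^ i) (pderiv F)) x = 0"
      using Suc.prems(1)[of "Suc i"] by (simp add: funpow_swap1)
  qed (use Suc.prems(2) in auto)
  show ?case
  proof (cases "F = 0")
    case False
    define m where "m = order x F"
    have "poly F x = 0" using Suc.prems(1)[of 0] by simp
    then have "m > 0" using False by (simp add: m_def order_root)
    obtain G where G: "F = [:-x, 1:] ^ m * G" "\<not> [:-x, 1:] dvd G"
      unfolding m_def using order_decomp[OF False] by blast
    have Gx: "poly G x \<noteq> 0" using G(2) by (simp add: poly_eq_0_iff_dvd)
    have "m \<ge> Suc n"
    proof (rule ccontr)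
      assume "\<not> m \<ge> Suc n"
      then have m: "m \<le> n" by simp
      obtain k where k: "m = Suc k" using \<open>m > 0\<close> by (cases m) auto
      have "pderiv (l ^ Suc k * G) = l ^ k * (smult (of_nat (Suc k)) G + l * pderiv G)"
        if "pderiv l = 1" for l :: "'a poly"
        unfolding pderiv_mult pderiv_power_Suc using that by (simp add: algebra_simps del: of_nat_Suc)
      from this[of "[:-x, 1:]"]
      have "pderiv F = [:-x, 1:] ^ k * (smult (of_nat m) G + [:-x, 1:] * pderiv G)"
        by (simp add: G(1) k pderiv_pCons del: of_nat_Suc mult_pCons_left power_Suc)
      moreover have "[:-x, 1:] ^ m dvd pderiv F"
        using 1 m by (meson dvd_trans le_imp_power_dvd)
      ultimately have "[:-x, 1:] ^ k * [:-x, 1:] dvd [:-x, 1:] ^ k * (smult (of_nat m) G + [:-x, 1:] * pderiv G)"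
        by (simp add: k mult.commute del: mult_pCons_left mult_pCons_right)
      then have "[:-x, 1:] dvd smult (of_nat m) G + [:-x, 1:] * pderiv G"
        by (subst (asm) dvd_mult_cancel_left) auto
      then have "poly (smult (of_nat m) G + [:-x, 1:] * pderiv G) x = 0"
        by (simp only: poly_eq_0_iff_dvd)
      with Gx have "of_nat m = (0::'a)" by simp
      with Suc.prems(2)[of m] m \<open>m > 0\<close> show False by simp
    qed
    then show ?thesis unfolding G(1) by (meson dvd_mult2 le_imp_power_dvd)
  qed auto
qed auto

lemma dvd_imp_higher_pderiv_zero:
  fixes F :: "'a::idom poly"
  assumes "[:-x, 1:] ^ n dvd F" "i < n"
  shows "poly ((pderiv ^^ i) F) x = 0"
  using assms
proof (induction i arbitrary: n F)
  case 0
  then have "[:-x, 1:] dvd F" by (cases n) (auto intro: dvd_trans[OF dvd_triv_left])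
  then show ?case by (simp add: poly_eq_0_iff_dvd)
next
  case (Suc i)
  then have "poly ((pderiv ^^ i) (pderiv F)) x = 0"
    using power_dvd_pderiv[OF Suc.prems(1)] by (intro Suc.IH[of "n - 1"]) auto
  then show ?case by (simp add: funpow_swap1)
qed

lemma card_simple_roots:
  fixes G :: "'a::alg_closed_field poly"
  assumes "G \<noteq> 0" "\<And>x. poly G x = 0 \<Longrightarrow> poly (pderiv G) x \<noteq> 0"
  shows "finite {x. poly G x = 0}" "card {x. poly G x = 0} = degree G"
proof -
  show fin: "finite {x. poly G x = 0}" using assms(1) by (rule poly_roots_finite)
  obtain A where A: "size A = degree G" "G = smult (lead_coeff G) (\<Prod>x\<in>#A. [:-x, 1:])"
    using alg_closed_imp_factorization[OF assms(1)] by blast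
  have "poly G x = 0 \<longleftrightarrow> x \<in># A" for x
    using assms(1) by (subst A(2)) (auto simp: poly_prod_mset)
  then have roots: "{x. poly G x = 0} = set_mset A" by auto
  have "count A x \<le> 1" for x
  proof (rule ccontr)
    assume "\<not> count A x \<le> 1"
    then have "{#x, x#} \<subseteq># A"
      by (intro mset_subset_eqI) auto
    then obtain C where "A = {#x, x#} + C" by (metis subset_mset.le_iff_add)
    then have "(\<Prod>x\<in>#A. [:-x, 1:]) = [:-x, 1:] ^ 2 * (\<Prod>x\<in>#C. [:-x, 1:])"
      by (simp add: power2_eq_square mult.assoc del: mult_pCons_left mult_pCons_right)
    then have "[:-x, 1:] ^ 2 dvd (\<Prod>x\<in>#A. [:-x, 1:])" by simp
    then have "[:-x, 1:] ^ 2 dvd G"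
      by (subst A(2)) (rule dvd_smult)
    from dvd_imp_higher_pderiv_zero[OF this, of 0] dvd_imp_higher_pderiv_zero[OF this, of 1]
      assms(2)[of x] show False by simp
  qed
  then have "count A x = (if x \<in># A then 1 else 0)" for x
    by (metis One_nat_def count_eq_zero_iff count_greater_zero_iff le_antisym Suc_leI)
  then have "A = mset_set (set_mset A)"
    by (intro multiset_eqI) (auto simp: count_mset_set')
  then have "size A = card (set_mset A)" by (metis size_mset_set)
  with A(1) roots show "card {x. poly G x = 0} = degree G" by simp
qed

section \<open>Pencils with prescribed ramification\<close>

text \<open>The first three ramification points are $0, \infty, 1$, lying over $0, \infty, 1$, and the fourth
  branch point is \<open>mu\<close>.\<close>

locale pencil =
  fixes d e1 e2 e3 n :: nat and mu :: "'a::alg_closed_field"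
  assumes e: "1 < e1" "1 < e2" "1 < e3" "1 < n" "e1 < d" "e2 < d" "e3 < d" "n < d"
    and sum: "e1 + e2 + e3 + n = 2 * d + 2"
    and mx: "d < max e1 n + e2" "d < max e1 n + e3" "d < max e2 n + e1"
      "d < max e2 n + e3" "d < max e3 n + e1" "d < max e3 n + e2"
    and char: "CHAR('a) = 0 \<or> CHAR('a) = d \<and> prime d"
    and mu: "mu \<noteq> 0" "mu \<noteq> 1"
begin

text \<open>As a form of degree \<open>d\<close>, B vanishes to order \<open>e2\<close> at infinity
  iff its degree is at most \<open>d - e2\<close>. Coprimality and exact orders are not part of the
  condition, so that the pairs form a linear space; \<open>nondegenerate\<close> recovers both
  afterwards.\<close>

definition W :: "'a poly \<Rightarrow> 'a poly \<Rightarrow> bool" where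
  "W A B \<longleftrightarrow> degree A \<le> d \<and> degree B \<le> d - e2 \<and> [:0, 1:] ^ e1 dvd A \<and> [:-1, 1:] ^ e3 dvd A - B"

definition fourth :: "'a poly \<Rightarrow> 'a poly \<Rightarrow> 'a poly" where
  "fourth A B = A - smult mu B"

text \<open>Infinity is included because nonvanishing there makes the top \<open>n\<close>
  coefficients of \<open>fourth A B\<close> coordinates on the space \<open>W\<close>.\<close>

fun van4 :: "'a proj_line \<Rightarrow> 'a poly \<Rightarrow> bool" where
  "van4 (Fin x) F \<longleftrightarrow> [:-x, 1:] ^ n dvd F"
| "van4 Infty F \<longleftrightarrow> degree F \<le> d - n"

lemma of_nat_neq_0: "0 < i \<Longrightarrow> i < d \<Longrightarrow> of_nat i \<noteq> (0::'a)"
  using char by (auto simp: of_nat_eq_0_iff_char_dvd dest: dvd_imp_le simp del: of_nat_eq_0_iff)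

lemma smult_add_linear: "W A B \<Longrightarrow> W A' B' \<Longrightarrow> W (smult a A + smult b A') (smult a B + smult b B')"
  unfolding W_def
proof (intro conjI)
  assume "degree A \<le> d \<and> degree B \<le> d - e2 \<and> [:0, 1:] ^ e1 dvd A \<and> [:- 1, 1:] ^ e3 dvd A - B"
    and "degree A' \<le> d \<and> degree B' \<le> d - e2 \<and> [:0, 1:] ^ e1 dvd A' \<and> [:- 1, 1:] ^ e3 dvd A' - B'"
  then have h: "degree A \<le> d" "degree B \<le> d - e2" "[:0, 1:] ^ e1 dvd A" "[:- 1, 1:] ^ e3 dvd A - B"
    "degree A' \<le> d" "degree B' \<le> d - e2" "[:0, 1:] ^ e1 dvd A'" "[:- 1, 1:] ^ e3 dvd A' - B'" by auto
  show "degree (smult a A + smult b A') \<le> d"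
    using h by (intro degree_add_le order.trans[OF degree_smult_le]) auto
  show "degree (smult a B + smult b B') \<le> d - e2"
    using h by (intro degree_add_le order.trans[OF degree_smult_le]) auto
  show "[:0, 1:] ^ e1 dvd smult a A + smult b A'"
    using h by (intro dvd_add dvd_smult)
  have "smult a A + smult b A' - (smult a B + smult b B') = smult a (A - B) + smult b (A' - B')"
    by (simp add: algebra_simps smult_diff_right)
  also have "[:- 1, 1:] ^ e3 dvd \<dots>"
    using h by (intro dvd_add dvd_smult)
  finally show "[:- 1, 1:] ^ e3 dvd smult a A + smult b A' - (smult a B + smult b B')" .
qed

lemma W_diff: "W A B \<Longrightarrow> W A' B' \<Longrightarrow> W (A - A') (B - B')"
  using smult_add_linear[of A B A' B' 1 "-1"] by simp

lemma W_0 [simp]: "W 0 0"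
  by (simp add: W_def)

lemma W_sum: "(\<And>j. j \<in> I \<Longrightarrow> W (A j) (B j)) \<Longrightarrow> W (\<Sum>j\<in>I. smult (c j) (A j)) (\<Sum>j\<in>I. smult (c j) (B j))"
proof (induction I rule: infinite_finite_induct)
  case (insert x F)
  then show ?case using smult_add_linear[of "A x" "B x" _ _ "c x" 1] by simp
qed auto

lemma fourth_sum: "fourth (\<Sum>j\<in>I. smult (c j) (A j)) (\<Sum>j\<in>I. smult (c j) (B j)) =
    (\<Sum>j\<in>I. smult (c j) (fourth (A j) (B j)))"
proof -
  have "smult mu (\<Sum>j\<in>I. smult (c j) (B j)) = (\<Sum>j\<in>I. smult (c j) (smult mu (B j)))"
    by (induction I rule: infinite_finite_induct) (simp_all add: smult_add_right mult.commute)
  then show ?thesis by (simp add: fourth_def smult_diff_right sum_subtractf)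
qed

lemma degree_fourth_le: "W A B \<Longrightarrow> degree (fourth A B) \<le> d"
  unfolding W_def fourth_def
  by (intro degree_diff_le order.trans[OF degree_smult_le]) auto

section \<open>Pairs with vanishing Wronskian\<close>

lemma pderiv_zero_shape:
  fixes A :: "'a poly"
  assumes "pderiv A = 0" "degree A \<le> d"
  shows "\<exists>c a. A = [:c:] + monom a d \<and> (CHAR('a) = d \<or> a = 0)"
proof -
  have z: "coeff A i = 0" if "0 < i" "i < d \<or> CHAR('a) = 0" for i
  proof -
    have "of_nat i * coeff A i = 0"
      using arg_cong[OF assms(1), of "\<lambda>p. coeff p (i - 1)"] that(1) by (cases i) (simp_all add: coeff_pderiv)
    moreover have "of_nat i \<noteq> (0::'a)"
      using that of_nat_neq_0[of i] by (auto simp: of_nat_eq_0_iff_char_dvd)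
    ultimately show ?thesis by simp
  qed
  have "A = [:coeff A 0:] + monom (coeff A d) d"
  proof (intro poly_eqI)
    fix i
    have "coeff A i = 0" if "d < i" using that assms(2) by (intro coeff_eq_0) auto
    moreover consider "i = 0" | "0 < i" "i < d" | "i = d" | "d < i" by linarith
    ultimately show "coeff A i = coeff ([:coeff A 0:] + monom (coeff A d) d) i"
      using z[of i] e by cases (auto simp: coeff_pCons split: nat.splits)
  qed
  moreover have "CHAR('a) = d \<or> coeff A d = 0"
    using z[of d] e char by auto
  ultimately show ?thesis by blast
qed

text \<open>In characteristic \<open>d\<close> the pencil spanned by $x^d$ and $1$ satisfies all the conditions, but it is
  inseparable.\<close>

lemma wr_zero_cases:
  assumes W: "W A B" and wr: "wr A B = 0"
  shows "(\<exists>s t H. A = smult s H \<and> B = smult t H \<and> (s \<noteq> 0 \<or> t \<noteq> 0)) \<or>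
    (CHAR('a) = d \<and> (\<exists>a. a \<noteq> 0 \<and> A = monom a d \<and> B = [:a:]))"
proof (cases "A = 0")
  case True
  then show ?thesis by (intro disjI1 exI[of _ 0] exI[of _ 1] exI[of _ B]) auto
next
  case False
  then obtain g A0 B0 where g: "A = g * A0" "B = g * B0" "coprime A0 B0"
    using coprime_decomposition by blast
  have nz: "g \<noteq> 0" "A0 \<noteq> 0" using False g(1) by auto
  have "g^2 * wr A0 B0 = 0" using wr unfolding g(1,2) wr_mult .
  then have w0: "pderiv A0 * B0 = A0 * pderiv B0" using nz by (simp add: wr_def)
  have dA0: "degree A0 \<le> d" using W nz unfolding W_def g(1) by (simp add: degree_mult_eq)
  \<comment> \<open>Coprimality turns the vanishing Wronskian into divisibility of the derivative of
    \<open>A0\<close> by \<open>A0\<close>, which the degree forbids unless this derivative is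
    zero.\<close>
  have "A0 dvd B0 * pderiv A0" using w0 by (simp add: mult.commute)
  then have "A0 dvd pderiv A0" using coprime_poly_dvd_mult[OF g(3)] by blast
  have "pderiv A0 = 0"
  proof (rule ccontr)
    assume nz': "pderiv A0 \<noteq> 0"
    then have "degree A0 \<le> degree (pderiv A0)" using \<open>A0 dvd pderiv A0\<close> by (intro dvd_imp_degree_le)
    moreover have "degree A0 \<noteq> 0" using nz' by (metis degree_eq_zeroE pderiv_singleton)
    ultimately show False using degree_pderiv_le_diff[of A0] by linarith
  qed
  then obtain c a where A0: "A0 = [:c:] + monom a d" "CHAR('a) = d \<or> a = 0"
    using pderiv_zero_shape[OF _ dA0] by blast
  have "pderiv B0 = 0" using w0 nz \<open>pderiv A0 = 0\<close> by simp
  have dB0: "degree B0 \<le> d - e2"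
    using W nz unfolding W_def g(2) by (cases "B0 = 0") (auto simp: degree_mult_eq)
  then obtain c' a' where "B0 = [:c':] + monom a' d"
    using pderiv_zero_shape[OF \<open>pderiv B0 = 0\<close> order.trans[OF dB0 diff_le_self]] by blast
  moreover have "coeff B0 d = 0" using dB0 e by (intro coeff_eq_0) auto
  ultimately have B0: "B0 = [:c':]" using e by (auto simp: coeff_pCons split: nat.splits)
  show ?thesis
  proof (cases "a = 0")
    case True
    then show ?thesis
      using nz(2) A0(1) B0 g(1,2)
      by (intro disjI1 exI[of _ c] exI[of _ c'] exI[of _ g]) auto
  next
    case a: False
    \<comment> \<open>With \<open>a\<close> nonzero, \<open>A0\<close> has full degree
      \<open>d\<close>, so the common factor \<open>g\<close> is constant; the zero at 0 and the
      contact at 1 then fix both polynomials up to a common scalar.\<close>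
    have "coeff A0 d \<noteq> 0" using a e by (auto simp: A0 coeff_pCons split: nat.splits)
    then have "degree A0 = d" using dA0 by (simp add: le_degree antisym)
    then have "degree g = 0" using W nz unfolding W_def g(1) by (simp add: degree_mult_eq)
    then obtain k where k: "g = [:k:]" by (rule degree_eq_zeroE)
    have "poly A 0 = 0" using W e unfolding W_def
      using dvd_imp_higher_pderiv_zero[of 0 e1 A 0] by simp
    then have c: "c = 0" using e nz k by (simp add: g A0 poly_monom power_0_left)
    have "[:-1, 1:] ^ e3 dvd A - B" using W by (simp add: W_def)
    from dvd_imp_higher_pderiv_zero[OF this, of 0] have "poly A 1 = poly B 1"
      using e by simp
    then have "a = c'" using nz k c by (simp add: g A0 B0 poly_monom)
    then have "A = monom (k * a) d \<and> B = [:k * a:]" using k c by (simp add: g A0 B0 smult_monom)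
    moreover have "k * a \<noteq> 0" using nz a k by auto
    ultimately show ?thesis using A0(2) a by blast
  qed
qed

text \<open>Every member of the pencil is a multiple of \<open>H\<close>, and at most one of the
  four distinguished members is the zero multiple, since 0, infinity, 1 and \<open>mu\<close> are
  distinct. So \<open>H\<close> satisfies at least three of the four vanishing conditions, which is
  too much for its degree. If \<open>P\<close> coincides with 0, 1 or infinity, two orders at that
  point contribute only their maximum; this is where \<open>mx\<close> is used.\<close>

lemma proportional_zero:
  assumes W: "W A B" and prp: "A = smult s H" "B = smult t H" "s \<noteq> 0 \<or> t \<noteq> 0"
    and v: "van4 P (fourth A B)"
  shows "H = 0"
proof (rule ccontr)
  assume H: "H \<noteq> 0"
  have deg: "degree H \<le> d" and h1: "s \<noteq> 0 \<Longrightarrow> [:-0, 1:] ^ e1 dvd H" and h2: "t \<noteq> 0 \<Longrightarrow> degree H \<le> d - e2"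
    using W prp by (auto simp: W_def dvd_smult_iff)
  have "A - B = smult (s - t) H" using prp by (simp add: smult_diff_left)
  then have h3: "s \<noteq> t \<Longrightarrow> [:-1, 1:] ^ e3 dvd H"
    using W by (auto simp: W_def dvd_smult_iff)
  have F: "fourth A B = smult (s - mu * t) H" using prp by (simp add: fourth_def smult_diff_left)
  have h4: "s \<noteq> mu * t \<Longrightarrow> van4 P H"
    using v unfolding F by (cases P) (auto simp: dvd_smult_iff)
  have m01: "i + j \<le> degree H" if "[:-0, 1:] ^ i dvd H" "[:-1, 1:] ^ j dvd H" for i j
    using mult_le_degree2[OF that] H by simp
  have one: "i \<le> degree H" if "[:-x, 1:] ^ i dvd H" for x i
    using mult_le_degree2[OF that, of "x + 1" 0] H by simp
  have mxd: "[:-x, 1:] ^ max i j dvd H" if "[:-x, 1:] ^ i dvd H" "[:-x, 1:] ^ j dvd H" for x i j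
    using that by (simp add: max_def)
  consider "s \<noteq> 0" "t \<noteq> 0" "s \<noteq> t" | "s = 0" | "t = 0" | "s \<noteq> 0" "s = t" by blast
  then show False
  proof cases
    case 1
    then show False using m01[OF h1 h3] h2 e sum by auto
  next
    case 2
    then have t: "t \<noteq> 0" using prp by auto
    note g3 = h3[unfolded 2] and g4 = h4[unfolded 2]
    show False
    proof (cases P)
      case (Fin x)
      have v4: "[:-x, 1:] ^ n dvd H" using g4 t mu Fin by auto
      show False
      proof (cases "x = 1")
        case True
        then show False using one[OF mxd[OF _ v4, of e3]] g3 t h2 mx e by auto
      next
        case False
        then show False using mult_le_degree2[OF g3 v4] H t h2 e sum by auto
      qed
    next
      case Infty
      then show False using g4 t mu one[OF g3] h2 mx e by auto
    qed
  next
    case 3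
    then have s: "s \<noteq> 0" using prp by auto
    note g1 = h1[OF s] and g3 = h3[unfolded 3, OF s] and g4 = h4[unfolded 3, simplified, OF s]
    show False
    proof (cases P)
      case (Fin x)
      have v4: "[:-x, 1:] ^ n dvd H" using g4 Fin by auto
      consider "x = 0" | "x = 1" | "x \<noteq> 0" "x \<noteq> 1" by blast
      then show False
      proof cases
        case 1
        then show False using m01[OF mxd[OF g1, of n] g3] v4 mx deg by auto
      next
        case 2
        then show False using m01[OF g1 mxd[OF g3, of n]] v4 mx deg by auto
      next
        case 3
        then show False using mult_le_degree3[OF g1 g3 v4] H sum e deg by auto
      qed
    next
      case Infty
      then show False using g4 m01[OF g1 g3] sum e by auto
    qed
  next
    case 4
    then have t: "t \<noteq> 0" "s \<noteq> mu * t" using mu by auto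
    note g1 = h1[OF 4(1)] and g2 = h2[OF t(1)] and g4 = h4[OF t(2)]
    show False
    proof (cases P)
      case (Fin x)
      have v4: "[:-x, 1:] ^ n dvd H" using g4 Fin by auto
      show False
      proof (cases "x = 0")
        case True
        then show False using one[OF mxd[OF g1, of n]] v4 mx g2 e by auto
      next
        case False
        then show False using mult_le_degree2[OF g1 v4] H sum e g2 by auto
      qed
    next
      case Infty
      then show False using g4 one[OF g1] g2 mx e by auto
    qed
  qed
qed

lemma wr_zero_van4:
  assumes "W A B" "wr A B = 0" "van4 P (fourth A B)"
  shows "A = 0 \<and> B = 0 \<or> CHAR('a) = d \<and> (\<exists>a. a \<noteq> 0 \<and> A = monom a d \<and> B = [:a:])"
  using wr_zero_cases[OF assms(1,2)] proportional_zero[OF assms(1) _ _ _ assms(3)] by auto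

section \<open>Riemann-Hurwitz bounds for the Wronskian\<close>

lemma degree_wr_W: "W A B \<Longrightarrow> degree (wr A B) \<le> 2 * d - e2 - 1"
  using degree_wr_le[of A d B "d - e2"] e by (auto simp: W_def)

lemma wr_at_0: "W A B \<Longrightarrow> [:-0, 1:] ^ (e1 - 1) dvd wr A B"
  using wr_dvd[of "[:0, 1:]" e1 A 0 B] by (simp add: W_def)

lemma wr_at_1: "W A B \<Longrightarrow> [:-1, 1:] ^ (e3 - 1) dvd wr A B"
  using wr_dvd[of "[:-1, 1:]" e3 "A - B" 0 B] by (simp add: W_def wr_minus_left)

lemma wr_at_4: "[:-x, 1:] ^ k dvd fourth A B \<Longrightarrow> [:-x, 1:] ^ (k - 1) dvd wr A B"
  using wr_dvd[of "[:-x, 1:]" k "fourth A B" 0 B] by (simp add: fourth_def wr_pencil'')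

text \<open>If two ramification points collide, their orders add before one is lost: at 0, for
  instance, the Wronskian vanishes to order \<open>e1 + n - 1\<close> instead of
  \<open>(e1 - 1) + (n - 1)\<close>, and the total exceeds the degree bound by one. The inseparable
  pencil is excluded separately: \<open>x ^ d - mu\<close> is nonzero at 0 and 1 and has full
  degree.\<close>

lemma special_zero:
  assumes W: "W A B" and v: "van4 P (fourth A B)" and P: "P \<in> {Fin 0, Fin 1, Infty}"
  shows "A = 0" "B = 0"
proof -
  have "wr A B = 0"
  proof (rule ccontr)
    assume nz: "wr A B \<noteq> 0"
    from P consider "P = Fin 0" | "P = Fin 1" | "P = Infty" by blast
    then show False
    proof cases
      case 1
      then have "[:-0, 1:] ^ (e1 + n - 1) dvd wr A (fourth A B)"
        using W v by (intro wr_dvd) (auto simp: W_def)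
      then have "[:-0, 1:] ^ (e1 + n - 1) dvd wr A B"
        unfolding fourth_def wr_pencil' by (simp add: dvd_smult_iff mu)
      from mult_le_degree2[OF this wr_at_1[OF W]] nz degree_wr_W[OF W] e sum show False by simp
    next
      case 2
      then have "[:-1, 1:] ^ (e3 + n - 1) dvd wr (A - B) (fourth A B)"
        using W v by (intro wr_dvd) (auto simp: W_def)
      then have "[:-1, 1:] ^ (e3 + n - 1) dvd wr A B"
        unfolding fourth_def wr_pencil by (simp add: dvd_smult_iff mu)
      from mult_le_degree2[OF wr_at_0[OF W] this] nz degree_wr_W[OF W] e sum show False by simp
    next
      case 3
      then have "degree (wr (fourth A B) B) \<le> (d - n) + (d - e2) - 1"
        using W v by (intro degree_wr_le) (auto simp: W_def)
      then have "degree (wr A B) \<le> (d - n) + (d - e2) - 1"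
        by (simp add: fourth_def wr_pencil'')
      with mult_le_degree2[OF wr_at_0[OF W] wr_at_1[OF W]] nz e sum show False by simp
    qed
  qed
  from wr_zero_van4[OF W this v]
  have "A = 0 \<and> B = 0 \<or> (\<exists>a. a \<noteq> 0 \<and> A = monom a d \<and> B = [:a:])" by blast
  moreover have False if "a \<noteq> 0" "A = monom a d" "B = [:a:]" for a
  proof -
    have F: "fourth A B = monom a d - [:mu * a:]" using that by (simp add: fourth_def)
    have "poly (fourth A B) x = 0" if "P = Fin x" for x
      using dvd_imp_higher_pderiv_zero[of x n "fourth A B" 0] v that e by simp
    moreover have "coeff (fourth A B) d \<noteq> 0"
      using that(1) e unfolding F by (auto simp: coeff_pCons split: nat.splits)
    then have "degree (fourth A B) = d"
      using degree_fourth_le[OF W] by (simp add: le_degree antisym)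
    ultimately show False using P v mu e that unfolding F
      by (auto simp: poly_monom)
  qed
  ultimately show "A = 0" "B = 0" by blast+
qed

text \<open>The known zeros at 0, 1 and \<open>l\<close> have total order
  \<open>(e1 - 1) + (e3 - 1) + (n - 1) = 2 * d - e2 - 1\<close>, the largest possible degree of the
  Wronskian. A further zero, a higher order, a common root of A and B or a drop in degree would each
  break this balance.\<close>

lemma nondegenerate:
  assumes W: "W A B" and nz: "wr A B \<noteq> 0" and l: "l \<noteq> 0" "l \<noteq> 1"
    and F: "[:-l, 1:] ^ n dvd fourth A B"
  shows "coprime A B" "degree A = d" "degree B = d - e2"
    "\<not> [:0, 1:] ^ e1 dvd wr A B" "\<not> [:-1, 1:] ^ e3 dvd wr A B" "\<not> [:-l, 1:] ^ n dvd wr A B"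
    "\<And>x. x \<notin> {0, 1, l} \<Longrightarrow> poly (wr A B) x \<noteq> 0"
proof -
  note at = wr_at_0[OF W] wr_at_1[OF W] wr_at_4[OF F]
  note deg = degree_wr_W[OF W]
  show n0: "\<not> [:0, 1:] ^ e1 dvd wr A B"
    using mult_le_degree3[OF _ at(2,3), of 0 e1] nz l deg e sum by auto
  show n1: "\<not> [:-1, 1:] ^ e3 dvd wr A B"
    using mult_le_degree3[OF at(1) _ at(3), of 1 e3] nz l deg e sum by auto
  show nl: "\<not> [:-l, 1:] ^ n dvd wr A B"
    using mult_le_degree3[OF at(1,2), of l n] nz l deg e sum by auto
  show nx: "poly (wr A B) x \<noteq> 0" if "x \<notin> {0, 1, l}" for x
  proof
    assume "poly (wr A B) x = 0"
    then have "[:-x, 1:] ^ 1 dvd wr A B" by (simp add: poly_eq_0_iff_dvd)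
    from mult_le_degree4[OF at this] that nz l deg e sum show False by auto
  qed
  show "coprime A B"
  proof (rule coprime_polyI_root)
    show "A \<noteq> 0 \<or> B \<noteq> 0" using nz by (auto simp: wr_def)
    fix x assume x: "poly A x = 0" "poly B x = 0"
    then have dB: "[:-x, 1:] ^ 1 dvd B" by (simp add: poly_eq_0_iff_dvd)
    consider "x = 0" | "x = 1" | "x = l" | "x \<notin> {0, 1, l}" by blast
    then show False
    proof cases
      case 1
      then show False using wr_dvd[of "[:0, 1:]" e1 A 1 B] W dB n0 by (simp add: W_def)
    next
      case 2
      then show False using wr_dvd[of "[:-1, 1:]" e3 "A - B" 1 B] W dB n1 by (simp add: W_def wr_minus_left)
    next
      case 3
      then show False using wr_dvd[of "[:-l, 1:]" n "fourth A B" 1 B] F dB nl by (simp add: fourth_def wr_pencil'')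
    next
      case 4
      then show False using nx[OF 4] wr_dvd_root[OF x] by simp
    qed
  qed
  have low: "2 * d - e2 - 1 \<le> degree (wr A B)"
    using mult_le_degree3[OF at] nz l e sum by auto
  show "degree A = d"
  proof (rule ccontr)
    assume "degree A \<noteq> d"
    then have "degree A \<le> d - 1" using W by (auto simp: W_def)
    from degree_wr_le[OF this, of B "d - e2"] low e W show False by (simp add: W_def)
  qed
  show "degree B = d - e2"
  proof (rule ccontr)
    assume "degree B \<noteq> d - e2"
    then have "degree B \<le> d - e2 - 1" using W by (auto simp: W_def)
    from degree_wr_le[OF _ this, of A d] low e W show False by (simp add: W_def)
  qed
qed

text \<open>Tame covers with fixed branch points are infinitesimally rigid: $A'/B'$ is a first order
  deformation of $A/B$ that moves the fourth ramification point, so $A' B - A B'$ has too many zeros.\<close>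

lemma pencil_unique:
  assumes W: "W A B" and nz: "wr A B \<noteq> 0" and l: "l \<noteq> 0" "l \<noteq> 1"
    and F: "[:-l, 1:] ^ n dvd fourth A B"
    and W': "W A' B'" and F': "[:-l, 1:] ^ (n - 1) dvd fourth A' B'"
  obtains c where "A' = smult c A" "B' = smult c B"
proof -
  note nd = nondegenerate[OF W nz l F]
  define T where "T = A' * B - A * B'"
  have "T = 0"
  proof (rule ccontr)
    assume T: "T \<noteq> 0"
    have 0: "[:-0, 1:] ^ e1 dvd T"
      using W W' unfolding T_def by (auto simp: W_def)
    have "T = (A' - B') * B - (A - B) * B'" by (simp add: T_def algebra_simps)
    then have 1: "[:-1, 1:] ^ e3 dvd T"
      using W W' by (auto simp: W_def)
    have "T = fourth A' B' * B - fourth A B * B'" by (simp add: T_def fourth_def algebra_simps)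
    moreover have "[:-l, 1:] ^ (n - 1) dvd fourth A B"
      using F by (meson diff_le_self dvd_trans le_imp_power_dvd)
    ultimately have 2: "[:-l, 1:] ^ (n - 1) dvd T"
      using F' by auto
    \<comment> \<open>The total order \<open>e1 + e3 + (n - 1)\<close> is
      \<open>2 * d + 1 - e2\<close>, one more than this bound. So order \<open>n - 1\<close> in the
      fourth condition on the second pair is enough.\<close>
    have "degree T \<le> d + (d - e2)"
      unfolding T_def using W W' degree_mult_le[of A' B] degree_mult_le[of A B']
      by (intro degree_diff_le) (auto simp: W_def)
    with mult_le_degree3[OF 0 1 2] T l e sum show False by auto
  qed
  then have T: "A' * B = A * B'" by (simp add: T_def)
  have "A dvd B * A'" using T by (simp add: mult.commute)
  then have "A dvd A'" using coprime_poly_dvd_mult[OF nd(1)] by blast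
  then obtain q where q: "A' = A * q" by (elim dvdE)
  have A: "A \<noteq> 0" using nd(2) e by auto
  have "degree q = 0"
    using nd(2) W' A unfolding W_def q by (cases "q = 0") (auto simp: degree_mult_eq)
  then obtain c where c: "q = [:c:]" by (rule degree_eq_zeroE)
  have "A' = smult c A" using q c by simp
  moreover have "A * B' = A * smult c B" using T[unfolded \<open>A' = smult c A\<close>] by simp
  then have "B' = smult c B" using A by (simp del: mult_smult_right)
  ultimately show ?thesis using that by blast
qed

end

section \<open>Counting with a Wronskian determinant\<close>

lemma fdet_transpose: "fdet n M = fdet n (\<lambda>i j. M j i)"
proof -
  have "det (transpose_mat (mat n n (\<lambda>(i, j). M i j))) = det (mat n n (\<lambda>(i, j). M i j))"
    by (rule det_transpose[of _ n]) simp
  moreover have "transpose_mat (mat n n (\<lambda>(i, j). M i j)) = mat n n (\<lambda>(i, j). M j i)"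
    by (rule eq_matI) auto
  ultimately show ?thesis by (simp add: fdet_def)
qed

text \<open>The falling factorial x (x - 1) ... (x - i + 1). Its value at \<open>k\<close> is the
  factor by which the operator \<open>x ^ i\<close> times the \<open>i\<close>-th derivative scales
  \<open>x ^ k\<close>.\<close>

definition ffact :: "nat \<Rightarrow> 'a::idom poly" where
  "ffact i = (\<Prod>t<i. [:- of_nat t, 1:])"

lemma degree_ffact: "degree (ffact i :: 'a::idom poly) = i"
  and coeff_ffact: "coeff (ffact i :: 'a::idom poly) i = 1"
proof -
  show "degree (ffact i :: 'a poly) = i"
    unfolding ffact_def by (subst degree_prod_sum_eq) auto
  moreover have "lead_coeff (ffact i :: 'a poly) = 1"
    unfolding ffact_def by (simp add: lead_coeff_prod)
  ultimately show "coeff (ffact i :: 'a poly) i = 1" by simp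
qed

lemma poly_ffact_of_nat:
  "poly (ffact i) (of_nat k) = (if i \<le> k then pochhammer (of_nat (Suc (k - i))) i else 0)"
proof (cases "i \<le> k")
  case True
  have "pochhammer (of_nat (Suc (k - i))) i = (\<Prod>t<i. of_nat (Suc (k - i)) + of_nat (i - Suc t) :: 'a)"
    unfolding pochhammer_prod atLeast0LessThan
    by (rule prod.nat_diff_reindex[symmetric])
  also have "\<dots> = (\<Prod>t<i. of_nat k - of_nat t)"
  proof (rule prod.cong)
    fix t assume "t \<in> {..<i}"
    then have "Suc (k - i) + (i - Suc t) + t = k" using True by auto
    then have "of_nat (Suc (k - i)) + of_nat (i - Suc t) + of_nat t = (of_nat k :: 'a)"
      by (metis of_nat_add)
    then show "of_nat (Suc (k - i)) + of_nat (i - Suc t) = (of_nat k - of_nat t :: 'a)"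
      by (simp add: eq_diff_eq)
  qed auto
  finally show ?thesis using True by (simp add: ffact_def poly_prod)
next
  case False
  then have "k \<in> {..<i}" by auto
  then show ?thesis using False by (auto simp: ffact_def poly_prod intro!: prod_zero)
qed

text \<open>A Vandermonde argument: since \<open>ffact i\<close> has degree \<open>i\<close>, a
  kernel vector of the transpose would give a nonzero polynomial of degree below \<open>n\<close>
  with \<open>n\<close> distinct zeros.\<close>

lemma fdet_ffact_neq_0:
  fixes x :: "nat \<Rightarrow> 'a::field"
  assumes "inj_on x {..<n}"
  shows "fdet n (\<lambda>i j. poly (ffact i) (x j)) \<noteq> 0"
proof
  assume "fdet n (\<lambda>i j. poly (ffact i) (x j)) = 0"
  then have "fdet n (\<lambda>j i. poly (ffact i) (x j)) = 0" by (subst fdet_transpose) simp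
  then obtain c where c: "\<exists>j<n. c j \<noteq> 0" "\<forall>i<n. (\<Sum>j<n. poly (ffact j) (x i) * c j) = 0"
    unfolding fdet_eq_0_iff by blast
  define P where "P = (\<Sum>j<n. smult (c j) (ffact j))"
  define S where "S = {j. j < n \<and> c j \<noteq> 0}"
  have S: "finite S" "S \<noteq> {}" using c(1) by (auto simp: S_def)
  define m where "m = Max S"
  have m: "m < n" "c m \<noteq> 0" using Max_in[OF S] by (auto simp: m_def S_def)
  have mx: "c j = 0" if "j < n" "m < j" for j
  proof (rule ccontr)
    assume "c j \<noteq> 0"
    then have "j \<in> S" using that by (simp add: S_def)
    with Max_ge[OF S(1), of j] that show False by (simp add: m_def)
  qed
  have "coeff P m = (\<Sum>j<n. c j * coeff (ffact j) m)"
    by (simp add: P_def coeff_sum)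
  also have "\<dots> = (\<Sum>j\<in>{m}. c j * coeff (ffact j) m)"
  proof (intro sum.mono_neutral_right ballI)
    fix j assume "j \<in> {..<n} - {m}"
    then show "c j * coeff (ffact j) m = 0"
      using mx[of j] by (cases "m < j") (auto simp: coeff_eq_0 degree_ffact)
  qed (use m in auto)
  finally have "coeff P m \<noteq> 0" using m by (simp add: coeff_ffact)
  then have P: "P \<noteq> 0" by auto
  have "degree P \<le> n - 1"
    unfolding P_def by (intro degree_sum_le) (auto intro!: order.trans[OF degree_smult_le] simp: degree_ffact)
  have "x ` {..<n} \<subseteq> {y. poly P y = 0}"
    using c(2) by (auto simp: P_def poly_sum mult.commute)
  then have "card (x ` {..<n}) \<le> card {y. poly P y = 0}"
    by (intro card_mono poly_roots_finite P)
  also have "\<dots> \<le> degree P" by (rule card_poly_roots_bound[OF P])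
  finally show False using \<open>degree P \<le> n - 1\<close> m by (simp add: card_image[OF assms])
qed

section \<open>A basis of the pencils and its Wronskian determinant\<close>

context pencil begin

lemma top_zero:
  assumes W: "W A B" and z: "\<And>i. i < n \<Longrightarrow> coeff (fourth A B) (d - i) = 0"
  shows "A = 0" "B = 0"
proof -
  have "degree (fourth A B) \<le> d - n"
  proof (rule degree_le, intro allI impI)
    fix i assume i: "d - n < i"
    show "coeff (fourth A B) i = 0"
    proof (cases "i \<le> d")
      case True
      then show ?thesis using z[of "d - i"] i by auto
    next
      case False
      then show ?thesis using degree_fourth_le[OF W] by (intro coeff_eq_0) auto
    qed
  qed
  then show "A = 0" "B = 0" using special_zero[OF W, of Infty] by auto
qed

text \<open>The unknowns are the \<open>d + 1 - e1\<close> free coefficients of A and the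
  \<open>d + 1 - e2\<close> coefficients of B; the equations are the \<open>e3\<close> conditions at
  1 and the \<open>n\<close> prescribed top coefficients. By the sum formula the numbers agree, and
  \<open>top_zero\<close> makes the system injective.\<close>

lemma exists_top:
  fixes b :: "nat \<Rightarrow> 'a"
  obtains A B where "W A B" "\<And>i. i < n \<Longrightarrow> coeff (fourth A B) (d - i) = b i"
proof -
  define a N where "a = d + 1 - e1" and "N = e3 + n"
  have N: "N = a + (d + 1 - e2)" and ed: "e1 + a = d + 1" using e sum by (auto simp: a_def N_def)
  define pa pb :: "nat \<Rightarrow> 'a poly"
    where "pa = (\<lambda>j. if j < a then monom 1 (e1 + j) else 0)"
      and "pb = (\<lambda>j. if j < a then 0 else monom 1 (j - a))"
  define PA PB where "PA = (\<lambda>c. \<Sum>j<N. smult (c j) (pa j))" and "PB = (\<lambda>c. \<Sum>j<N. smult (c j) (pb j))"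
  \<comment> \<open>The first \<open>e3\<close> rows express contact at 1 after translation; the
    others read off the coefficients of degree \<open>d\<close>, ...,
    \<open>d - n + 1\<close>.\<close>
  define M where "M = (\<lambda>i j. if i < e3 then coeff (pcompose (pa j - pb j) [:1, 1:]) i
      else coeff (fourth (pa j) (pb j)) (d - (i - e3)))"
  have lin1: "(\<Sum>j<N. M i j * c j) = coeff (pcompose (PA c - PB c) [:1, 1:]) i" if "i < e3" for i c
    using that by (simp add: M_def PA_def PB_def pcompose_diff pcompose_sum pcompose_smult coeff_sum
        algebra_simps flip: sum_subtractf)
  have lin2: "(\<Sum>j<N. M (e3 + i) j * c j) = coeff (fourth (PA c) (PB c)) (d - i)" for i c
    by (simp add: M_def PA_def PB_def fourth_sum coeff_sum mult.commute)
  have Wc: "W (PA c) (PB c)" if "\<And>i. i < e3 \<Longrightarrow> (\<Sum>j<N. M i j * c j) = 0" for c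
    unfolding W_def
  proof (intro conjI)
    show "degree (PA c) \<le> d"
      unfolding PA_def using ed
      by (intro degree_sum_le order.trans[OF degree_smult_le])
        (auto simp: pa_def degree_monom_eq)
    show "degree (PB c) \<le> d - e2"
      unfolding PB_def
      by (intro degree_sum_le order.trans[OF degree_smult_le])
        (auto simp: pb_def degree_monom_eq N)
    show "[:0, 1:] ^ e1 dvd PA c"
      unfolding PA_def by (intro dvd_sum dvd_smult) (auto simp: pa_def monom_altdef le_imp_power_dvd)
    show "[:-1, 1:] ^ e3 dvd PA c - PB c"
      unfolding dvd_iff_coeff_pcompose using that lin1 by auto
  qed
  have cA: "coeff (PA c) (e1 + j) = c j" if "j < a" for c j
  proof -
    have "coeff (PA c) (e1 + j) = (\<Sum>k<N. if k = j then c k else 0)"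
      unfolding PA_def coeff_sum using that by (intro sum.cong) (auto simp: pa_def)
    then show ?thesis using that N by simp
  qed
  have cB: "coeff (PB c) j = c (a + j)" if "j < d + 1 - e2" for c j
  proof -
    have "coeff (PB c) j = (\<Sum>k<N. if k = a + j then c k else 0)"
      unfolding PB_def coeff_sum using that by (intro sum.cong) (auto simp: pb_def)
    then show ?thesis using that N by simp
  qed
  have inj: "c j = 0" if z: "\<And>i. i < N \<Longrightarrow> (\<Sum>j<N. M i j * c j) = 0" and j: "j < N" for c j
  proof -
    have "coeff (fourth (PA c) (PB c)) (d - i) = 0" if "i < n" for i
      using lin2[of i c] z[of "e3 + i"] that by (simp add: N_def)
    from top_zero[OF Wc this] z have PAB: "PA c = 0" "PB c = 0" by (auto simp: N_def)
    show "c j = 0"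
    proof (cases "j < a")
      case True
      then show ?thesis using cA[of j c] PAB by simp
    next
      case False
      then show ?thesis using cB[of "j - a" c] PAB j N by simp
    qed
  qed
  obtain c where c: "\<And>i. i < N \<Longrightarrow> (\<Sum>j<N. M i j * c j) = (if i < e3 then 0 else b (i - e3))"
    by (rule square_system_solvable[of N M "\<lambda>i. if i < e3 then 0 else b (i - e3)"]) (use inj in blast)+
  show ?thesis
  proof (rule that)
    have "(\<Sum>j<N. M i j * c j) = 0" if "i < e3" for i
      using c[of i] that by (simp add: N_def)
    then show "W (PA c) (PB c)" by (rule Wc)
    show "coeff (fourth (PA c) (PB c)) (d - i) = b i" if "i < n" for i
      using lin2[of i c] c[of "e3 + i"] that by (simp add: N_def)
  qed
qed

text \<open>The basis of \<open>W\<close> dual to the top \<open>n\<close> coefficients. For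
  \<open>j < n\<close> the polynomial \<open>F j\<close> is thus monic of degree
  \<open>d - j\<close>.\<close>

definition bs :: "nat \<Rightarrow> 'a poly \<times> 'a poly" where
  "bs j = (SOME q. W (fst q) (snd q) \<and>
     (\<forall>i<n. coeff (fourth (fst q) (snd q)) (d - i) = (if i = j then 1 else 0)))"

definition F :: "nat \<Rightarrow> 'a poly" where
  "F j = fourth (fst (bs j)) (snd (bs j))"

lemma bs: "W (fst (bs j)) (snd (bs j))" "i < n \<Longrightarrow> coeff (F j) (d - i) = (if i = j then 1 else 0)"
proof -
  obtain A B where "W A B" "\<And>i. i < n \<Longrightarrow> coeff (fourth A B) (d - i) = (if i = j then 1 else 0)"
    using exists_top[of "\<lambda>i. if i = j then 1 else 0"] by blast
  then have "\<exists>q. W (fst q) (snd q) \<and>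
     (\<forall>i<n. coeff (fourth (fst q) (snd q)) (d - i) = (if i = j then 1 else 0))"
    by (intro exI[of _ "(A, B)"]) auto
  from someI_ex[OF this] show "W (fst (bs j)) (snd (bs j))"
    "i < n \<Longrightarrow> coeff (F j) (d - i) = (if i = j then 1 else 0)"
    unfolding bs_def[symmetric] F_def by auto
qed

definition combA :: "(nat \<Rightarrow> 'a) \<Rightarrow> 'a poly" where
  "combA c = (\<Sum>j<n. smult (c j) (fst (bs j)))"

definition combB :: "(nat \<Rightarrow> 'a) \<Rightarrow> 'a poly" where
  "combB c = (\<Sum>j<n. smult (c j) (snd (bs j)))"

lemma W_comb: "W (combA c) (combB c)"
  unfolding combA_def combB_def by (intro W_sum bs)

lemma fourth_comb: "fourth (combA c) (combB c) = (\<Sum>j<n. smult (c j) (F j))"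
  by (simp add: combA_def combB_def fourth_sum F_def)

lemma coeff_comb: "i < n \<Longrightarrow> coeff (fourth (combA c) (combB c)) (d - i) = c i"
proof -
  assume i: "i < n"
  have "coeff (fourth (combA c) (combB c)) (d - i) = (\<Sum>j<n. if j = i then c j else 0)"
    unfolding fourth_comb coeff_sum using i by (intro sum.cong) (auto simp: bs(2))
  then show ?thesis using i by simp
qed

lemma W_unique:
  assumes "W A B" "W A' B'" "\<And>i. i < n \<Longrightarrow> coeff (fourth A B) (d - i) = coeff (fourth A' B') (d - i)"
  shows "A = A'" "B = B'"
proof -
  have "fourth (A - A') (B - B') = fourth A B - fourth A' B'"
    by (simp add: fourth_def smult_diff_right)
  then have "A - A' = 0" "B - B' = 0"
    using top_zero[OF W_diff[OF assms(1,2)]] assms(3) by auto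
  then show "A = A'" "B = B'" by auto
qed

lemma W_expand:
  assumes "W A B"
  obtains c where "A = combA c" "B = combB c"
  using W_unique[OF assms W_comb[of "\<lambda>j. coeff (fourth A B) (d - j)"]] coeff_comb that by metis

definition D :: "'a poly" where
  "D = fdet n (\<lambda>i j. (pderiv ^^ i) (F j))"

text \<open>The orders of the rows are given by \<open>k\<close>, so that the lemma covers
  \<open>D\<close> and also its derivative, where the last row has order \<open>n\<close>.\<close>

lemma fdet_kernel:
  "fdet n (\<lambda>i j. poly ((pderiv ^^ k i) (F j)) x) = 0 \<longleftrightarrow>
     (\<exists>A B. W A B \<and> \<not> (A = 0 \<and> B = 0) \<and> (\<forall>i<n. poly ((pderiv ^^ k i) (fourth A B)) x = 0))"
  (is "?l = ?r")
proof -
  have eq: "(\<Sum>j<n. poly ((pderiv ^^ k i) (F j)) x * c j) =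
      poly ((pderiv ^^ k i) (fourth (combA c) (combB c))) x" for c i
    by (simp add: fourth_comb higher_pderiv_sum higher_pderiv_smult poly_sum mult.commute)
  show ?thesis
  proof
    assume ?l
    then obtain c where c: "\<exists>j<n. c j \<noteq> 0" "\<forall>i<n. (\<Sum>j<n. poly ((pderiv ^^ k i) (F j)) x * c j) = 0"
      unfolding fdet_eq_0_iff by blast
    have "\<not> (combA c = 0 \<and> combB c = 0)"
      using c(1) coeff_comb[of _ c] by (auto simp: fourth_def)
    with c(2) W_comb show ?r unfolding eq by blast
  next
    assume ?r
    then obtain A B where AB: "W A B" "\<not> (A = 0 \<and> B = 0)"
      "\<forall>i<n. poly ((pderiv ^^ k i) (fourth A B)) x = 0" by blast
    obtain c where c: "A = combA c" "B = combB c" using W_expand[OF AB(1)] .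
    have "\<exists>j<n. c j \<noteq> 0"
      using AB(2) by (rule contrapos_np) (auto simp: c combA_def combB_def)
    with AB(3) show ?l unfolding fdet_eq_0_iff eq c by blast
  qed
qed

lemma taylor:
  fixes G :: "'a poly"
  assumes "k \<le> d"
  shows "(\<forall>i<k. poly ((pderiv ^^ i) G) x = 0) \<longleftrightarrow> [:-x, 1:] ^ k dvd G"
  using higher_pderiv_zero_imp_dvd[of k G x] dvd_imp_higher_pderiv_zero[of x k G] of_nat_neq_0 assms
  by (meson less_le_trans)

lemma D_root:
  "poly D x = 0 \<longleftrightarrow> (\<exists>A B. W A B \<and> \<not> (A = 0 \<and> B = 0) \<and> [:-x, 1:] ^ n dvd fourth A B)"
  unfolding D_def poly_fdet fdet_kernel[of "\<lambda>i. i"] using taylor[of n] e by simp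

lemma D_root_not_01: "poly D x = 0 \<Longrightarrow> x \<noteq> 0 \<and> x \<noteq> 1"
  unfolding D_root using special_zero[of _ _ "Fin x"] by auto

text \<open>Multiplying row \<open>i\<close> by \<open>x ^ i\<close> turns the derivatives into
  operators that only scale monomials. Column \<open>j\<close> then has degree at most
  \<open>d - j\<close>, and the top coefficient is a determinant of falling factorials at the
  exponents \<open>d\<close>, ..., \<open>d - n + 1\<close>. These stay distinct in the field
  because their differences are below \<open>d\<close>. Dividing out the powers of \<open>x\<close>
  leaves the stated degree.\<close>

lemma degree_D: "D \<noteq> 0" "degree D = n * (d + 1 - n)"
proof -
  define M where "M = (\<lambda>i j. monom 1 i * (pderiv ^^ i) (F j))"
  have cM: "coeff (M i j) k = poly (ffact i) (of_nat k) * coeff (F j) k" for i j k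
    by (simp add: M_def coeff_monom_mult coeff_higher_pderiv poly_ffact_of_nat)
  have dF: "coeff (F j) k = 0" if "d - j < k" "j < n" for j k
  proof (cases "k \<le> d")
    case True
    then show ?thesis using bs(2)[of "d - k" j] that by auto
  next
    case False
    then show ?thesis using degree_fourth_le[OF bs(1)[of j]] by (intro coeff_eq_0) (auto simp: F_def)
  qed
  have dM: "degree (M i j) \<le> d - j" if "j < n" for i j
    by (rule degree_le) (use cM dF that in auto)
  define s where "s = (\<Sum>j<n. d - j)"
  have eq: "fdet n M = monom 1 (\<Sum>i<n. i) * D"
  proof -
    have "(\<Prod>i<k. monom 1 i) = (monom 1 (\<Sum>i<k. i) :: 'a poly)" for k
      by (induction k) (simp_all add: mult_monom add.commute)
    then show ?thesis unfolding M_def D_def fdet_row_scale by simp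
  qed
  have "coeff (fdet n M) s = fdet n (\<lambda>i j. coeff (M i j) (d - j))"
    unfolding s_def by (rule fdet_degree_coeff(2)) (use dM in auto)
  also have "\<dots> = fdet n (\<lambda>i j. poly (ffact i) (of_nat (d - j)))"
    by (rule fdet_cong) (simp add: cM bs)
  also have "\<dots> \<noteq> 0"
  proof (rule fdet_ffact_neq_0, rule inj_onI)
    have *: "i = j" if "i < n" "j < n" "i \<le> j" "of_nat (d - i) = (of_nat (d - j) :: 'a)" for i j
    proof -
      have "d - i = (d - j) + (j - i)" using that e by auto
      then have "of_nat (j - i) = (0::'a)" using that(4) by (metis add_cancel_right_right of_nat_add)
      then show ?thesis using of_nat_neq_0[of "j - i"] that e by fastforce
    qed
    fix i j assume "i \<in> {..<n}" "j \<in> {..<n}" "of_nat (d - i) = (of_nat (d - j) :: 'a)"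
    then show "i = j" using *[of i j] *[of j i] by (cases "i \<le> j") auto
  qed
  finally have nz: "coeff (fdet n M) s \<noteq> 0" .
  have "degree (fdet n M) \<le> s" unfolding s_def by (rule fdet_degree_coeff(1)) (use dM in auto)
  with nz have deg: "degree (fdet n M) = s" by (simp add: le_degree antisym)
  show "D \<noteq> 0" using nz eq by auto
  then have "s = (\<Sum>i<n. i) + degree D"
    using deg unfolding eq by (subst (asm) degree_mult_eq) (auto simp: degree_monom_eq)
  moreover have "s + (\<Sum>i<n. i) = n * d"
  proof -
    have "s + (\<Sum>i<n. i) = (\<Sum>i<n. d - i + i)" by (simp add: s_def sum.distrib)
    also have "\<dots> = (\<Sum>i<n. d)" by (rule sum.cong) (use e in auto)
    finally show ?thesis by simp
  qed
  moreover have "(\<Sum>i<n. i) + (\<Sum>i<n. i) = n * (n - 1)"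
    by (induction n) (auto simp: algebra_simps)
  ultimately have "degree D + n * (n - 1) = n * d" by linarith
  moreover have "n * (d + 1 - n) + n * (n - 1) = n * d"
    unfolding distrib_left[symmetric] using e by simp
  ultimately show "degree D = n * (d + 1 - n)" by linarith
qed

text \<open>The possible positions of the fourth ramification point of a cover; the condition on the
  Wronskian keeps out the inseparable pencil.\<close>

definition good :: "'a set" where
  "good = {l. l \<noteq> 0 \<and> l \<noteq> 1 \<and> (\<exists>A B. W A B \<and> wr A B \<noteq> 0 \<and> [:-l, 1:] ^ n dvd fourth A B)}"

lemma good_imp_root: "l \<in> good \<Longrightarrow> poly D l = 0"
proof -
  assume "l \<in> good"
  then obtain A B where "W A B" "wr A B \<noteq> 0" "[:-l, 1:] ^ n dvd fourth A B"
    by (auto simp: good_def)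
  moreover from this have "\<not> (A = 0 \<and> B = 0)" by (auto simp: wr_def)
  ultimately show ?thesis unfolding D_root by blast
qed

lemma D_root_cases:
  assumes "poly D l = 0" "CHAR('a) = d \<Longrightarrow> l ^ d \<noteq> mu"
  obtains A B where "l \<noteq> 0" "l \<noteq> 1" "W A B" "wr A B \<noteq> 0" "[:-l, 1:] ^ n dvd fourth A B"
proof -
  from assms(1) obtain A B where AB: "W A B" "\<not> (A = 0 \<and> B = 0)" "[:-l, 1:] ^ n dvd fourth A B"
    unfolding D_root by blast
  have "wr A B \<noteq> 0"
  proof
    assume "wr A B = 0"
    from wr_zero_van4[OF AB(1) this, of "Fin l"] AB
    obtain a where a: "CHAR('a) = d" "a \<noteq> 0" "A = monom a d" "B = [:a:]" by auto
    have "poly (fourth A B) l = 0" using dvd_imp_higher_pderiv_zero[OF AB(3), of 0] e by simp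
    then have "a * (l ^ d - mu) = 0" by (simp add: fourth_def a poly_monom algebra_simps)
    with a assms(2) show False by simp
  qed
  with AB D_root_not_01[OF assms(1)] that show ?thesis by blast
qed

text \<open>A double zero yields a second pair whose fourth member has vanishing derivatives of
  orders 0 to \<open>n - 2\<close> and \<open>n\<close>. By rigidity it is proportional to the first
  pair, whose fourth member would then vanish to order \<open>n + 1\<close>, too high for the
  Wronskian.\<close>

lemma D_root_simple:
  assumes "poly D l = 0" "CHAR('a) = d \<Longrightarrow> l ^ d \<noteq> mu"
  shows "poly (pderiv D) l \<noteq> 0"
proof
  assume D': "poly (pderiv D) l = 0"
  obtain A B where AB: "l \<noteq> 0" "l \<noteq> 1" "W A B" "wr A B \<noteq> 0" "[:-l, 1:] ^ n dvd fourth A B"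
    using D_root_cases[OF assms] .
  let ?k = "\<lambda>i. if i = n - 1 then n else i"
  have "fdet n (\<lambda>i j. poly ((pderiv ^^ ?k i) (F j)) l) = 0"
    using D' e unfolding D_def by (subst (asm) pderiv_wronskian) (auto simp: poly_fdet)
  then obtain A' B' where AB': "W A' B'" "\<not> (A' = 0 \<and> B' = 0)"
    "\<forall>i<n. poly ((pderiv ^^ ?k i) (fourth A' B')) l = 0"
    unfolding fdet_kernel by blast
  have "poly ((pderiv ^^ i) (fourth A' B')) l = 0" if "i < n - 1" for i
    using AB'(3)[rule_format, of i] that by auto
  then have "[:-l, 1:] ^ (n - 1) dvd fourth A' B'"
    using taylor[of "n - 1" "fourth A' B'" l] e by auto
  then obtain c where c: "A' = smult c A" "B' = smult c B"
    using pencil_unique[OF AB(3,4,1,2,5) AB'(1)] by blast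
  have F': "fourth A' B' = smult c (fourth A B)"
    by (simp add: c fourth_def smult_diff_right mult.commute)
  have "c \<noteq> 0" using AB'(2) c by auto
  have "poly ((pderiv ^^ n) (fourth A' B')) l = 0"
    using AB'(3)[rule_format, of "n - 1"] e by simp
  then have "poly ((pderiv ^^ n) (fourth A B)) l = 0"
    using \<open>c \<noteq> 0\<close> by (simp add: F' higher_pderiv_smult)
  moreover have "\<forall>i<n. poly ((pderiv ^^ i) (fourth A B)) l = 0"
    using taylor[of n] AB(5) e by auto
  ultimately have "[:-l, 1:] ^ Suc n dvd fourth A B"
    using taylor[of "Suc n"] e by (auto simp: less_Suc_eq)
  then show False using wr_at_4[of l "Suc n" A B] nondegenerate(6)[OF AB(3,4,1,2,5)] by simp
qed

lemma card_good_char_0: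
  assumes "CHAR('a) = 0"
  shows "finite good" "card good = n * (d + 1 - n)"
proof -
  have "CHAR('a) \<noteq> d" using assms e by auto
  then have "good = {l. poly D l = 0}"
    using good_imp_root by (auto simp: good_def elim!: D_root_cases)
  moreover have "\<And>l. poly D l = 0 \<Longrightarrow> poly (pderiv D) l \<noteq> 0"
    using D_root_simple \<open>CHAR('a) \<noteq> d\<close> by blast
  ultimately show "finite good" "card good = n * (d + 1 - n)"
    using card_simple_roots[OF degree_D(1)] degree_D(2) by auto
qed

section \<open>The inseparable pencil in characteristic \<open>d\<close>\<close>

definition phi :: "'a \<Rightarrow> 'a" where
  "phi l = coeff ([:0, 1:] ^ (e1 - 1) * [:-1, 1:] ^ (e3 - 1) * [:-l, 1:] ^ (n - 1)) (d - 1)"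

lemma frobenius_linear:
  assumes "CHAR('a) = d"
  shows "[:-c, 1:] ^ d = monom 1 d - [:c ^ d :: 'a:]"
proof -
  have "prime d" using char assms e by auto
  have "([:-c, 1:] + [:c:]) ^ d = [:-c, 1:] ^ d + [:c:] ^ d"
    by (rule freshmans_dream) (use assms \<open>prime d\<close> in simp_all)
  moreover have "[:c:] ^ d = [:c ^ d:]" by (induction d) (simp_all add: one_pCons)
  ultimately show ?thesis by (simp add: monom_altdef)
qed

text \<open>By Frobenius, \<open>x ^ d - 1 = (x - 1) ^ d\<close>, so the contact at 1 has order
  \<open>d\<close>, beyond the required \<open>e3\<close>.\<close>

lemma inseparable_pencil:
  assumes "CHAR('a) = d"
  shows "W (monom a d) [:a:]"
proof -
  have "[:0, 1:] ^ e1 dvd monom (1::'a) d"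
    using e by (auto simp: monom_altdef le_imp_power_dvd)
  moreover have "[:-1, 1:] ^ e3 dvd [:-1, 1::'a:] ^ d" using e by (intro le_imp_power_dvd) auto
  then have "[:-1, 1:] ^ e3 dvd monom 1 d - [:1::'a:]"
    unfolding frobenius_linear[OF assms] by simp
  moreover have "monom a d = smult a (monom 1 d)" "[:a:] = smult a [:1:]"
    "monom a d - [:a:] = smult a (monom 1 d - [:1:])"
    by (simp_all add: smult_monom smult_diff_right)
  ultimately show ?thesis
    unfolding W_def by (metis degree_monom_le degree_pCons_0 dvd_smult zero_le)
qed

text \<open>For $H = A - x^d B$, all zeros of $H'$ are accounted for by the ramification, so $H'$ is a constant
  multiple of the product in the definition of \<open>phi\<close>. But a derivative has no term of degree $d - 1$ in
  characteristic $d$.\<close>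

lemma generic_pencil:
  assumes char_d: "CHAR('a) = d" and l: "l ^ d = mu" "phi l \<noteq> 0"
    and W: "W A B" and v: "[:-l, 1:] ^ n dvd fourth A B - [:c:]"
  shows "\<exists>a. A = monom a d \<and> B = [:a:]"
proof -
  have l01: "l \<noteq> 0" "l \<noteq> 1" using mu l e by (auto simp: power_0_left)
  have od: "of_nat d = (0::'a)" using char_d by (metis of_nat_CHAR)
  \<comment> \<open>By Frobenius, \<open>x ^ d\<close> differs from 1 by \<open>(x - 1) ^ d\<close>
    and from \<open>mu\<close> by \<open>(x - l) ^ d\<close>. Up to a high order at the respective
    point, \<open>H\<close> therefore agrees with \<open>A - B\<close> near 1 and with
    \<open>fourth A B\<close> near \<open>l\<close>, and it inherits the contacts at 0, 1 and
    \<open>l\<close> simultaneously.\<close>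
  define H where "H = A - monom 1 d * B"
  define Q where "Q = [:0, 1:] ^ (e1 - 1) * [:-1, 1:] ^ (e3 - 1) * [:-l, 1:] ^ (n - 1)"
  have "[:0, 1:] ^ e1 dvd H"
    using W e unfolding H_def W_def by (intro dvd_diff dvd_mult2) (auto simp: monom_altdef le_imp_power_dvd)
  then have 0: "[:-0, 1:] ^ (e1 - 1) dvd pderiv H" using power_dvd_pderiv[of "[:0, 1:]"] by simp
  have "H = (A - B) - [:-1, 1:] ^ d * B"
    unfolding frobenius_linear[OF char_d] H_def by (simp add: algebra_simps)
  also have "[:-1, 1:] ^ e3 dvd \<dots>"
    using W e unfolding W_def by (intro dvd_diff[of _ "A - B"] dvd_mult2) (auto simp: le_imp_power_dvd)
  finally have 1: "[:-1, 1:] ^ (e3 - 1) dvd pderiv H" by (rule power_dvd_pderiv)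
  have "H - [:c:] = (fourth A B - [:c:]) - [:-l, 1:] ^ d * B"
    unfolding frobenius_linear[OF char_d] l H_def fourth_def by (simp add: algebra_simps)
  also have "[:-l, 1:] ^ n dvd \<dots>"
    using v e by (intro dvd_diff[of _ "fourth A B - [:c:]"] dvd_mult2) (auto simp: le_imp_power_dvd)
  finally have "[:-l, 1:] ^ (n - 1) dvd pderiv (H - [:c:])" by (rule power_dvd_pderiv)
  then have 2: "[:-l, 1:] ^ (n - 1) dvd pderiv H" by (simp add: pderiv_diff)
  have "pderiv H = 0"
  proof (rule ccontr)
    assume nz: "pderiv H \<noteq> 0"
    let ?m = "\<lambda>x. if x = 0 then e1 - 1 else if x = 1 then e3 - 1 else n - 1"
    have "(\<Prod>c\<in>{0, 1, l}. [:-c, 1:] ^ ?m c) dvd pderiv H"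
      by (rule prod_linear_power_dvd) (use 0 1 2 in auto)
    moreover have "(\<Prod>c\<in>{0, 1, l}. [:-c, 1:] ^ ?m c) = Q"
      using l01 by (simp add: Q_def mult.assoc del: mult_pCons_left mult_pCons_right)
    ultimately obtain R where R: "pderiv H = Q * R" by (auto elim: dvdE)
    have "degree H \<le> d + (d - e2)"
      unfolding H_def using W degree_mult_le[of "monom 1 d" B]
      by (intro degree_diff_le) (auto simp: W_def degree_monom_eq)
    then have "degree (pderiv H) \<le> 2 * d - e2 - 1" using degree_pderiv_le_diff[of H] e by linarith
    moreover have "degree Q = 2 * d - e2 - 1"
      using e sum by (simp add: Q_def degree_mult_eq degree_power_eq del: mult_pCons_left mult_pCons_right)
    ultimately have "degree R = 0" using nz unfolding R by (auto simp: degree_mult_eq)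
    then obtain r where r: "R = [:r:]" by (rule degree_eq_zeroE)
    have "coeff (pderiv H) (d - 1) = of_nat d * coeff H d"
      using e by (simp add: coeff_pderiv del: of_nat_Suc)
    then have "r * coeff Q (d - 1) = 0" using od by (simp add: R r)
    moreover have "r \<noteq> 0" using nz R r by auto
    ultimately show False using l(2) by (simp add: phi_def Q_def)
  qed
  moreover have pm: "pderiv (monom 1 d) = (0::'a poly)" using od by (simp add: pderiv_monom)
  ultimately have eq: "pderiv A = monom 1 d * pderiv B"
    by (simp add: H_def pderiv_diff pderiv_mult)
  \<comment> \<open>In \<open>eq\<close> the derivative of A has degree below \<open>d\<close>,
    while a nonzero right side would have degree at least \<open>d\<close>.\<close>
  have B': "pderiv B = 0"
  proof (rule ccontr)
    assume "pderiv B \<noteq> 0"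
    then have "degree (pderiv A) \<ge> d" unfolding eq by (simp add: degree_mult_eq degree_monom_eq monom_eq_0_iff)
    then show False using degree_pderiv_le_diff[of A] W e unfolding W_def by linarith
  qed
  then have "wr A B = 0" using eq by (simp add: wr_def)
  have A': "pderiv A = 0" using eq B' by simp
  have "degree B \<le> d" using W unfolding W_def by linarith
  then obtain b b' where B: "B = [:b:] + monom b' d"
    using pderiv_zero_shape[OF B'] by blast
  moreover have "coeff B d = 0" using W e by (intro coeff_eq_0) (auto simp: W_def)
  ultimately have B: "B = [:b:]" using e by (auto simp: coeff_pCons split: nat.splits)
  obtain a a' where A: "A = [:a':] + monom a d"
    using pderiv_zero_shape[OF A'] W by (auto simp: W_def)
  have "poly A 0 = 0"
    using W e dvd_imp_higher_pderiv_zero[of 0 e1 A 0] by (simp add: W_def)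
  then have a': "a' = 0" using e by (simp add: A poly_monom power_0_left)
  have "poly (A - B) 1 = 0"
    using W e dvd_imp_higher_pderiv_zero[of 1 e3 "A - B" 0] by (simp add: W_def)
  then have "a = b" using a' by (simp add: A B poly_monom)
  then show ?thesis using A B a' by auto
qed

text \<open>The inseparable pencil contributes the factor $x^d - \mu$ of \<open>D\<close>. For generic \<open>mu\<close> its zero is not
  a zero of the cofactor.\<close>

lemma card_good_char_d:
  assumes char_d: "CHAR('a) = d" and gen: "\<And>l. l ^ d = mu \<Longrightarrow> phi l \<noteq> 0"
  shows "finite good" "card good + d = n * (d + 1 - n)"
proof -
  have od: "of_nat d = (0::'a)" using char_d by (metis of_nat_CHAR)
  define F0 where "F0 = monom 1 d - [:mu:]"
  \<comment> \<open>The inseparable pencil has top coefficients 1, 0, ..., 0; its constant term lies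
    below them because \<open>n < d\<close>. It is therefore the first basis member.\<close>
  have "coeff (fourth (fst (bs 0)) (snd (bs 0))) (d - i) = coeff (fourth (monom 1 d) [:1:]) (d - i)"
    if "i < n" for i
  proof -
    have "coeff (fourth (monom 1 d) [:1:]) (d - i) = (if i = 0 then 1 else 0)"
      using that e by (cases "d - i") (auto simp: fourth_def)
    then show ?thesis using bs(2)[OF that, of 0] by (simp add: F_def)
  qed
  from W_unique[OF bs(1) inseparable_pencil[OF char_d] this]
  have "fst (bs 0) = monom 1 d" "snd (bs 0) = [:1:]" by auto
  then have F0: "F 0 = F0" by (simp add: F_def fourth_def F0_def)
  have pF0: "(pderiv ^^ i) F0 = 0" if "0 < i" for i
  proof -
    have "pderiv F0 = 0" using od by (simp add: F0_def pderiv_diff pderiv_monom)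
    then show ?thesis using that by (cases i) (simp_all add: funpow_swap1)
  qed
  \<comment> \<open>All derivatives of \<open>F0\<close> vanish, so column 0 of the Wronskian matrix
    is \<open>F0\<close> times the first unit vector.\<close>
  define N where "N = (\<lambda>i j. if j = 0 then (if i = 0 then 1 else 0) else (pderiv ^^ i) (F j))"
  define G where "G = fdet n N"
  have "D = fdet n (\<lambda>i j. (if j = 0 then F0 else 1) * N i j)"
    unfolding D_def by (rule fdet_cong) (auto simp: N_def F0 pF0)
  also have "\<dots> = (\<Prod>j<n. if j = 0 then F0 else 1) * G" by (simp add: fdet_col_scale G_def)
  also have "(\<Prod>j<n. if j = 0 then F0 else 1) = F0" using e by simp
  finally have DG: "D = F0 * G" .
  have polyF0: "poly F0 x = x ^ d - mu" for x by (simp add: F0_def poly_monom)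
  have degF0: "degree F0 = d"
  proof (rule antisym)
    show "degree F0 \<le> d" unfolding F0_def by (intro degree_diff_le) (auto simp: degree_monom_le)
    show "d \<le> degree F0" using e by (intro le_degree) (auto simp: F0_def coeff_pCons split: nat.splits)
  qed
  have nz: "F0 \<noteq> 0" "G \<noteq> 0" using degree_D(1) DG by auto
  have "degree G + d = n * (d + 1 - n)"
    using degree_D(2) nz unfolding DG by (simp add: degree_mult_eq degF0)
  have Gl: "poly G l \<noteq> 0" if l: "l ^ d = mu" for l
  proof
    assume "poly G l = 0"
    then obtain c where c: "\<exists>j<n. c j \<noteq> 0" "\<And>i. i < n \<Longrightarrow> (\<Sum>j<n. poly (N i j) l * c j) = 0"
      unfolding G_def poly_fdet fdet_eq_0_iff by blast
    \<comment> \<open>Since column 0 is a unit vector, a kernel vector makes the combination of the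
      other members vanish to order \<open>n\<close> at \<open>l\<close> only up to a constant. This
      is why \<open>generic_pencil\<close> admits the constant \<open>c\<close>.\<close>
    define c' where "c' = c(0 := 0)"
    have N: "(\<Sum>j<n. poly (N i j) l * c j) = (if i = 0 then c 0 else 0) +
        poly ((pderiv ^^ i) (fourth (combA c') (combB c'))) l" for i
    proof -
      have n: "{..<n} = insert 0 {1..<n}" using e by auto
      show ?thesis
        by (simp add: n N_def c'_def fourth_comb higher_pderiv_sum higher_pderiv_smult poly_sum mult.commute)
    qed
    define P where "P = fourth (combA c') (combB c') - [:poly (fourth (combA c') (combB c')) l:]"
    have "poly ((pderiv ^^ i) P) l = 0" if "i < n" for i
    proof (cases i)
      case (Suc k)
      have "(pderiv ^^ Suc k) [:x:] = 0" for x :: 'a by (simp add: funpow_swap1)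
      then have "(pderiv ^^ i) P = (pderiv ^^ i) (fourth (combA c') (combB c'))"
        unfolding P_def Suc diff_conv_add_uminus higher_pderiv_add minus_pCons by simp
      then show ?thesis using c(2)[OF that] N[of i] Suc by simp
    qed (simp add: P_def)
    then have "[:-l, 1:] ^ n dvd P" using taylor[of n P l] e by auto
    from generic_pencil[OF char_d l gen[OF l] W_comb this[unfolded P_def]]
    obtain a where a: "combA c' = monom a d" "combB c' = [:a:]" by blast
    \<comment> \<open>The coordinates 1 to \<open>n - 1\<close> of an inseparable pencil are zero.
      So \<open>c\<close> is supported at 0, and the first row then gives
      \<open>c 0 = 0\<close>.\<close>
    have z: "c j = 0" if "0 < j" "j < n" for j
    proof -
      have "c' j = coeff (fourth (combA c') (combB c')) (d - j)" using that by (simp add: coeff_comb)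
      also have "\<dots> = 0" using that e by (auto simp: a fourth_def coeff_pCons split: nat.splits)
      finally show ?thesis using that by (simp add: c'_def)
    qed
    have "combA c' = 0" "combB c' = 0"
      unfolding combA_def combB_def by (auto simp: c'_def z intro!: sum.neutral)
    then have "c 0 = 0" using N[of 0] c(2)[of 0] e by (simp add: fourth_def)
    with z c(1) show False by (metis gr0I)
  qed
  have "good = {l. poly G l = 0}"
  proof (intro equalityI subsetI; clarify?)
    fix l assume l: "l \<in> good"
    then obtain A B where AB: "W A B" "wr A B \<noteq> 0" "[:-l, 1:] ^ n dvd fourth A B" by (auto simp: good_def)
    have "l ^ d \<noteq> mu"
    proof
      assume "l ^ d = mu"
      from generic_pencil[OF char_d this gen[OF this] AB(1), of 0] AB(3)
      obtain a where "A = monom a d" "B = [:a:]" by auto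
      then have "wr A B = 0" using od by (simp add: wr_def pderiv_monom)
      with AB(2) show False by simp
    qed
    moreover have "poly D l = 0" using l by (rule good_imp_root)
    ultimately show "poly G l = 0" by (simp add: DG polyF0)
  next
    fix l assume l: "poly G l = 0"
    then have "poly D l = 0" "l ^ d \<noteq> mu" using Gl by (auto simp: DG)
    then obtain A B where "l \<noteq> 0" "l \<noteq> 1" "W A B" "wr A B \<noteq> 0" "[:-l, 1:] ^ n dvd fourth A B"
      by (rule D_root_cases)
    then show "l \<in> good" by (auto simp: good_def)
  qed
  moreover have "poly (pderiv G) l \<noteq> 0" if "poly G l = 0" for l
  proof -
    have ld: "l ^ d \<noteq> mu" using Gl that by blast
    have "poly D l = 0" using that by (simp add: DG)
    from D_root_simple[OF this ld] show ?thesis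
      using that by (simp add: DG pderiv_mult)
  qed
  ultimately show "finite good" "card good + d = n * (d + 1 - n)"
    using card_simple_roots[OF nz(2)] \<open>degree G + d = n * (d + 1 - n)\<close> by auto
qed

text \<open>Expanded in powers of \<open>- l\<close>, the coefficients of \<open>phi l\<close> are
  up to sign products of two binomial coefficients with upper entries below \<open>d\<close>. As
  \<open>d\<close> is prime, those within range are nonzero in characteristic
  \<open>d\<close>.\<close>

lemma phi_polynomial:
  assumes char_d: "CHAR('a) = d"
  obtains P where "P \<noteq> 0" "\<And>l. phi l = poly P l"
proof -
  have "prime d" using char char_d e by auto
  have bin: "of_nat (m choose i) \<noteq> (0::'a)" if "m < d" "i \<le> m" for m i
  proof
    assume "of_nat (m choose i) = (0::'a)"
    then have "d dvd (m choose i)" using char_d by (metis of_nat_eq_0_iff_char_dvd)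
    then have "d dvd fact m" using binomial_fact_lemma[OF that(2)] by (metis dvd_mult)
    then show False using that(1) \<open>prime d\<close> by (simp add: prime_dvd_fact_iff)
  qed
  define k where "k = d - e1"
  define u :: "nat \<Rightarrow> 'a" where "u = (\<lambda>i. coeff ([:-1, 1:] ^ (e3 - 1)) i * of_nat ((n - 1) choose (k - i)))"
  define P where "P = (\<Sum>i\<le>k. smult (u i) ([:0, -1:] ^ (n - 1 - (k - i))))"
  have lin: "coeff ([:-l, 1:] ^ m) i = of_nat (m choose i) * (- l) ^ (m - i)" for l :: 'a and m i
  proof (cases "i \<le> m")
    case True
    then show ?thesis by (simp add: coeff_linear_poly_power)
  next
    case False
    then show ?thesis by (simp add: coeff_eq_0 degree_power_eq binomial_eq_0)
  qed
  have "phi l = poly P l" for l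
  proof -
    have "phi l = coeff (monom 1 (e1 - 1) * ([:-1, 1:] ^ (e3 - 1) * [:-l, 1:] ^ (n - 1))) (d - 1)"
      by (simp only: phi_def mult.assoc monom_altdef smult_1_left)
    also have "\<dots> = coeff ([:-1, 1:] ^ (e3 - 1) * [:-l, 1:] ^ (n - 1)) k"
      using e unfolding coeff_monom_mult k_def by simp
    also have "\<dots> = (\<Sum>i\<le>k. u i * (- l) ^ (n - 1 - (k - i)))"
      unfolding coeff_mult u_def lin[of l] by (simp add: mult.assoc)
    finally show ?thesis by (simp add: P_def poly_sum)
  qed
  moreover have "P \<noteq> 0"
  proof -
    \<comment> \<open>The largest \<open>i \<le> k\<close> for which
      \<open>[:-1, 1:] ^ (e3 - 1)\<close> has a nonzero coefficient. The bound on
      \<open>k - i0\<close> holds because \<open>d - e1 \<le> (e3 - 1) + (n - 1)\<close> by the sum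
      formula.\<close>
    define i0 where "i0 = min k (e3 - 1)"
    have i0: "i0 \<le> k" "i0 \<le> e3 - 1" "k - i0 \<le> n - 1" using e sum by (auto simp: i0_def k_def)
    define t where "t = n - 1 - (k - i0)"
    have mon: "[:0, -1:] ^ m = monom ((-1) ^ m) m" for m :: nat
      by (induction m) (simp_all add: monom_Suc one_pCons monom_0 smult_monom)
    have "coeff P t = (\<Sum>i\<le>k. u i * coeff ([:0, -1:] ^ (n - 1 - (k - i))) t)"
      by (simp add: P_def coeff_sum)
    also have "\<dots> = (\<Sum>i\<in>{i0}. u i * coeff ([:0, -1:] ^ (n - 1 - (k - i))) t)"
    proof (intro sum.mono_neutral_right ballI)
      fix i assume i: "i \<in> {..k} - {i0}"
      \<comment> \<open>If \<open>k - i\<close> exceeds \<open>n - 1\<close>, the exponent is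
        truncated to 0 and could collide with \<open>t\<close>, but then the binomial coefficient in
        \<open>u i\<close> is 0.\<close>
      show "u i * coeff ([:0, -1:] ^ (n - 1 - (k - i))) t = 0"
      proof (cases "k - i \<le> n - 1")
        case True
        then have "n - 1 - (k - i) \<noteq> t" using i i0 unfolding t_def by auto
        then show ?thesis by (simp add: mon)
      qed (simp add: u_def binomial_eq_0)
    qed (use i0 in auto)
    also have "\<dots> = u i0 * (- 1) ^ t" by (simp add: mon t_def)
    also have "\<dots> \<noteq> 0"
      using bin[of "e3 - 1" i0] bin[of "n - 1" "k - i0"] i0 e lin[of 1 "e3 - 1" i0] by (auto simp: u_def)
    finally show ?thesis by auto
  qed
  ultimately show ?thesis using that by blast
qed

end

section \<open>Separability\<close>

lemma comm_ring_homI: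
  fixes f :: "'a::comm_ring_1 \<Rightarrow> 'b::comm_ring_1"
  assumes "f 1 = 1" "\<And>x y. f (x + y) = f x + f y" "\<And>x y. f (x * y) = f x * f y"
  shows "comm_ring_hom f"
proof
  show "f 0 = 0" using assms(2)[of 0 0] by simp
qed (use assms in auto)

context
  fixes f :: "'a::idom \<Rightarrow> 'b::idom"
  assumes f: "comm_ring_hom f"
begin

interpretation f: comm_ring_hom f by (fact f)

lemma map_poly_hom_pCons: "map_poly f (pCons c p) = pCons (f c) (map_poly f p)"
  by (rule poly_eqI) (simp add: coeff_map_poly coeff_pCons split: nat.splits)

lemma map_poly_hom_add: "map_poly f (p + q) = map_poly f p + map_poly f q"
  by (rule poly_eqI) (simp add: coeff_map_poly f.hom_add)

lemma map_poly_hom_mult: "map_poly f (p * q) = map_poly f p * map_poly f q"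
proof (induction p)
  case (pCons c p)
  have "map_poly f (smult c q) = smult (f c) (map_poly f q)"
    by (rule poly_eqI) (simp add: coeff_map_poly f.hom_mult)
  then show ?case using pCons by (simp add: map_poly_hom_add map_poly_hom_pCons)
qed simp

lemma map_poly_hom_pderiv: "map_poly f (pderiv p) = pderiv (map_poly f p)"
  by (induction p) (simp_all add: map_poly_hom_add map_poly_hom_pCons pderiv_pCons)

lemma comm_ring_hom_poly_eval: "comm_ring_hom (\<lambda>p. poly (map_poly f p) y)"
  by (rule comm_ring_homI) (simp_all add: map_poly_hom_add map_poly_hom_mult one_pCons map_poly_hom_pCons)

end

text \<open>A vanishing derivative leaves only exponents divisible by \<open>p\<close>, and
  Frobenius is additive, so roots of the coefficients assemble to a root of \<open>f\<close>. For a
  two-variable relation this is applied twice, first to its coefficients and then to the relation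
  itself.\<close>

lemma pth_power_poly:
  fixes f :: "'r::idom poly"
  assumes p: "prime p" "CHAR('r) = p" and der: "pderiv f = 0"
    and coeffs: "\<And>i. \<exists>g. g ^ p = coeff f i"
  obtains q where "q ^ p = f"
proof -
  from coeffs obtain r where r: "\<And>i. r i ^ p = coeff f i" by metis
  have p0: "p > 0" using p by (simp add: prime_gt_0_nat)
  define q where "q = (\<Sum>i\<le>degree f. monom (r (p * i)) i)"
  have "q ^ p = (\<Sum>i\<le>degree f. monom (r (p * i)) i ^ p)"
    unfolding q_def by (rule freshmans_dream_sum) (use p in simp_all)
  also have "\<dots> = (\<Sum>i\<le>degree f. monom (coeff f (p * i)) (p * i))"
    by (simp add: monom_power r mult.commute)
  also have "\<dots> = f"
  proof (rule poly_eqI)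
    fix k
    have "coeff (\<Sum>i\<le>degree f. monom (coeff f (p * i)) (p * i)) k =
        (\<Sum>i\<le>degree f. if p * i = k then coeff f k else 0)"
      unfolding coeff_sum by (intro sum.cong) auto
    also have "\<dots> = coeff f k"
    proof (cases "p dvd k")
      case True
      then obtain i where i: "k = p * i" by (elim dvdE)
      have "(\<Sum>i'\<le>degree f. if p * i' = k then coeff f k else 0) = (\<Sum>i'\<le>degree f. if i' = i then coeff f k else 0)"
        using p0 i by (intro sum.cong) auto
      also have "\<dots> = (if i \<le> degree f then coeff f k else 0)" by simp
      also have "\<dots> = coeff f k"
      proof (cases "i \<le> degree f")
        case False
        have "i \<le> p * i" using p0 by simp
        then have "degree f < k" using False i by linarith
        then show ?thesis using False by (simp add: coeff_eq_0)
      qed simp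
      finally show ?thesis .
    next
      case False
      then have "k \<noteq> 0" by (metis dvd_0_right)
      have "of_nat k * coeff f k = 0"
        using arg_cong[OF der, of "\<lambda>g. coeff g (k - 1)"] \<open>k \<noteq> 0\<close>
        by (simp add: coeff_pderiv del: of_nat_Suc)
      moreover have "of_nat k \<noteq> (0::'r)"
        using False p(2) by (simp add: of_nat_eq_0_iff_char_dvd)
      ultimately have "coeff f k = 0" by simp
      moreover have "p * i \<noteq> k" for i using False by auto
      ultimately show ?thesis by simp
    qed
    finally show "coeff (\<Sum>i\<le>degree f. monom (coeff f (p * i)) (p * i)) k = coeff f k" .
  qed
  finally show ?thesis by (rule that)
qed

text \<open>A relational derivation of the rational function field, which spares a quotient construction.\<close>

definition der :: "'a::field poly fract \<Rightarrow> 'a poly fract \<Rightarrow> bool" where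
  "der y y' \<longleftrightarrow> (\<exists>u v. v \<noteq> 0 \<and> y = Fract u v \<and> y' = Fract (wr u v) (v * v))"

lemma Fract_eq_0_iff: "v \<noteq> 0 \<Longrightarrow> Fract u v = 0 \<longleftrightarrow> u = 0"
  by (subst Zero_fract_def, subst eq_fract) auto

lemma der_zero: "der 0 y' \<Longrightarrow> y' = 0"
  by (auto simp: der_def Fract_eq_0_iff wr_def dest!: sym[of 0])

lemma der_const: "der (Fract [:c:] 1) 0"
  unfolding der_def by (intro exI[of _ "[:c:]"] exI[of _ 1]) (simp add: wr_def fract_collapse)

lemma der_add:
  assumes "der y y'" "der z z'"
  shows "der (y + z) (y' + z')"
proof -
  obtain u v where y: "v \<noteq> 0" "y = Fract u v" "y' = Fract (wr u v) (v * v)" using assms(1) by (auto simp: der_def)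
  obtain s t where z: "t \<noteq> 0" "z = Fract s t" "z' = Fract (wr s t) (t * t)" using assms(2) by (auto simp: der_def)
  show ?thesis unfolding der_def
    by (intro exI[of _ "u * t + s * v"] exI[of _ "v * t"])
      (use y z in \<open>simp add: eq_fract wr_def pderiv_mult pderiv_add algebra_simps\<close>)
qed

lemma der_mult:
  assumes "der y y'" "der z z'"
  shows "der (y * z) (y' * z + y * z')"
proof -
  obtain u v where y: "v \<noteq> 0" "y = Fract u v" "y' = Fract (wr u v) (v * v)" using assms(1) by (auto simp: der_def)
  obtain s t where z: "t \<noteq> 0" "z = Fract s t" "z' = Fract (wr s t) (t * t)" using assms(2) by (auto simp: der_def)
  show ?thesis unfolding der_def
    by (intro exI[of _ "u * s"] exI[of _ "v * t"])
      (use y z in \<open>simp add: eq_fract wr_def pderiv_mult algebra_simps\<close>)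
qed

section \<open>Relations between a morphism and an element of the function field\<close>

context
  fixes a b :: "'a::alg_closed_field poly" and tt z :: "'a poly fract"
  assumes wr: "wr a b \<noteq> 0" and tt: "tt = Fract a b"
begin

text \<open>The type \<open>'a poly poly\<close> stands for K[t][Z]: \<open>E1\<close> puts the
  morphism \<open>tt\<close> for t, and \<open>E2\<close> moreover puts \<open>z\<close> for
  Z.\<close>

definition "\<iota> c = Fract [:c::'a:] 1"
definition "E1 c = poly (map_poly \<iota> c) tt"
definition "E2 P = poly (map_poly E1 P) z"

lemma b_nz: "b \<noteq> 0" using wr by (auto simp: wr_def)

lemma hom_iota: "comm_ring_hom \<iota>"
  by (rule comm_ring_homI) (simp_all add: \<iota>_def One_fract_def one_pCons mult.commute)

interpretation \<iota>: comm_ring_hom \<iota> by (rule hom_iota)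

interpretation E1: comm_ring_hom E1
  unfolding E1_def[abs_def] by (rule comm_ring_hom_poly_eval[OF hom_iota])

interpretation E2: comm_ring_hom E2
  unfolding E2_def[abs_def] by (rule comm_ring_hom_poly_eval) unfold_locales

lemma E1_pCons: "E1 (pCons c p) = \<iota> c + tt * E1 p"
  by (simp add: E1_def map_poly_pCons)

lemma E2_pCons: "E2 (pCons c p) = E1 c + z * E2 p"
  by (simp add: E2_def map_poly_pCons)

lemma E2_smult: "E2 (smult c P) = E1 c * E2 P"
proof -
  have "smult c P = [:c:] * P" by simp
  then show ?thesis by (simp only: E2.hom_mult) (simp add: E2_pCons)
qed

lemma E1_subfield: "E1 c \<in> gen_subfield tt"
proof (induction c)
  case 0
  show ?case using gen_subfield.const[of 0 tt, folded \<iota>_def] by simp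
next
  case (pCons k c)
  have 0: "0 \<in> gen_subfield tt" using gen_subfield.const[of 0 tt, folded \<iota>_def] by simp
  have "\<iota> k - (0 - tt * E1 c) \<in> gen_subfield tt"
    unfolding \<iota>_def
    by (intro gen_subfield.diff gen_subfield.mult gen_subfield.gen gen_subfield.const 0 pCons.IH)
  then show ?case by (simp add: E1_pCons)
qed

text \<open>The morphism is transcendental over the constants: a polynomial vanishing at
  \<open>tt\<close> splits into linear factors, and \<open>tt = \<iota> x\<close> would make the
  Wronskian zero.\<close>

lemma E1_eq_0: "E1 c = 0 \<Longrightarrow> c = 0"
proof (induction "degree c" arbitrary: c)
  case 0
  then obtain k where "c = [:k:]" by (metis degree_eq_zeroE)
  moreover from this 0 have "\<iota> k = 0" by (simp add: E1_pCons)
  ultimately show ?case by (simp add: \<iota>_def Fract_eq_0_iff)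
next
  case (Suc n)
  then obtain x where "poly c x = 0" using alg_closed_imp_poly_has_root[of c] by auto
  then obtain q where q: "c = [:-x, 1:] * q" by (auto simp: poly_eq_0_iff_dvd)
  have "q \<noteq> 0" using Suc(2) q by auto
  then have "degree q = n" using Suc(2) unfolding q by (subst (asm) degree_mult_eq) auto
  have "E1 [:-x, 1:] = tt - \<iota> x"
    by (simp add: E1_pCons \<iota>.hom_uminus)
  moreover have "tt \<noteq> \<iota> x"
  proof
    assume "tt = \<iota> x"
    then have "a = smult x b" using b_nz by (simp add: tt \<iota>_def eq_fract)
    then show False using wr by (simp add: wr_def pderiv_smult mult.commute)
  qed
  moreover have "E1 c = E1 [:-x, 1:] * E1 q" unfolding q by (rule E1.hom_mult)
  ultimately have "E1 q = 0" using Suc(3) by simp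
  then show ?case using Suc(1)[of q] \<open>degree q = n\<close> \<open>q \<noteq> 0\<close> by simp
qed

lemma der_E1:
  assumes t': "der tt t'"
  shows "der (E1 c) (E1 (pderiv c) * t')"
proof (induction c)
  case 0
  show ?case using der_const[of "0::'a", folded \<iota>_def] by simp
next
  case (pCons k c)
  from der_add[OF der_const der_mult[OF t' pCons.IH], of k]
  show ?case by (simp add: E1_pCons pderiv_pCons E1.hom_add algebra_simps flip: \<iota>_def)
qed

text \<open>The chain rule in two variables: \<open>map_poly pderiv\<close> is the partial
  derivative in the inner variable t, and \<open>pderiv\<close> the one in the outer variable
  Z.\<close>

lemma der_E2:
  assumes t': "der tt t'" and z': "der z z'"
  shows "der (E2 P) (E2 (map_poly pderiv P) * t' + E2 (pderiv P) * z')"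
proof (induction P)
  case 0
  show ?case using der_const[of "0::'a", folded \<iota>_def] by simp
next
  case (pCons c P)
  from der_add[OF der_E1[OF t'] der_mult[OF z' pCons.IH], of c]
  show ?case by (simp add: E2_pCons pderiv_pCons E2.hom_add algebra_simps map_poly_pCons)
qed

lemma E2_map_poly_pderiv:
  assumes "E2 P = 0" "pderiv P = 0"
  shows "E2 (map_poly pderiv P) = 0"
proof -
  obtain u v where "z = Fract u v" "v \<noteq> 0" by (cases z) auto
  then have z': "der z (Fract (wr u v) (v * v))" by (auto simp: der_def)
  define t' where "t' = Fract (wr a b) (b * b)"
  have t': "der tt t'" using b_nz by (auto simp: der_def tt t'_def)
  from der_zero[OF der_E2[OF t' z', of P, unfolded assms(1)]]
  have "E2 (map_poly pderiv P) * t' = 0" using assms(2) by simp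
  moreover have "t' \<noteq> 0" using wr b_nz by (simp add: t'_def Fract_eq_0_iff)
  ultimately show ?thesis by simp
qed

lemma E2_monom: "E2 (monom (monom c i) j) = \<iota> c * tt ^ i * z ^ j"
  by (simp add: E2_def E1_def map_poly_monom poly_monom)

text \<open>With denominators cleared, the monomials \<open>tt ^ i * z ^ j\<close> with
  \<open>i \<le> N\<close> and \<open>j \<le> M\<close> become polynomials of bounded degree. They
  outnumber the available coefficients and hence are linearly dependent.\<close>

lemma algebraic: "\<exists>P. P \<noteq> 0 \<and> E2 P = 0"
proof -
  obtain u v where uv: "z = Fract u v" "v \<noteq> 0" by (cases z) auto
  define M e0 where "M = max (degree a) (degree b)" and "e0 = max (degree u) (degree v)"
  define N where "N = M * e0"
  have M: "M > 0"
  proof (rule ccontr)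
    assume "\<not> M > 0"
    then obtain c c' where "a = [:c:]" "b = [:c':]" unfolding M_def by (metis degree_eq_zeroE gr0I max_nat.neutr_eq_iff)
    then show False using wr by (simp add: wr_def)
  qed
  define T where "T = (\<lambda>i j. a ^ i * b ^ (N - i) * (u ^ j * v ^ (M - j)))"
  have dT: "degree (T i j) \<le> N * M + M * e0" if "i \<le> N" "j \<le> M" for i j
  proof -
    have "degree (a ^ i * b ^ (N - i)) \<le> i * M + (N - i) * M"
      by (rule order.trans[OF degree_mult_le], rule add_mono; rule order.trans[OF degree_power_le])
        (auto simp: M_def mult.commute)
    moreover have "degree (u ^ j * v ^ (M - j)) \<le> j * e0 + (M - j) * e0"
      by (rule order.trans[OF degree_mult_le], rule add_mono; rule order.trans[OF degree_power_le])
        (auto simp: e0_def mult.commute)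
    moreover have "i * M + (N - i) * M = N * M" "j * e0 + (M - j) * e0 = M * e0"
      using that by (simp_all flip: add_mult_distrib)
    ultimately show ?thesis unfolding T_def
      by (intro order.trans[OF degree_mult_le]) linarith
  qed
  \<comment> \<open>Pairs of exponents are coded as one index \<open>k\<close>, with
    \<open>i = k mod (N + 1)\<close> and \<open>j = k div (N + 1)\<close>. For
    \<open>N = M * e0\<close> there are exactly \<open>M\<close> more unknowns than
    equations.\<close>
  define n where "n = (N + 1) * (M + 1)"
  define m where "m = N * M + M * e0 + 1"
  have "m < n" using M by (simp add: n_def m_def N_def)
  then obtain c where c: "\<exists>k<n. c k \<noteq> 0"
    "\<And>i. i < m \<Longrightarrow> (\<Sum>k<n. coeff (T (k mod (N + 1)) (k div (N + 1))) i * c k) = 0"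
    using homogeneous_system_nontrivial[of m n "\<lambda>i k. coeff (T (k mod (N + 1)) (k div (N + 1))) i"] by blast
  have kM: "k mod (N + 1) \<le> N" "k div (N + 1) \<le> M" if "k < n" for k
  proof -
    have "k mod (N + 1) < N + 1" by simp
    then show "k mod (N + 1) \<le> N" by linarith
    have "k div (N + 1) < M + 1" using that by (simp add: n_def less_mult_imp_div_less mult.commute)
    then show "k div (N + 1) \<le> M" by linarith
  qed
  have zero: "(\<Sum>k<n. smult (c k) (T (k mod (N + 1)) (k div (N + 1)))) = 0"
  proof (rule poly_eqI)
    fix i
    show "coeff (\<Sum>k<n. smult (c k) (T (k mod (N + 1)) (k div (N + 1)))) i = coeff 0 i"
    proof (cases "i < m")
      case True
      then show ?thesis using c(2)[OF True] by (simp add: coeff_sum mult.commute)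
    next
      case False
      then have "coeff (T (k mod (N + 1)) (k div (N + 1))) i = 0" if "k < n" for k
        using dT[OF kM[OF that]] by (intro coeff_eq_0) (simp add: m_def)
      then show ?thesis by (simp add: coeff_sum)
    qed
  qed
  define P where "P = (\<Sum>k<n. monom (monom (c k) (k mod (N + 1))) (k div (N + 1)))"
  have "P \<noteq> 0"
  proof -
    obtain k where k: "k < n" "c k \<noteq> 0" using c(1) by blast
    have "coeff (coeff P (k div (N + 1))) (k mod (N + 1)) = (\<Sum>k'<n. if k' = k then c k else 0)"
      unfolding P_def coeff_sum
    proof (intro sum.cong refl)
      fix k'
      have "k' = k \<longleftrightarrow> k' div (N + 1) = k div (N + 1) \<and> k' mod (N + 1) = k mod (N + 1)"
        by (metis div_mult_mod_eq)
      then show "coeff (coeff (monom (monom (c k') (k' mod (N + 1))) (k' div (N + 1))) (k div (N + 1))) (k mod (N + 1)) =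
        (if k' = k then c k else 0)" by auto
    qed
    then show ?thesis using k by auto
  qed
  moreover have "E2 P = 0"
  proof -
    let ?f = "\<lambda>p::'a poly. Fract p 1"
    have f: "comm_ring_hom ?f" by (rule comm_ring_homI) (simp_all add: One_fract_def)
    interpret f: comm_ring_hom ?f by (rule f)
    have tb: "tt * ?f b = ?f a" "z * ?f v = ?f u" using b_nz uv by (simp_all add: tt eq_fract)
    have pw: "y ^ i * w ^ N' = (y * w) ^ i * w ^ (N' - i)" if "i \<le> N'" for y w :: "'a poly fract" and i N'
      using that by (simp add: power_mult_distrib flip: power_add mult.assoc)
    have "?f (b ^ N * v ^ M) * E2 P =
        (\<Sum>k<n. ?f (smult (c k) (T (k mod (N + 1)) (k div (N + 1)))))"
      unfolding P_def E2.hom_sum sum_distrib_left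
    proof (intro sum.cong refl)
      fix k assume "k \<in> {..<n}"
      then have k: "k mod (N + 1) \<le> N" "k div (N + 1) \<le> M" using kM by auto
      let ?i = "k mod (N + 1)" and ?j = "k div (N + 1)"
      have "?f (b ^ N * v ^ M) * (\<iota> (c k) * tt ^ ?i * z ^ ?j) =
        \<iota> (c k) * (tt ^ ?i * ?f b ^ N) * (z ^ ?j * ?f v ^ M)"
        by (simp only: f.hom_mult f.hom_power mult_ac)
      also have "\<dots> = \<iota> (c k) * (?f a ^ ?i * ?f b ^ (N - ?i)) * (?f u ^ ?j * ?f v ^ (M - ?j))"
        unfolding pw[OF k(1)] pw[OF k(2)] tb ..
      also have "\<dots> = ?f ([:c k:] * T ?i ?j)"
        unfolding T_def \<iota>_def by (simp only: f.hom_mult f.hom_power mult.assoc)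
      finally show "?f (b ^ N * v ^ M) * E2 (monom (monom (c k) ?i) ?j) = ?f (smult (c k) (T ?i ?j))"
        unfolding E2_monom by simp
    qed
    also have "\<dots> = ?f (\<Sum>k<n. smult (c k) (T (k mod (N + 1)) (k div (N + 1))))"
      by (simp only: f.hom_sum)
    also have "\<dots> = 0" unfolding zero by (simp add: fract_collapse)
    finally have "?f (b ^ N * v ^ M) * E2 P = 0" .
    moreover have "?f (b ^ N * v ^ M) \<noteq> 0" using b_nz uv by (simp add: Fract_eq_0_iff)
    ultimately show ?thesis by simp
  qed
  ultimately show ?thesis by blast
qed

definition relations :: "'a poly poly set" where
  "relations = {P. P \<noteq> 0 \<and> E2 P = 0}"

lemma relation_degree_pos: "P \<in> relations \<Longrightarrow> 0 < degree P"
proof (rule ccontr)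
  assume P: "P \<in> relations" and "\<not> 0 < degree P"
  then obtain c where "P = [:c:]" by (auto elim: degree_eq_zeroE)
  with P E1_eq_0[of c] show False by (simp add: relations_def E2_pCons)
qed

text \<open>A relation between $f$ and $z$ of minimal degree in $z$ and then of minimal size is separable in $z$:
  otherwise differentiating it shows that its partial derivative with respect to $f$ vanishes as well, so
  that it is a $p$-th power.\<close>

lemma separable_relation:
  obtains P where "P \<in> relations" "\<And>Q. Q \<in> relations \<Longrightarrow> degree P \<le> degree Q" "pderiv P \<noteq> 0"
proof -
  define n0 where "n0 = (LEAST n. \<exists>P\<in>relations. degree P = n)"
  have n0: "n0 \<le> degree Q" if "Q \<in> relations" for Q
    unfolding n0_def by (rule Least_le) (use that in auto)
  have "\<exists>P\<in>relations. degree P = n0"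
    unfolding n0_def by (rule LeastI_ex) (use algebraic in \<open>auto simp: relations_def\<close>)
  then obtain P1 where P1: "P1 \<in> relations" "degree P1 = n0" by blast
  \<comment> \<open>The size of a relation: the sum of the t-degrees of its coefficients. The
    partial derivative in t, if it is a relation at all, has the same degree in Z by minimality but
    smaller size.\<close>
  define \<sigma> :: "'a poly poly \<Rightarrow> nat" where "\<sigma> = (\<lambda>P. \<Sum>i\<le>n0. degree (coeff P i))"
  obtain P where P: "P \<in> relations" "degree P = n0"
    and min: "\<And>Q. Q \<in> relations \<Longrightarrow> degree Q = n0 \<Longrightarrow> \<sigma> P \<le> \<sigma> Q"
    using ex_has_least_nat[of "\<lambda>P. P \<in> relations \<and> degree P = n0" P1 \<sigma>] P1 by blast
  have "pderiv P \<noteq> 0"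
  proof
    assume P': "pderiv P = 0"
    have cS: "coeff (map_poly pderiv P) i = pderiv (coeff P i)" for i
      by (simp add: coeff_map_poly)
    have S: "map_poly pderiv P = 0"
    proof (rule ccontr)
      assume nz: "map_poly pderiv P \<noteq> 0"
      then have R: "map_poly pderiv P \<in> relations"
        using E2_map_poly_pderiv[OF _ P'] P by (simp add: relations_def)
      then have "degree (map_poly pderiv P) = n0"
        using n0[OF R] degree_le[of "degree P" "map_poly pderiv P"] P(2) by (simp add: cS coeff_eq_0)
      from min[OF R this] have le: "\<sigma> P \<le> \<sigma> (map_poly pderiv P)" .
      have "lead_coeff (map_poly pderiv P) \<noteq> 0" using nz by simp
      then have "pderiv (coeff P n0) \<noteq> 0" using \<open>degree (map_poly pderiv P) = n0\<close> by (simp add: cS)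
      then have "degree (coeff P n0) > 0" by (metis degree_eq_zeroE gr0I pderiv_singleton)
      then have "degree (pderiv (coeff P n0)) < degree (coeff P n0)"
        using degree_pderiv_le_diff[of "coeff P n0"] by linarith
      moreover have "degree (pderiv (coeff P i)) \<le> degree (coeff P i)" for i
        using degree_pderiv_le_diff[of "coeff P i"] by linarith
      ultimately have "\<sigma> (map_poly pderiv P) < \<sigma> P"
        unfolding \<sigma>_def cS by (intro sum_strict_mono_ex1) auto
      with le show False by simp
    qed
    show False
    proof (cases "CHAR('a) = 0")
      case True
      have "of_nat n0 * coeff P n0 = 0"
        using arg_cong[OF P', of "\<lambda>g. coeff g (n0 - 1)"] relation_degree_pos[OF P(1)] P(2)
        by (simp add: coeff_pderiv del: of_nat_Suc)
      moreover have "coeff P n0 \<noteq> 0" using P by (auto simp: relations_def)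
      ultimately have "of_nat n0 = (0::'a poly)" by simp
      then show False using True relation_degree_pos[OF P(1)] P(2)
        by (simp only: of_nat_eq_0_iff_char_dvd semiring_char_poly) simp
    next
      case False
      define p where "p = CHAR('a)"
      have p: "prime p" using False by (simp add: p_def prime_CHAR_semidom)
      have "\<exists>g. g ^ p = coeff P i" for i
      proof -
        have 1: "pderiv (coeff P i) = 0" using S cS[of i] by simp
        have 2: "\<exists>y. y ^ p = coeff (coeff P i) k" for k
          using nth_root_exists[of p] p by (simp add: prime_gt_0_nat)
        show ?thesis by (rule pth_power_poly[OF p p_def[symmetric] 1 2]) blast
      qed
      moreover have "CHAR('a poly) = p" by (simp add: p_def)
      ultimately obtain Q where Q: "Q ^ p = P"
        using pth_power_poly[OF p _ P'] by blast
      have "Q \<noteq> 0" using Q P p by (auto simp: relations_def prime_gt_0_nat)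
      moreover have "E2 Q ^ p = 0" using P Q by (simp add: relations_def flip: E2.hom_power)
      ultimately have QR: "Q \<in> relations" by (simp add: relations_def)
      have "degree P = p * degree Q" using \<open>Q \<noteq> 0\<close> by (simp add: degree_power_eq flip: Q)
      then have "degree Q < degree P"
        using prime_gt_1_nat[OF p] relation_degree_pos[OF QR] by simp
      then show False using n0[OF QR] P(2) by simp
    qed
  qed
  then show ?thesis using that P n0 by metis
qed

text \<open>Over K[t] a nonzero combination \<open>h\<close> of \<open>P\<close> and its derivative
  of least degree in Z divides a multiple of \<open>P\<close>, by pseudo-division. As
  \<open>h\<close> is too short to be a relation, the cofactor is one, and minimality of
  \<open>P\<close> leaves degree 0 for \<open>h\<close>. By transcendence \<open>E1\<close> keeps
  this constant nonzero, which is a Bezout identity over the subfield.\<close>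

lemma separable_element:
  "\<exists>g. (\<forall>i. coeff g i \<in> gen_subfield tt) \<and> g \<noteq> 0 \<and> poly g z = 0 \<and> coprime g (pderiv g)"
proof -
  obtain P where P: "P \<in> relations" "\<And>Q. Q \<in> relations \<Longrightarrow> degree P \<le> degree Q" "pderiv P \<noteq> 0"
    using separable_relation by blast
  define I where "I = {h. h \<noteq> 0 \<and> (\<exists>u v. h = u * P + v * pderiv P)}"
  have "pderiv P = 0 * P + 1 * pderiv P" by simp
  then have "pderiv P \<in> I" using P(3) unfolding I_def by blast
  then obtain h where h: "h \<in> I" and hmin: "\<And>k. k \<in> I \<Longrightarrow> degree h \<le> degree k"
    using ex_has_least_nat[of "\<lambda>h. h \<in> I" "pderiv P" degree] by blast
  obtain u v where uv: "h = u * P + v * pderiv P" "h \<noteq> 0" using h by (auto simp: I_def)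
  have "degree h < degree P"
    using hmin[OF \<open>pderiv P \<in> I\<close>] degree_pderiv_le_diff[of P] relation_degree_pos[OF P(1)] by linarith
  obtain c q where cq: "c \<noteq> 0" "smult c P = h * q + pseudo_mod P h"
    using pseudo_mod(1)[OF uv(2), of P] by blast
  have "pseudo_mod P h = 0"
  proof (rule ccontr)
    assume nz: "pseudo_mod P h \<noteq> 0"
    have "pseudo_mod P h = smult c P - h * q" using cq by simp
    also have "\<dots> = ([:c:] - u * q) * P + (- v * q) * pderiv P"
      by (simp add: uv(1) algebra_simps)
    finally have "pseudo_mod P h \<in> I" using nz unfolding I_def by blast
    from hmin[OF this] pseudo_mod(2)[OF uv(2), of P] nz show False by simp
  qed
  then have eq: "smult c P = h * q" using cq by simp
  have "h \<notin> relations" using P(2)[of h] \<open>degree h < degree P\<close> by auto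
  then have "E2 h \<noteq> 0" using uv(2) by (simp add: relations_def)
  moreover have "E2 h * E2 q = 0"
    using P(1) by (simp add: relations_def E2_smult flip: E2.hom_mult eq)
  ultimately have "E2 q = 0" by simp
  moreover have "q \<noteq> 0" using eq cq(1) P(1) by (auto simp: relations_def)
  ultimately have "degree P \<le> degree q" using P(2) by (simp add: relations_def)
  moreover have "degree P = degree h + degree q"
    using arg_cong[OF eq, of degree] cq(1) uv(2) \<open>q \<noteq> 0\<close> by (simp add: degree_mult_eq)
  ultimately have "degree h = 0" by simp
  then obtain r where r: "h = [:r:]" by (rule degree_eq_zeroE)
  define \<Phi> where "\<Phi> = map_poly E1"
  have hom: "comm_ring_hom E1" by unfold_locales
  note Phi = map_poly_hom_add[OF hom, folded \<Phi>_def] map_poly_hom_mult[OF hom, folded \<Phi>_def]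
    map_poly_hom_pderiv[OF hom, folded \<Phi>_def] map_poly_hom_pCons[OF hom, folded \<Phi>_def]
  define g where "g = \<Phi> P"
  have "g \<noteq> 0"
  proof
    assume "g = 0"
    then have "E1 (lead_coeff P) = 0" using coeff_map_poly[of E1 P "degree P"] by (simp add: g_def \<Phi>_def)
    then show False using E1_eq_0[of "lead_coeff P"] P(1) by (simp add: relations_def)
  qed
  moreover have "poly g z = 0" using P(1) by (simp add: g_def \<Phi>_def relations_def E2_def)
  moreover have "coeff g i \<in> gen_subfield tt" for i
    by (simp add: g_def \<Phi>_def coeff_map_poly E1_subfield)
  moreover have "coprime g (pderiv g)"
  proof (rule coprimeI)
    fix k assume k: "k dvd g" "k dvd pderiv g"
    have "\<Phi> h = \<Phi> u * g + \<Phi> v * pderiv g"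
      by (simp add: uv(1) Phi g_def)
    moreover have "\<Phi> h = [:E1 r:]" by (simp add: r Phi) (simp add: \<Phi>_def)
    ultimately have "k dvd [:E1 r:]" using k by (simp add: dvd_add dvd_mult)
    moreover have "E1 r \<noteq> 0" using E1_eq_0[of r] uv(2) r by auto
    then have "[:E1 r:] dvd 1" by (simp add: is_unit_iff_degree)
    ultimately show "is_unit k" by (rule dvd_trans)
  qed
  ultimately show ?thesis by (intro exI[of _ g] conjI allI)
qed

end

lemma separable_morphism_if_wr_nonzero:
  fixes a b :: "'a::alg_closed_field poly"
  assumes "wr a b \<noteq> 0"
  shows "separable_morphism (a, b)"
  unfolding separable_morphism_def using separable_element[OF assms refl] by simp

section \<open>Polynomials over an algebraically closed field\<close>

lemma infinite_alg_closed: "infinite (UNIV :: 'a::alg_closed_field set)"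
proof
  assume fin: "finite (UNIV :: 'a set)"
  define q :: "'a poly" where "q = (\<Prod>c\<in>UNIV. [:-c, 1:]) + 1"
  have d: "degree (\<Prod>c\<in>(UNIV :: 'a set). [:-c, 1:]) = card (UNIV :: 'a set)"
    by (subst degree_prod_sum_eq) auto
  have "card (UNIV :: 'a set) > 0" using fin by (simp add: card_gt_0_iff)
  then have "degree q > 0" unfolding q_def using d by (subst degree_add_eq_left) auto
  then obtain x where "poly q x = 0" using alg_closed_imp_poly_has_root by blast
  moreover have "(\<Prod>c\<in>UNIV. poly [:-c, 1:] x) = 0"
    using fin by (intro prod_zero) (auto intro: bexI[of _ x])
  ultimately show False by (simp add: q_def poly_prod)
qed

lemma poly_eqI_pointwise:
  fixes p q :: "'a::alg_closed_field poly"
  assumes "\<And>x. poly p x = poly q x"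
  shows "p = q"
proof (rule ccontr)
  assume "p \<noteq> q"
  then have "finite {x. poly (p - q) x = 0}" by (intro poly_roots_finite) simp
  then show False using assms infinite_alg_closed[where 'a = 'a] by simp
qed

lemma exists_not_root:
  fixes p :: "'a::alg_closed_field poly"
  assumes "p \<noteq> 0" "finite S"
  shows "\<exists>x. x \<notin> S \<and> poly p x \<noteq> 0"
proof -
  have "finite (S \<union> {x. poly p x = 0})" using assms by (simp add: poly_roots_finite)
  then obtain x where "x \<notin> S \<union> {x. poly p x = 0}"
    using infinite_alg_closed[where 'a = 'a] by (metis ex_new_if_finite)
  then show ?thesis by auto
qed

lemma sum_order:
  fixes q :: "'a::alg_closed_field poly"
  assumes "q \<noteq> 0"
  shows "(\<Sum>x | poly q x = 0. order x q) = degree q"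
proof -
  obtain A where A: "size A = degree q" "q = smult (lead_coeff q) (\<Prod>x\<in>#A. [:-x, 1:])"
    using alg_closed_imp_factorization[OF assms] by blast
  have "proots q = proots (\<Prod>x\<in>#A. [:-x, 1:])"
    using assms by (subst A(2)) (subst proots_smult, simp_all)
  also have "\<dots> = A"
  proof (induction A)
    case (add x A)
    have "(\<Prod>x\<in>#A. [:-x, 1:]) \<noteq> 0" by (auto simp: prod_mset_zero_iff)
    then have "proots ([:-x, 1:] * (\<Prod>x\<in>#A. [:-x, 1:])) = proots [:-x, 1:] + proots (\<Prod>x\<in>#A. [:-x, 1:])"
      by (intro proots_mult) auto
    then show ?case using add by (simp del: mult_pCons_left)
  qed simp
  finally have "proots q = A" .
  then have "degree q = size (proots q)" using A(1) by simp
  also have "\<dots> = (\<Sum>x\<in>set_mset (proots q). count (proots q) x)" by (simp add: size_multiset_overloaded_eq)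
  finally show ?thesis using assms by simp
qed

section \<open>Binary forms and composition of morphisms\<close>

text \<open>\<open>hv d q\<close> is the binary form of degree \<open>d\<close> with dehomogenization \<open>q\<close>. Correspondingly, the value of
  a form of degree \<open>m\<close> at \<^term>\<open>Infty\<close> is its coefficient of degree \<open>m\<close>.\<close>

definition hv :: "nat \<Rightarrow> 'a::field poly \<Rightarrow> 'a \<Rightarrow> 'a \<Rightarrow> 'a" where
  "hv d q u v = (\<Sum>i\<le>d. coeff q i * (u ^ i * v ^ (d - i)))"

definition hom_sub :: "nat \<Rightarrow> 'a::field poly \<Rightarrow> 'a poly \<Rightarrow> 'a poly \<Rightarrow> 'a poly" where
  "hom_sub d q s1 s2 = (\<Sum>i\<le>d. smult (coeff q i) (s1 ^ i * s2 ^ (d - i)))"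

fun evP :: "nat \<Rightarrow> 'a::field poly \<Rightarrow> 'a proj_line \<Rightarrow> 'a" where
  "evP m s (Fin x) = poly s x"
| "evP m s Infty = coeff s m"

lemma hv_0: "hv d q u 0 = coeff q d * u ^ d"
proof -
  have "hv d q u 0 = (\<Sum>i\<le>d. if i = d then coeff q d * u ^ d else 0)"
    unfolding hv_def by (intro sum.cong) (auto simp: power_0_left)
  then show ?thesis by simp
qed

lemma hv_nonzero:
  assumes "degree q \<le> d" "v \<noteq> 0"
  shows "hv d q u v = v ^ d * poly q (u / v)"
proof -
  have "poly q (u / v) = (\<Sum>i\<le>d. coeff q i * (u / v) ^ i)"
    unfolding poly_altdef using assms(1)
    by (intro sum.mono_neutral_left) (auto simp: coeff_eq_0)
  then have "v ^ d * poly q (u / v) = (\<Sum>i\<le>d. v ^ d * (coeff q i * (u / v) ^ i))"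
    by (simp add: sum_distrib_left)
  also have "\<dots> = hv d q u v"
    unfolding hv_def
  proof (rule sum.cong)
    fix i assume "i \<in> {..d}"
    then have "v ^ d = v ^ i * v ^ (d - i)" by (simp flip: power_add)
    then show "v ^ d * (coeff q i * (u / v) ^ i) = coeff q i * (u ^ i * v ^ (d - i))"
      using assms(2) by (simp add: power_divide)
  qed simp
  finally show ?thesis ..
qed

lemma hv_mult:
  assumes "degree p \<le> i" "degree q \<le> j"
  shows "hv (i + j) (p * q) u v = hv i p u v * hv j q u v"
proof (cases "v = 0")
  case True
  then show ?thesis using assms by (simp add: hv_0 coeff_mult_le_degrees power_add)
next
  case False
  have "degree (p * q) \<le> i + j" using degree_mult_le[of p q] assms by linarith
  then show ?thesis using False assms by (simp add: hv_nonzero power_add)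
qed

lemma poly_hom_sub: "poly (hom_sub d q s1 s2) x = hv d q (poly s1 x) (poly s2 x)"
  by (simp add: hom_sub_def hv_def poly_sum)

lemma degree_hom_sub_le:
  assumes "degree s1 \<le> m" "degree s2 \<le> m"
  shows "degree (hom_sub d q s1 s2) \<le> d * m"
proof -
  have "degree (s1 ^ i * s2 ^ (d - i)) \<le> d * m" if "i \<le> d" for i
  proof -
    have "degree (s1 ^ i) \<le> i * m" "degree (s2 ^ (d - i)) \<le> (d - i) * m"
      using degree_power_le[of s1 i] degree_power_le[of s2 "d - i"] assms
      by (auto intro: order.trans simp: mult.commute)
    then have "degree (s1 ^ i * s2 ^ (d - i)) \<le> i * m + (d - i) * m"
      using degree_mult_le[of "s1 ^ i" "s2 ^ (d - i)"] by linarith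
    then show ?thesis using that by (simp flip: add_mult_distrib)
  qed
  then show ?thesis
    unfolding hom_sub_def by (intro degree_sum_le order.trans[OF degree_smult_le]) auto
qed

lemma coeff_power_le_degree: "degree s \<le> m \<Longrightarrow> coeff (s ^ k) (k * m) = coeff s m ^ k"
proof (induction k)
  case (Suc k)
  have "degree (s ^ k) \<le> k * m"
    using degree_power_le[of s k] Suc.prems by (auto intro: order.trans simp: mult.commute)
  then have "coeff (s * s ^ k) (m + k * m) = coeff s m * coeff (s ^ k) (k * m)"
    using Suc.prems by (intro coeff_mult_le_degrees)
  then show ?case using Suc by simp
qed simp

lemma coeff_hom_sub:
  assumes "degree s1 \<le> m" "degree s2 \<le> m"
  shows "coeff (hom_sub d q s1 s2) (d * m) = hv d q (coeff s1 m) (coeff s2 m)"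
proof -
  have "coeff (s1 ^ i * s2 ^ (d - i)) (d * m) = coeff s1 m ^ i * coeff s2 m ^ (d - i)" if "i \<le> d" for i
  proof -
    have "degree (s1 ^ i) \<le> i * m" "degree (s2 ^ (d - i)) \<le> (d - i) * m"
      using degree_power_le[of s1 i] degree_power_le[of s2 "d - i"] assms
      by (auto intro: order.trans simp: mult.commute)
    then have "coeff (s1 ^ i * s2 ^ (d - i)) (i * m + (d - i) * m) =
        coeff s1 m ^ i * coeff s2 m ^ (d - i)"
      using assms by (simp add: coeff_mult_le_degrees coeff_power_le_degree)
    then show ?thesis using that by (simp flip: add_mult_distrib)
  qed
  then show ?thesis by (simp add: hom_sub_def hv_def coeff_sum)
qed

lemma evP_hom_sub:
  assumes "degree s1 \<le> m" "degree s2 \<le> m"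
  shows "evP (d * m) (hom_sub d q s1 s2) P = hv d q (evP m s1 P) (evP m s2 P)"
  using assms by (cases P) (simp_all add: poly_hom_sub coeff_hom_sub)

lemma hom_sub_mult:
  fixes p q :: "'a::alg_closed_field poly"
  assumes "degree p \<le> i" "degree q \<le> j"
  shows "hom_sub (i + j) (p * q) s1 s2 = hom_sub i p s1 s2 * hom_sub j q s1 s2"
  using assms by (intro poly_eqI_pointwise) (simp add: poly_hom_sub hv_mult)

lemma hom_sub_lin: "hom_sub d (p - smult c q) s1 s2 = hom_sub d p s1 s2 - smult c (hom_sub d q s1 s2)"
proof -
  have "smult c (\<Sum>i\<in>I. f i) = (\<Sum>i\<in>I. smult c (f i))" for f :: "nat \<Rightarrow> 'a poly" and I
    by (induction I rule: infinite_finite_induct) (simp_all add: smult_add_right)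
  then show ?thesis by (simp add: hom_sub_def smult_diff_left sum_subtractf)
qed

definition mcomp :: "'a::field ratpair \<Rightarrow> 'a ratpair \<Rightarrow> 'a ratpair" where
  "mcomp f s = (hom_sub (mdegree f) (fst f) (fst s) (snd s), hom_sub (mdegree f) (snd f) (fst s) (snd s))"

lemma mapply_evP: "mapply f P = proj_pt (evP (mdegree f) (fst f) P) (evP (mdegree f) (snd f) P)"
  by (cases P) simp_all

lemma degree_le_mdegree: "degree (fst f) \<le> mdegree f" "degree (snd f) \<le> mdegree f"
  by (simp_all add: mdegree_def)

lemma morphism_nonzero: "is_morphism f \<Longrightarrow> fst f \<noteq> 0 \<or> snd f \<noteq> 0"
  by (auto simp: is_morphism_def)

lemma evP_nonzero:
  assumes "is_morphism f"
  shows "evP (mdegree f) (fst f) P \<noteq> 0 \<or> evP (mdegree f) (snd f) P \<noteq> 0"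
proof (cases P)
  case (Fin x)
  then show ?thesis using coprime_poly_no_common_root[of "fst f" "snd f" x] assms
    by (auto simp: is_morphism_def)
next
  case Infty
  show ?thesis
  proof (cases "degree (snd f) \<le> degree (fst f)")
    case True
    then have m: "mdegree f = degree (fst f)" by (simp add: mdegree_def)
    show ?thesis
    proof (cases "fst f = 0")
      case z: True
      then have "degree (snd f) = 0" "snd f \<noteq> 0" using True morphism_nonzero[OF assms] by auto
      then have "coeff (snd f) 0 \<noteq> 0" by (metis leading_coeff_0_iff)
      then show ?thesis using z Infty by (simp add: m)
    qed (simp add: m Infty)
  next
    case False
    then have "mdegree f = degree (snd f)" by (simp add: mdegree_def)
    then show ?thesis using False Infty by auto
  qed
qed

lemma hv_pair_nonzero:
  assumes "is_morphism f" "u \<noteq> 0 \<or> v \<noteq> 0"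
  shows "hv (mdegree f) (fst f) u v \<noteq> 0 \<or> hv (mdegree f) (snd f) u v \<noteq> 0"
proof (cases "v = 0")
  case True
  then show ?thesis using assms evP_nonzero[OF assms(1), of Infty] by (simp add: hv_0)
next
  case False
  then show ?thesis using evP_nonzero[OF assms(1), of "Fin (u / v)"] degree_le_mdegree[of f]
    by (simp add: hv_nonzero)
qed

lemma proj_pt_scale: "c \<noteq> 0 \<Longrightarrow> proj_pt (c * u) (c * v) = proj_pt u v"
  by (simp add: proj_pt_def)

lemma mapply_proj_pt:
  assumes "u \<noteq> 0 \<or> v \<noteq> 0"
  shows "mapply f (proj_pt u v) = proj_pt (hv (mdegree f) (fst f) u v) (hv (mdegree f) (snd f) u v)"
proof (cases "v = 0")
  case True
  let ?d = "mdegree f"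
  have "proj_pt (coeff (fst f) ?d * u ^ ?d) (coeff (snd f) ?d * u ^ ?d) = proj_pt (coeff (fst f) ?d) (coeff (snd f) ?d)"
    using True assms proj_pt_scale[of "u ^ ?d" "coeff (fst f) ?d" "coeff (snd f) ?d"]
    by (simp add: mult.commute)
  moreover have "proj_pt u v = Infty" using True by (simp add: proj_pt_def)
  ultimately show ?thesis using True by (simp add: hv_0)
next
  case False
  then show ?thesis using degree_le_mdegree[of f]
    by (simp add: proj_pt_def[of u v] hv_nonzero proj_pt_scale)
qed

text \<open>Everything follows from one fact: the two composed forms have no common zero. At finite
  points this is coprimality, and at infinity it says that the degree does not drop.\<close>

lemma mcomp_morphism:
  fixes f s :: "'a::alg_closed_field ratpair"
  assumes f: "is_morphism f" and s: "is_morphism s"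
  shows "is_morphism (mcomp f s)" "mdegree (mcomp f s) = mdegree f * mdegree s"
    "mapply (mcomp f s) = mapply f \<circ> mapply s"
proof -
  note ds = degree_le_mdegree[of s]
  have ev: "evP (mdegree f * mdegree s) (fst (mcomp f s)) P = hv (mdegree f) (fst f) (evP (mdegree s) (fst s) P) (evP (mdegree s) (snd s) P)"
    "evP (mdegree f * mdegree s) (snd (mcomp f s)) P = hv (mdegree f) (snd f) (evP (mdegree s) (fst s) P) (evP (mdegree s) (snd s) P)" for P
    using ds by (simp_all add: mcomp_def evP_hom_sub)
  have nz: "evP (mdegree f * mdegree s) (fst (mcomp f s)) P \<noteq> 0 \<or> evP (mdegree f * mdegree s) (snd (mcomp f s)) P \<noteq> 0" for P
    unfolding ev by (rule hv_pair_nonzero[OF f evP_nonzero[OF s]])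
  show mor: "is_morphism (mcomp f s)"
    unfolding is_morphism_def
  proof (rule coprime_polyI_root)
    show "fst (mcomp f s) \<noteq> 0 \<or> snd (mcomp f s) \<noteq> 0"
      using nz[of "Fin 0"] by auto
  qed (use nz[of "Fin _"] in auto)
  have "degree (fst (mcomp f s)) \<le> mdegree f * mdegree s" "degree (snd (mcomp f s)) \<le> mdegree f * mdegree s"
    using ds by (simp_all add: mcomp_def degree_hom_sub_le)
  moreover have "mdegree f * mdegree s \<le> degree (fst (mcomp f s)) \<or> mdegree f * mdegree s \<le> degree (snd (mcomp f s))"
    using nz[of Infty] le_degree by auto
  ultimately show deg: "mdegree (mcomp f s) = mdegree f * mdegree s"
    unfolding mdegree_def[of "mcomp f s"] by linarith
  show "mapply (mcomp f s) = mapply f \<circ> mapply s"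
  proof
    fix P
    have "mapply f (mapply s P) = mapply f (proj_pt (evP (mdegree s) (fst s) P) (evP (mdegree s) (snd s) P))"
      by (simp add: mapply_evP)
    also have "\<dots> = mapply (mcomp f s) P"
      unfolding mapply_evP[of "mcomp f s"] deg ev by (rule mapply_proj_pt[OF evP_nonzero[OF s]])
    finally show "mapply (mcomp f s) P = (mapply f \<circ> mapply s) P" by simp
  qed
qed

text \<open>Equal values give equal cross products on infinitely many points; coprimality then makes
  the first components divide each other.\<close>

lemma same_map_proportional:
  fixes f g :: "'a::alg_closed_field ratpair"
  assumes f: "is_morphism f" and g: "is_morphism g" and eq: "mapply f = mapply g"
  obtains c where "c \<noteq> 0" "fst f = smult c (fst g)" "snd f = smult c (snd g)"
proof -
  have "fst f * snd g = fst g * snd f"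
  proof (rule poly_eqI_pointwise)
    fix x
    have "proj_pt (poly (fst f) x) (poly (snd f) x) = proj_pt (poly (fst g) x) (poly (snd g) x)"
      using fun_cong[OF eq, of "Fin x"] by simp
    then show "poly (fst f * snd g) x = poly (fst g * snd f) x"
      by (auto simp: proj_pt_def frac_eq_eq split: if_splits)
  qed
  note cross = this
  have cf: "coprime (fst f) (snd f)" and cg: "coprime (fst g) (snd g)" using f g by (auto simp: is_morphism_def)
  have "fst f dvd snd f * fst g" using cross by (metis dvd_triv_left mult.commute)
  then have d1: "fst f dvd fst g" by (rule coprime_poly_dvd_mult[OF cf])
  have "fst g dvd snd g * fst f" using cross by (metis dvd_triv_left mult.commute)
  then have d2: "fst g dvd fst f" by (rule coprime_poly_dvd_mult[OF cg])
  show ?thesis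
  proof (cases "fst g = 0")
    case True
    then have "fst f = 0" using d2 by simp
    then have "is_unit (snd f)" "is_unit (snd g)" using True cf cg by auto
    then obtain c c' where c: "snd f = [:c:]" "c \<noteq> 0" "snd g = [:c':]" "c' \<noteq> 0"
      unfolding is_unit_poly_iff by (auto simp: dvd_field_iff)
    show ?thesis by (rule that[of "c / c'"]) (use c True \<open>fst f = 0\<close> in auto)
  next
    case False
    then have "fst f \<noteq> 0" using d1 by auto
    obtain q where q: "fst f = fst g * q" using d2 by (elim dvdE)
    have "degree q = 0"
      using dvd_imp_degree_le[OF d1 False] \<open>fst f \<noteq> 0\<close> unfolding q by (auto simp: degree_mult_eq)
    then obtain c where c: "q = [:c:]" by (rule degree_eq_zeroE)
    have ff: "fst f = smult c (fst g)" using q c by simp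
    have "c \<noteq> 0" using ff \<open>fst f \<noteq> 0\<close> by auto
    moreover have "fst g * snd f = fst g * smult c (snd g)" using cross ff by simp
    then have "snd f = smult c (snd g)" using False by (simp del: mult_smult_right)
    ultimately show ?thesis using that ff by blast
  qed
qed

section \<open>Orders of forms and ramification indices\<close>

fun ordP :: "nat \<Rightarrow> 'a::field poly \<Rightarrow> 'a proj_line \<Rightarrow> nat" where
  "ordP d q (Fin x) = order x q"
| "ordP d q Infty = d - degree q"

lemma ram_index_ordP: "ram_index f P = ordP (mdegree f) (pullback_form f (mapply f P)) P"
  by (cases P) simp_all

lemma degree_pullback_le: "degree (pullback_form f Q) \<le> mdegree f"
  using degree_le_mdegree[of f]
  by (cases Q) (auto intro!: degree_diff_le order.trans[OF degree_smult_le])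

lemma pullback_nonzero:
  assumes "is_morphism f" "0 < mdegree f"
  shows "pullback_form f Q \<noteq> 0"
proof
  assume z: "pullback_form f Q = 0"
  have cf: "coprime (fst f) (snd f)" using assms(1) by (simp add: is_morphism_def)
  show False
  proof (cases Q)
    case (Fin c)
    then have "fst f = smult c (snd f)" using z by simp
    then have "snd f dvd fst f" by (simp add: dvd_smult)
    then have "is_unit (snd f)" using cf by (metis coprime_common_divisor dvd_refl)
    then have "degree (snd f) = 0" using is_unit_iff_degree by (metis not_is_unit_0)
    then have "mdegree f = 0" using \<open>fst f = smult c (snd f)\<close> by (simp add: mdegree_def)
    then show False using assms(2) by simp
  next
    case Infty
    then have "snd f = 0" using z by simp
    then have "is_unit (fst f)" using cf by simp
    then have "degree (fst f) = 0" using is_unit_iff_degree by (metis not_is_unit_0)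
    then show False using assms(2) \<open>snd f = 0\<close> by (simp add: mdegree_def)
  qed
qed

lemma evP_pullback: "evP m (pullback_form f (Fin c)) P = evP m (fst f) P - c * evP m (snd f) P"
  by (cases P) simp_all

lemma mapply_eq_iff:
  assumes "is_morphism f"
  shows "mapply f P = Q \<longleftrightarrow> evP (mdegree f) (pullback_form f Q) P = 0"
proof (cases Q)
  case (Fin c)
  then show ?thesis using evP_nonzero[OF assms, of P] unfolding mapply_evP Fin evP_pullback
    by (auto simp: proj_pt_def field_simps)
next
  case Infty
  then show ?thesis unfolding mapply_evP by (auto simp: proj_pt_def)
qed

lemma ordP_pos_iff:
  assumes "q \<noteq> 0" "degree q \<le> d" "0 < d"
  shows "0 < ordP d q P \<longleftrightarrow> evP d q P = 0"
proof (cases P)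
  case (Fin x)
  then show ?thesis using assms by (simp add: order_root)
next
  case Infty
  have "coeff q d = 0 \<longleftrightarrow> degree q < d"
    using assms by (metis coeff_eq_0 leading_coeff_0_iff nat_less_le)
  then show ?thesis using Infty assms by auto
qed

lemma mapply_eq_iff_ordP:
  assumes "is_morphism f" "0 < mdegree f"
  shows "mapply f P = Q \<longleftrightarrow> 0 < ordP (mdegree f) (pullback_form f Q) P"
  using mapply_eq_iff[OF assms(1)] ordP_pos_iff[OF pullback_nonzero[OF assms] degree_pullback_le assms(2)]
  by simp

lemma ram_index_pos:
  assumes "is_morphism f" "0 < mdegree f"
  shows "0 < ram_index f P"
  unfolding ram_index_ordP using mapply_eq_iff_ordP[OF assms] by blast

lemma zeros_form:
  fixes q :: "'a::alg_closed_field poly"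
  assumes "q \<noteq> 0" "degree q \<le> d" "0 < d"
  shows "finite {P. evP d q P = 0}" "(\<Sum>P | evP d q P = 0. ordP d q P) = d"
proof -
  define R where "R = {x. poly q x = 0}"
  have finR: "finite R" using assms by (simp add: R_def poly_roots_finite)
  have eq: "{P. evP d q P = 0} = Fin ` R \<union> (if coeff q d = 0 then {Infty} else {})"
  proof (rule Set.set_eqI)
    fix P show "P \<in> {P. evP d q P = 0} \<longleftrightarrow> P \<in> Fin ` R \<union> (if coeff q d = 0 then {Infty} else {})"
      by (cases P) (auto simp: R_def)
  qed
  show "finite {P. evP d q P = 0}" unfolding eq using finR by simp
  have "(\<Sum>P\<in>Fin ` R. ordP d q P) = degree q"
    using sum_order[OF assms(1)] by (subst sum.reindex) (auto simp: R_def inj_on_def)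
  moreover have "(\<Sum>P\<in>(if coeff q d = 0 then {Infty} else {}). ordP d q P) = d - degree q"
    using assms(2) le_degree[of q d] by auto
  ultimately show "(\<Sum>P | evP d q P = 0. ordP d q P) = d"
    unfolding eq using finR assms(2) by (subst sum.union_disjoint) auto
qed

lemma fiber:
  fixes f :: "'a::alg_closed_field ratpair"
  assumes "is_morphism f" "0 < mdegree f"
  shows "finite {P. mapply f P = Q}" "(\<Sum>P | mapply f P = Q. ram_index f P) = mdegree f"
proof -
  note z = zeros_form[OF pullback_nonzero[OF assms] degree_pullback_le assms(2), of Q]
  have eq: "{P. mapply f P = Q} = {P. evP (mdegree f) (pullback_form f Q) P = 0}"
    using mapply_eq_iff[OF assms(1)] by simp
  show "finite {P. mapply f P = Q}" unfolding eq by (rule z)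
  have "(\<Sum>P | mapply f P = Q. ram_index f P) = (\<Sum>P | mapply f P = Q. ordP (mdegree f) (pullback_form f Q) P)"
    by (rule sum.cong) (auto simp: ram_index_ordP)
  then show "(\<Sum>P | mapply f P = Q. ram_index f P) = mdegree f" using z(2) unfolding eq by simp
qed

text \<open>The indices over a point sum to the degree. Once one of them is \<open>e\<close> and the
  others are 1, the number of points is forced, so the condition on the multiset becomes one on
  individual points.\<close>

lemma fiber_single_cycle:
  fixes f :: "'a::alg_closed_field ratpair"
  assumes f: "is_morphism f" "0 < mdegree f" and e: "1 < e"
  shows "image_mset (ram_index f) (mset_set {P. mapply f P = Q}) = single_cycle (mdegree f) e \<longleftrightarrow>
    (\<exists>P. mapply f P = Q \<and> ram_index f P = e \<and> (\<forall>P'. mapply f P' = Q \<and> P' \<noteq> P \<longrightarrow> ram_index f P' = 1))"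
    (is "?l \<longleftrightarrow> ?r")
proof -
  let ?S = "{P. mapply f P = Q}"
  note fin = fiber(1)[OF f, of Q]
  have split: "image_mset (ram_index f) (mset_set ?S) = {#ram_index f P#} + image_mset (ram_index f) (mset_set (?S - {P}))"
    if "P \<in> ?S" for P
    using mset_set.remove[OF fin that] by simp
  show ?thesis
  proof
    assume l: ?l
    have "e \<in># image_mset (ram_index f) (mset_set ?S)" unfolding l by (simp add: single_cycle_def)
    then obtain P where P: "P \<in> ?S" "ram_index f P = e" using fin by auto
    have "image_mset (ram_index f) (mset_set (?S - {P})) = replicate_mset (mdegree f - e) 1"
      using split[OF P(1)] l P(2) by (simp add: single_cycle_def)
    then have "set_mset (image_mset (ram_index f) (mset_set (?S - {P}))) \<subseteq> {1}"
      by (simp add: set_mset_replicate_mset_subset)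
    then have "ram_index f P' = 1" if "P' \<in> ?S - {P}" for P'
      using that fin by auto
    with P show ?r by auto
  next
    assume ?r
    then obtain P where P: "P \<in> ?S" "ram_index f P = e" "\<forall>P'\<in>?S - {P}. ram_index f P' = 1" by auto
    have "image_mset (ram_index f) (mset_set (?S - {P})) = image_mset (\<lambda>_. 1) (mset_set (?S - {P}))"
      using P(3) fin by (intro image_mset_cong) auto
    also have "\<dots> = replicate_mset (card (?S - {P})) 1" by (simp add: image_mset_const_eq)
    finally have im: "image_mset (ram_index f) (mset_set (?S - {P})) = replicate_mset (card (?S - {P})) 1" .
    have "mdegree f = ram_index f P + (\<Sum>P'\<in>?S - {P}. ram_index f P')"
      using fiber(2)[OF f, of Q] sum.remove[OF fin P(1), of "ram_index f"] by simp
    also have "(\<Sum>P'\<in>?S - {P}. ram_index f P') = card (?S - {P})" using P(3) by simp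
    finally have "card (?S - {P}) = mdegree f - e" using P(2) by simp
    then show ?l using split[OF P(1)] im P(2) by (simp add: single_cycle_def)
  qed
qed

lemma ordP_linear_power:
  fixes L :: "'a::field poly"
  assumes L: "L \<noteq> 0" "degree L \<le> 1" "evP 1 L P = 0" and R: "degree R \<le> j" "evP j R P \<noteq> 0"
  shows "ordP (k + j) (L ^ k * R) P = k"
proof (cases P)
  case (Fin x)
  then have "[:-x, 1:] dvd L" using L by (simp add: poly_eq_0_iff_dvd)
  then obtain q where q: "L = [:-x, 1:] * q" by (elim dvdE)
  have "q \<noteq> 0" using L q by auto
  then have "degree q = 0" using L(2) unfolding q by (subst (asm) degree_mult_eq) auto
  then obtain c where c: "q = [:c:]" by (rule degree_eq_zeroE)
  have L': "L = smult c [:-x, 1:]" using q c by simp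
  have "c \<noteq> 0" using L L' by auto
  have "R \<noteq> 0" using R Fin by auto
  have "L ^ k * R = smult (c ^ k) ([:-x, 1:] ^ k * R)" unfolding L' smult_power by simp
  then have "order x (L ^ k * R) = order x ([:-x, 1:] ^ k * R)"
    by (simp only: order_smult[OF power_not_zero[OF \<open>c \<noteq> 0\<close>]])
  also have "\<dots> = order x ([:-x, 1:] ^ k) + order x R"
    using \<open>R \<noteq> 0\<close> by (intro order_mult) auto
  also have "order x R = 0" using R Fin by (intro order_0I) simp
  finally show ?thesis using Fin by (simp add: order_power_n_n)
next
  case Infty
  then have "degree L = 0" using L by (metis evP.simps(2) degree_0 leading_coeff_0_iff le_neq_implies_less less_one)
  then obtain c where c: "L = [:c:]" by (rule degree_eq_zeroE)
  have "c \<noteq> 0" using L c by auto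
  have "degree R = j" using R Infty le_degree[of R j] by simp
  then have "degree (L ^ k * R) = j"
    using \<open>c \<noteq> 0\<close> by (simp add: c poly_const_pow)
  then show ?thesis using Infty by simp
qed

text \<open>Split off from \<open>q\<close> the full power of the linear form vanishing at
  \<open>mapply s P\<close>. Substitution turns it into a power of a linear form vanishing at
  \<open>P\<close> and the cofactor into a form that is nonzero there.\<close>

lemma ordP_hom_sub:
  fixes q :: "'a::alg_closed_field poly"
  assumes s: "is_morphism s" "mdegree s = 1" and q: "q \<noteq> 0" "degree q \<le> d"
  shows "ordP d (hom_sub d q (fst s) (snd s)) P = ordP d q (mapply s P)"
proof -
  define u v where "u = evP 1 (fst s) P" and "v = evP 1 (snd s) P"
  have uv: "u \<noteq> 0 \<or> v \<noteq> 0" using evP_nonzero[OF s(1), of P] by (simp add: u_def v_def s(2))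
  have sP: "mapply s P = proj_pt u v" by (simp add: mapply_evP u_def v_def s(2))
  note ds = degree_le_mdegree[of s, unfolded s(2)]
  have L: "pullback_form s Q \<noteq> 0" "degree (pullback_form s Q) \<le> 1" for Q
    using pullback_nonzero[OF s(1), of Q] degree_pullback_le[of s Q] s(2) by auto
  have L0: "evP 1 (pullback_form s (mapply s P)) P = 0"
    using mapply_eq_iff[OF s(1), of P "mapply s P"] s(2) by simp
  show ?thesis
  proof (cases "mapply s P")
    case (Fin c)
    define k where "k = order c q"
    obtain r where r: "q = [:-c, 1:] ^ k * r" "\<not> [:-c, 1:] dvd r"
      unfolding k_def using order_decomp[OF q(1)] by blast
    have rnz: "r \<noteq> 0" "poly r c \<noteq> 0" using r(2) by (auto simp: poly_eq_0_iff_dvd)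
    have "degree q = k + degree r" using rnz unfolding r(1) by (simp add: degree_mult_eq degree_power_eq)
    then have dr: "degree r \<le> d - k" and kd: "k \<le> d" using q(2) by auto
    have lin: "hom_sub k ([:-c, 1:] ^ k) (fst s) (snd s) = (fst s - smult c (snd s)) ^ k" for k
    proof (induction k)
      case 0
      show ?case by (simp add: hom_sub_def)
    next
      case (Suc k)
      have "hom_sub (1 + k) ([:-c, 1:] * [:-c, 1:] ^ k) (fst s) (snd s) =
        hom_sub 1 [:-c, 1:] (fst s) (snd s) * hom_sub k ([:-c, 1:] ^ k) (fst s) (snd s)"
        by (rule hom_sub_mult) (simp_all add: degree_power_eq)
      moreover have "hom_sub 1 [:-c, 1:] (fst s) (snd s) = fst s - smult c (snd s)"
        by (simp add: hom_sub_def)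
      ultimately show ?case using Suc by simp
    qed
    have "hom_sub (k + (d - k)) q (fst s) (snd s) =
        (fst s - smult c (snd s)) ^ k * hom_sub (d - k) r (fst s) (snd s)"
      unfolding r(1) using dr by (subst hom_sub_mult) (simp_all add: lin degree_power_eq)
    moreover have "evP (d - k) (hom_sub (d - k) r (fst s) (snd s)) P \<noteq> 0"
    proof -
      have "v \<noteq> 0" "u / v = c" using sP Fin by (auto simp: proj_pt_def split: if_splits)
      then show ?thesis using evP_hom_sub[OF ds, of "d - k" r P, folded u_def v_def] dr rnz
        by (simp add: hv_nonzero)
    qed
    moreover have "degree (hom_sub (d - k) r (fst s) (snd s)) \<le> d - k"
      using degree_hom_sub_le[OF ds, of "d - k" r] by simp
    ultimately show ?thesis
      using ordP_linear_power[OF L L0, of "hom_sub (d - k) r (fst s) (snd s)" "d - k" k] kd Fin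
      by (simp add: k_def)
  next
    case Infty
    define j where "j = degree q"
    have jd: "j \<le> d" using q(2) by (simp add: j_def)
    \<comment> \<open>As a form of degree \<open>d\<close>, \<open>q\<close> contains a power of the
      form vanishing at infinity, with exponent \<open>d - j\<close>. The dehomogenization of this
      power is 1.\<close>
    have "hom_sub ((d - j) + j) (1 * q) (fst s) (snd s) =
        hom_sub (d - j) 1 (fst s) (snd s) * hom_sub j q (fst s) (snd s)"
      by (rule hom_sub_mult) (simp_all add: j_def)
    moreover have "hom_sub (d - j) 1 (fst s) (snd s) = snd s ^ (d - j)"
    proof (rule poly_eqI_pointwise)
      fix x
      have "hv m 1 y w = w ^ m" for m and y w :: 'a
      proof -
        have "hv m 1 y w = (\<Sum>i\<le>m. if i = 0 then w ^ m else 0)"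
          unfolding hv_def by (intro sum.cong) (auto simp: coeff_1)
        then show ?thesis by simp
      qed
      then show "poly (hom_sub (d - j) 1 (fst s) (snd s)) x = poly (snd s ^ (d - j)) x"
        by (simp add: poly_hom_sub)
    qed
    moreover have "evP j (hom_sub j q (fst s) (snd s)) P \<noteq> 0"
    proof -
      have "v = 0" "u \<noteq> 0" using sP Infty uv by (auto simp: proj_pt_def split: if_splits)
      then show ?thesis using evP_hom_sub[OF ds, of j q P, folded u_def v_def] q(1)
        by (simp add: hv_0 j_def)
    qed
    moreover have "degree (hom_sub j q (fst s) (snd s)) \<le> j"
      using degree_hom_sub_le[OF ds, of j q] by simp
    ultimately show ?thesis
      using ordP_linear_power[OF L L0, of "hom_sub j q (fst s) (snd s)" j "d - j"] jd Infty
      by (simp add: j_def)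
  qed
qed

lemma pullback_mcomp: "pullback_form (mcomp f s) Q = hom_sub (mdegree f) (pullback_form f Q) (fst s) (snd s)"
  by (cases Q) (simp_all add: mcomp_def hom_sub_lin)

lemma ram_index_mcomp:
  fixes f s :: "'a::alg_closed_field ratpair"
  assumes f: "is_morphism f" "0 < mdegree f" and s: "is_morphism s" "mdegree s = 1"
  shows "ram_index (mcomp f s) P = ram_index f (mapply s P)"
  using mcomp_morphism[OF f(1) s(1)] ordP_hom_sub[OF s pullback_nonzero[OF f] degree_pullback_le]
  by (simp add: ram_index_ordP pullback_mcomp s(2))

lemma ram_index_same_map:
  fixes f g :: "'a::alg_closed_field ratpair"
  assumes "is_morphism f" "is_morphism g" "mapply f = mapply g"
  shows "ram_index f = ram_index g" "mdegree f = mdegree g"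
proof -
  obtain c where c: "c \<noteq> 0" "fst f = smult c (fst g)" "snd f = smult c (snd g)"
    using same_map_proportional[OF assms] .
  show m: "mdegree f = mdegree g" using c by (simp add: mdegree_def)
  have pf: "pullback_form f Q = smult c (pullback_form g Q)" for Q
    by (cases Q) (simp_all add: c smult_diff_right mult.commute)
  have "ordP d (smult c q) P = ordP d q P" for d q P
    using c(1) by (cases P) (simp_all add: order_smult)
  then show "ram_index f = ram_index g"
    by (intro ext) (simp add: ram_index_ordP m pf assms(3))
qed

section \<open>Isomorphisms of covers\<close>

definition id_pair :: "'a::field ratpair" where
  "id_pair = ([:0, 1:], 1)"

lemma id_pair:
  "is_morphism (id_pair :: 'a::field ratpair)" "mdegree (id_pair :: 'a::field ratpair) = 1"
  "mapply (id_pair :: 'a::field ratpair) = id"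
proof -
  show "is_morphism (id_pair :: 'a ratpair)" "mdegree (id_pair :: 'a ratpair) = 1" by (simp_all add: id_pair_def is_morphism_def mdegree_def)
  have "mapply id_pair P = P" for P :: "'a proj_line"
    by (cases P) (simp_all add: id_pair_def mdegree_def proj_pt_def)
  then show "mapply id_pair = (id :: 'a proj_line \<Rightarrow> _)" by auto
qed

lemma inverse_degree_1:
  fixes s t :: "'a::alg_closed_field ratpair"
  assumes "is_morphism s" "is_morphism t" "mapply s \<circ> mapply t = id"
  shows "mdegree s = 1"
proof -
  have "mdegree (mcomp s t) = mdegree (id_pair :: 'a ratpair)"
    using mcomp_morphism[OF assms(1,2)] assms(3) id_pair[where 'a = 'a]
    by (intro ram_index_same_map(2)) auto
  then show ?thesis using mcomp_morphism(2)[OF assms(1,2)] id_pair(2)[where 'a = 'a] by simp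
qed

lemma cover_iso_refl:
  fixes f :: "'a::field ratpair"
  shows "is_morphism f \<Longrightarrow> (f, f) \<in> cover_iso"
  unfolding cover_iso_def using id_pair[where 'a = 'a] by (auto intro!: exI[of _ id_pair] simp del: split_paired_Ex)

lemma cover_iso_same_map:
  fixes f g :: "'a::field ratpair"
  shows "is_morphism f \<Longrightarrow> is_morphism g \<Longrightarrow> mapply f = mapply g \<Longrightarrow> (f, g) \<in> cover_iso"
  unfolding cover_iso_def using id_pair[where 'a = 'a] by (auto intro!: exI[of _ id_pair] simp del: split_paired_Ex)

lemma cover_iso_sym: "(f, g) \<in> cover_iso \<Longrightarrow> (g, f) \<in> cover_iso"
proof -
  assume "(f, g) \<in> cover_iso"
  then obtain s t where *: "is_morphism f" "is_morphism g" "is_morphism s" "is_morphism t"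
    "mapply s \<circ> mapply t = id" "mapply t \<circ> mapply s = id" "mapply f = mapply g \<circ> mapply s"
    by (auto simp: cover_iso_def)
  have "mapply g = mapply f \<circ> mapply t" unfolding *(7) comp_assoc *(5) by simp
  with * show ?thesis unfolding cover_iso_def by blast
qed

lemma cover_iso_trans:
  fixes f g h :: "'a::alg_closed_field ratpair"
  assumes "(f, g) \<in> cover_iso" "(g, h) \<in> cover_iso"
  shows "(f, h) \<in> cover_iso"
proof -
  obtain s t where 1: "is_morphism f" "is_morphism g" "is_morphism s" "is_morphism t"
    "mapply s \<circ> mapply t = id" "mapply t \<circ> mapply s = id" "mapply f = mapply g \<circ> mapply s"
    using assms(1) by (auto simp: cover_iso_def)
  obtain s' t' where 2: "is_morphism h" "is_morphism s'" "is_morphism t'"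
    "mapply s' \<circ> mapply t' = id" "mapply t' \<circ> mapply s' = id" "mapply g = mapply h \<circ> mapply s'"
    using assms(2) by (auto simp: cover_iso_def)
  have "(mapply s' \<circ> mapply s) \<circ> (mapply t \<circ> mapply t') = mapply s' \<circ> (mapply s \<circ> mapply t) \<circ> mapply t'"
    "(mapply t \<circ> mapply t') \<circ> (mapply s' \<circ> mapply s) = mapply t \<circ> (mapply t' \<circ> mapply s') \<circ> mapply s"
    by (simp_all add: comp_assoc)
  then have "mapply (mcomp s' s) \<circ> mapply (mcomp t t') = id" "mapply (mcomp t t') \<circ> mapply (mcomp s' s) = id"
    using 1 2 by (simp_all add: mcomp_morphism)
  moreover have "mapply f = mapply h \<circ> mapply (mcomp s' s)"
    using 1 2 by (simp add: mcomp_morphism comp_assoc)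
  moreover have "is_morphism (mcomp s' s)" "is_morphism (mcomp t t')"
    using 1 2 by (simp_all add: mcomp_morphism)
  ultimately show ?thesis using 1(1) 2(1) unfolding cover_iso_def by blast
qed

lemma cover_iso_class_eq:
  fixes f g :: "'a::alg_closed_field ratpair"
  assumes "(f, g) \<in> cover_iso"
  shows "cover_iso `` {f} = cover_iso `` {g}"
  using assms cover_iso_sym cover_iso_trans by blast

section \<open>Moebius transformations\<close>

definition mob :: "'a::field \<Rightarrow> 'a \<Rightarrow> 'a \<Rightarrow> 'a \<Rightarrow> 'a ratpair" where
  "mob a b c d = ([:b, a:], [:d, c:])"

lemma mob_morphism:
  fixes a b c d :: "'a::alg_closed_field"
  assumes "a * d - b * c \<noteq> 0"
  shows "is_morphism (mob a b c d)" "mdegree (mob a b c d) = 1"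
    "mapply (mob a b c d) P = proj_pt (a * fst (hcoords P) + b * snd (hcoords P)) (c * fst (hcoords P) + d * snd (hcoords P))"
proof -
  have nz: "a \<noteq> 0 \<or> c \<noteq> 0" using assms by auto
  show m: "mdegree (mob a b c d) = 1" using nz by (auto simp: mob_def mdegree_def max_def)
  show "is_morphism (mob a b c d)"
    unfolding is_morphism_def
  proof (rule coprime_polyI_root)
    show "fst (mob a b c d) \<noteq> 0 \<or> snd (mob a b c d) \<noteq> 0" using nz by (auto simp: mob_def)
    fix x assume "poly (fst (mob a b c d)) x = 0" "poly (snd (mob a b c d)) x = 0"
    then have "b + a * x = 0" "d + c * x = 0" by (simp_all add: mob_def mult.commute)
    moreover have "a * d - b * c = a * (d + c * x) - c * (b + a * x)" by (simp add: algebra_simps)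
    ultimately show False using assms by simp
  qed
  show "mapply (mob a b c d) P = proj_pt (a * fst (hcoords P) + b * snd (hcoords P)) (c * fst (hcoords P) + d * snd (hcoords P))"
    using m by (cases P) (simp_all add: mob_def algebra_simps)
qed

lemma hcoords_proj_pt:
  assumes "u \<noteq> 0 \<or> v \<noteq> 0"
  obtains k where "k \<noteq> 0" "u = k * fst (hcoords (proj_pt u v))" "v = k * snd (hcoords (proj_pt u v))"
proof (cases "v = 0")
  case True
  then show ?thesis using assms by (intro that[of u]) (auto simp: proj_pt_def)
next
  case False
  then show ?thesis by (intro that[of v]) (auto simp: proj_pt_def)
qed

lemma proj_pt_hcoords: "k \<noteq> 0 \<Longrightarrow> proj_pt (k * fst (hcoords P)) (k * snd (hcoords P)) = P"
  by (cases P) (simp_all add: proj_pt_def)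

text \<open>The adjugate inverts a matrix up to the determinant, a scalar that homogeneous
  coordinates do not see.\<close>

lemma mob_inverse:
  fixes a b c d :: "'a::alg_closed_field"
  assumes "a * d - b * c \<noteq> 0"
  shows "mapply (mob d (- b) (- c) a) \<circ> mapply (mob a b c d) = id"
proof
  fix P :: "'a proj_line"
  define x y where "x = fst (hcoords P)" and "y = snd (hcoords P)"
  define u v where "u = a * x + b * y" and "v = c * x + d * y"
  have det: "d * a - (- b) * (- c) \<noteq> 0" using assms by (simp add: mult.commute)
  have inv: "d * u - b * v = (a * d - b * c) * x" "a * v - c * u = (a * d - b * c) * y"
    by (simp_all add: u_def v_def algebra_simps)
  have xy: "x \<noteq> 0 \<or> y \<noteq> 0" by (cases P) (auto simp: x_def y_def)
  then have "u \<noteq> 0 \<or> v \<noteq> 0" using inv assms by (metis diff_zero mult_eq_0_iff mult_zero_right)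
  then obtain k where k: "k \<noteq> 0" "u = k * fst (hcoords (proj_pt u v))" "v = k * snd (hcoords (proj_pt u v))"
    by (rule hcoords_proj_pt)
  let ?x = "fst (hcoords (proj_pt u v))" and ?y = "snd (hcoords (proj_pt u v))"
  have "mapply (mob d (- b) (- c) a) (mapply (mob a b c d) P) = proj_pt (d * ?x + (- b) * ?y) ((- c) * ?x + a * ?y)"
    using mob_morphism(3)[OF det] mob_morphism(3)[OF assms, of P] by (simp add: u_def v_def x_def y_def)
  also have "\<dots> = proj_pt (k * (d * ?x + (- b) * ?y)) (k * ((- c) * ?x + a * ?y))"
    by (rule proj_pt_scale[OF k(1), symmetric])
  also have "k * (d * ?x + (- b) * ?y) = d * (k * ?x) - b * (k * ?y)" by (simp add: algebra_simps)
  also have "k * ((- c) * ?x + a * ?y) = a * (k * ?y) - c * (k * ?x)" by (simp add: algebra_simps)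
  also have "proj_pt (d * (k * ?x) - b * (k * ?y)) (a * (k * ?y) - c * (k * ?x)) = proj_pt (d * u - b * v) (a * v - c * u)"
    using k by simp
  also have "\<dots> = P" unfolding inv x_def y_def using assms by (rule proj_pt_hcoords)
  finally show "(mapply (mob d (- b) (- c) a) \<circ> mapply (mob a b c d)) P = id P" by simp
qed

text \<open>The determinant of homogeneous coordinates. Cross ratios and distinctness are expressed
  through it, so that infinity is a branch point like any other.\<close>

definition br :: "'a::field proj_line \<Rightarrow> 'a proj_line \<Rightarrow> 'a" where
  "br P Q = fst (hcoords P) * snd (hcoords Q) - fst (hcoords Q) * snd (hcoords P)"

lemma br_eq_0_iff: "br P Q = 0 \<longleftrightarrow> P = Q"
  by (cases P; cases Q) (auto simp: br_def)

lemma exists_mobius: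
  fixes P1 P2 P3 :: "'a::alg_closed_field proj_line"
  assumes "P1 \<noteq> P2" "P1 \<noteq> P3" "P2 \<noteq> P3"
  obtains s t where "is_morphism s" "is_morphism t" "mdegree s = 1"
    "mapply s \<circ> mapply t = id" "mapply t \<circ> mapply s = id"
    "mapply s (Fin 0) = P1" "mapply s Infty = P2" "mapply s (Fin 1) = P3"
proof -
  define p1 q1 p2 q2 p3 q3 where "p1 = fst (hcoords P1)" "q1 = snd (hcoords P1)"
    "p2 = fst (hcoords P2)" "q2 = snd (hcoords P2)" "p3 = fst (hcoords P3)" "q3 = snd (hcoords P3)"
  note defs = this
  define \<alpha> \<beta> where "\<alpha> = br P1 P3" and "\<beta> = br P3 P2"
  have ab: "\<alpha> \<noteq> 0" "\<beta> \<noteq> 0" "br P2 P1 \<noteq> 0" "br P1 P2 \<noteq> 0" using assms by (auto simp: \<alpha>_def \<beta>_def br_eq_0_iff)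
  \<comment> \<open>The columns are coordinate vectors of \<open>P2\<close> and \<open>P1\<close>,
    scaled by Cramer's rule so that their sum is a coordinate vector of \<open>P3\<close>.\<close>
  define a b c d where "a = \<alpha> * p2" "b = \<beta> * p1" "c = \<alpha> * q2" "d = \<beta> * q1"
  note abcd = this
  have "a * d - b * c = \<alpha> * \<beta> * br P2 P1"
    by (simp add: abcd br_def defs algebra_simps)
  then have det: "a * d - b * c \<noteq> 0" using ab by simp
  have det': "d * a - (- b) * (- c) \<noteq> 0" using det by (simp add: mult.commute)
  show ?thesis
  proof (rule that)
    show "is_morphism (mob a b c d)" "mdegree (mob a b c d) = 1" "is_morphism (mob d (- b) (- c) a)"
      using mob_morphism det det' by blast+
    show "mapply (mob d (- b) (- c) a) \<circ> mapply (mob a b c d) = id" by (rule mob_inverse[OF det])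
    show "mapply (mob a b c d) \<circ> mapply (mob d (- b) (- c) a) = id"
      using mob_inverse[OF det'] by simp
    show "mapply (mob a b c d) (Fin 0) = P1" "mapply (mob a b c d) Infty = P2"
      using proj_pt_hcoords[OF ab(1), of P2] proj_pt_hcoords[OF ab(2), of P1]
      unfolding mob_morphism(3)[OF det] by (simp_all add: abcd defs)
    have "a + b = br P1 P2 * p3" "c + d = br P1 P2 * q3"
      by (simp_all add: abcd br_def defs \<alpha>_def \<beta>_def algebra_simps)
    then show "mapply (mob a b c d) (Fin 1) = P3"
      using proj_pt_hcoords[OF ab(4), of P3] unfolding mob_morphism(3)[OF det] by (simp add: defs)
  qed
qed

section \<open>Pure-cycle covers with four branch points\<close>

definition ramified_at :: "'a::field ratpair \<Rightarrow> 'a proj_line \<Rightarrow> 'a proj_line \<Rightarrow> nat \<Rightarrow> bool" where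
  "ramified_at f P Q e \<longleftrightarrow> mapply f P = Q \<and> ram_index f P = e \<and>
     (\<forall>P'. mapply f P' = Q \<and> P' \<noteq> P \<longrightarrow> ram_index f P' = 1)"

text \<open>If \<open>q\<close> is the member of the pencil vanishing at \<open>x\<close>, the
  Wronskian at \<open>x\<close> is the derivative of \<open>q\<close>, nonzero at a simple zero,
  times the nonzero value of the denominator.\<close>

lemma unramified_imp_wr_nonzero:
  assumes f: "is_morphism f" "0 < mdegree f" and ram: "ram_index f (Fin x) = 1" and fin: "mapply f (Fin x) \<noteq> Infty"
  shows "poly (wr (fst f) (snd f)) x \<noteq> 0"
proof -
  obtain c where c: "mapply f (Fin x) = Fin c" using fin by (cases "mapply f (Fin x)") auto
  define q where "q = fst f - smult c (snd f)"
  have o: "order x q = 1" using ram c by (simp add: q_def)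
  have "q \<noteq> 0" using pullback_nonzero[OF f, of "Fin c"] by (simp add: q_def)
  obtain r where r: "q = [:-x, 1:] ^ 1 * r" "\<not> [:-x, 1:] dvd r"
    using order_decomp[OF \<open>q \<noteq> 0\<close>, of x] unfolding o by blast
  have rx: "poly r x \<noteq> 0" using r(2) by (simp add: poly_eq_0_iff_dvd)
  have bx: "poly (snd f) x \<noteq> 0" using c by (auto simp: proj_pt_def split: if_splits)
  have "wr (fst f) (snd f) = wr q (snd f)" unfolding q_def wr_pencil'' ..
  moreover have "pderiv q = r + [:-x, 1:] * pderiv r"
    unfolding r(1) by (simp add: pderiv_mult pderiv_pCons del: mult_pCons_left)
  then have "poly (pderiv q) x = poly r x" by simp
  moreover have "poly q x = 0" unfolding r(1) by simp
  ultimately show ?thesis using rx bx by (simp add: wr_def)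
qed

lemma wr_nonzero_imp_unramified:
  fixes f :: "'a::alg_closed_field ratpair"
  assumes f: "is_morphism f" "0 < mdegree f" and w: "poly (wr (fst f) (snd f)) x \<noteq> 0"
  shows "ram_index f (Fin x) = 1"
proof (rule ccontr)
  let ?q = "pullback_form f (mapply f (Fin x))"
  assume "ram_index f (Fin x) \<noteq> 1"
  then have "2 \<le> order x ?q" using ram_index_pos[OF f, of "Fin x"] by simp
  then have "[:-x, 1:] ^ 2 dvd ?q" using order_divides by blast
  moreover have "[:-x, 1:] ^ 0 dvd snd f" "[:-x, 1:] ^ 0 dvd fst f" by simp_all
  ultimately have "[:-x, 1:] ^ 1 dvd wr (fst f) (snd f)"
  proof (cases "mapply f (Fin x)")
    case (Fin c)
    assume "[:-x, 1:] ^ 2 dvd ?q" "[:-x, 1:] ^ 0 dvd snd f"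
    from wr_dvd[OF this] show ?thesis unfolding Fin by (simp add: wr_pencil'')
  next
    case Infty
    assume "[:-x, 1:] ^ 2 dvd ?q" "[:-x, 1:] ^ 0 dvd fst f"
    from wr_dvd[OF this(2,1)] show ?thesis unfolding Infty by simp
  qed
  then show False using w by (simp add: poly_eq_0_iff_dvd)
qed

lemma finite_ramification_imp_wr_nonzero:
  fixes f :: "'a::alg_closed_field ratpair"
  assumes f: "is_morphism f" "0 < mdegree f" and fin: "finite {P. ram_index f P \<noteq> 1}"
  shows "wr (fst f) (snd f) \<noteq> 0"
proof -
  have "finite ({P. ram_index f P \<noteq> 1} \<union> {P. mapply f P = Infty})"
    using fin fiber(1)[OF f] by simp
  then have "finite (Fin -` ({P. ram_index f P \<noteq> 1} \<union> {P. mapply f P = Infty}))"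
    by (rule finite_vimageI) (simp add: inj_on_def)
  from exists_not_root[of 1, OF _ this] obtain x
    where "ram_index f (Fin x) = 1" "mapply f (Fin x) \<noteq> Infty" by auto
  from unramified_imp_wr_nonzero[OF f this] show ?thesis by auto
qed

text \<open>Separability is automatic: a point of ramification index 1 at which $f$ is finite is not a zero of the
  Wronskian.\<close>

lemma is_cover_iff:
  fixes f :: "'a::alg_closed_field ratpair"
  assumes len: "length Qs = length es" and e: "\<And>e. e \<in> set es \<Longrightarrow> 1 < e"
  shows "is_cover d (map (single_cycle d) es) Qs f \<longleftrightarrow>
    is_morphism f \<and> mdegree f = d \<and> 0 < d \<and> (\<forall>P. mapply f P \<notin> set Qs \<longrightarrow> ram_index f P = 1) \<and>
    (\<forall>i<length es. \<exists>P. ramified_at f P (Qs ! i) (es ! i))"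
    (is "?l \<longleftrightarrow> ?r")
proof -
  have fib: "(\<forall>i<length (map (single_cycle d) es).
        image_mset (ram_index f) (mset_set {P. mapply f P = Qs ! i}) = map (single_cycle d) es ! i) \<longleftrightarrow>
      (\<forall>i<length es. \<exists>P. ramified_at f P (Qs ! i) (es ! i))"
    if f: "is_morphism f" "mdegree f = d" "0 < d"
  proof -
    have "image_mset (ram_index f) (mset_set {P. mapply f P = Qs ! i}) = map (single_cycle d) es ! i \<longleftrightarrow>
      (\<exists>P. ramified_at f P (Qs ! i) (es ! i))" if "i < length es" for i
      using fiber_single_cycle[OF f(1), of "es ! i" "Qs ! i"] that e[of "es ! i"] f(2,3)
      by (simp add: ramified_at_def)
    then show ?thesis by simp
  qed
  show ?thesis
  proof
    assume ?l
    then show ?r unfolding is_cover_def using fib by blast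
  next
    assume r: ?r
    have "{P. ram_index f P \<noteq> 1} \<subseteq> (\<Union>Q\<in>set Qs. {P. mapply f P = Q})" using r by auto
    moreover have f: "is_morphism f" "0 < mdegree f" using r by auto
    have "finite (\<Union>Q\<in>set Qs. {P. mapply f P = Q})" using fiber(1)[OF f] by blast
    ultimately have "finite {P. ram_index f P \<noteq> 1}" by (rule finite_subset)
    then have "wr (fst f) (snd f) \<noteq> 0" by (rule finite_ramification_imp_wr_nonzero[OF f])
    then have "separable_morphism f" using separable_morphism_if_wr_nonzero[of "fst f" "snd f"] by simp
    then show ?l unfolding is_cover_def using r fib by blast
  qed
qed

text \<open>Agrees with \<open>pullback_form\<close> up to sign, but depends linearly on the
  coordinates of \<open>Q\<close>, so that Pluecker relations apply without distinguishing
  infinity.\<close>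

definition ell :: "'a::field proj_line \<Rightarrow> 'a ratpair \<Rightarrow> 'a poly" where
  "ell Q f = smult (snd (hcoords Q)) (fst f) - smult (fst (hcoords Q)) (snd f)"

lemma ell_pullback: "\<exists>k. k \<noteq> 0 \<and> ell Q f = smult k (pullback_form f Q)"
proof (cases Q)
  case (Fin c)
  then show ?thesis by (intro exI[of _ 1]) (simp add: ell_def)
next
  case Infty
  then show ?thesis by (intro exI[of _ "-1"]) (simp add: ell_def)
qed

lemma plucker: "smult (br Q R) (ell P f) - smult (br P R) (ell Q f) = smult (- br P Q) (ell R f)"
  by (rule poly_eqI) (simp add: ell_def br_def algebra_simps)

lemma plucker_br: "br P R * br Q S - br P S * br Q R = br P Q * br R S"
  by (simp add: br_def algebra_simps)

lemma wr_linear: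
  "wr (smult a A + smult b B) (smult c A + smult d B) = smult (a * d - b * c) (wr A B)"
  by (simp add: wr_def pderiv_add pderiv_smult algebra_simps smult_diff_left smult_diff_right smult_add_left smult_add_right)

lemma wr_ell: "wr (ell P f) (ell Q f) = smult (br P Q) (wr (fst f) (snd f))"
  using wr_linear[of "snd (hcoords P)" "fst f" "- fst (hcoords P)" "snd f" "snd (hcoords Q)" "- fst (hcoords Q)"]
  by (simp add: ell_def br_def algebra_simps)

lemma ell_recover:
  "smult (fst (hcoords Q)) (ell P f) - smult (fst (hcoords P)) (ell Q f) = smult (- br P Q) (fst f)"
  "smult (snd (hcoords Q)) (ell P f) - smult (snd (hcoords P)) (ell Q f) = smult (- br P Q) (snd f)"
  by (rule poly_eqI; simp add: ell_def br_def algebra_simps)+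

lemma ell_solve:
  fixes L1 L2 :: "'a::field poly"
  assumes "P \<noteq> Q"
  obtains f where "ell P f = L1" "ell Q f = L2"
proof -
  define k where "k = - inverse (br P Q)"
  have k: "k * br P Q = -1" using assms by (simp add: k_def br_eq_0_iff)
  define f where "f = (smult k (smult (fst (hcoords Q)) L1 - smult (fst (hcoords P)) L2),
    smult k (smult (snd (hcoords Q)) L1 - smult (snd (hcoords P)) L2))"
  have "ell P f = smult (- (k * br P Q)) L1" "ell Q f = smult (- (k * br P Q)) L2"
    by (rule poly_eqI; simp add: f_def ell_def br_def algebra_simps)+
  then show ?thesis using that k by simp
qed

section \<open>Normal forms of covers with given branch points\<close>

locale pencil_cover = pencil d e1 e2 e3 n mu
  for d e1 e2 e3 n :: nat and mu :: "'a::alg_closed_field" +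
  fixes Q1 Q2 Q3 Q4 :: "'a proj_line"
  assumes Q: "Q1 \<noteq> Q2" "Q1 \<noteq> Q3" "Q1 \<noteq> Q4" "Q2 \<noteq> Q3" "Q2 \<noteq> Q4" "Q3 \<noteq> Q4"
    and mu_eq: "mu = br Q2 Q3 * br Q1 Q4 / (br Q2 Q4 * br Q1 Q3)"
begin

definition cover :: "'a ratpair \<Rightarrow> bool" where
  "cover = is_cover d (map (single_cycle d) [e1, e2, e3, n]) [Q1, Q2, Q3, Q4]"

lemma br_nz: "br Q1 Q2 \<noteq> 0" "br Q1 Q3 \<noteq> 0" "br Q1 Q4 \<noteq> 0" "br Q2 Q3 \<noteq> 0" "br Q2 Q4 \<noteq> 0"
  using Q by (auto simp: br_eq_0_iff)

lemma cover_iff: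
  "cover f \<longleftrightarrow> is_morphism f \<and> mdegree f = d \<and>
    (\<forall>P. mapply f P \<notin> {Q1, Q2, Q3, Q4} \<longrightarrow> ram_index f P = 1) \<and>
    (\<exists>P. ramified_at f P Q1 e1) \<and> (\<exists>P. ramified_at f P Q2 e2) \<and>
    (\<exists>P. ramified_at f P Q3 e3) \<and> (\<exists>P. ramified_at f P Q4 n)"
proof -
  have "0 < d" using e by auto
  moreover have "(\<forall>i<length [e1, e2, e3, n]. R i) \<longleftrightarrow> R 0 \<and> R 1 \<and> R 2 \<and> R 3" for R
    by (auto simp: less_Suc_eq numeral_eq_Suc)
  ultimately show ?thesis
    unfolding cover_def using e by (subst is_cover_iff) (auto simp: numeral_eq_Suc)
qed

text \<open>An isomorphism over the target only changes the source coordinate. Placing three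
  ramification points at 0, infinity and 1 uses up this freedom, and \<open>l\<close> remains as the
  invariant.\<close>

definition normal :: "'a \<Rightarrow> 'a ratpair \<Rightarrow> bool" where
  "normal l f \<longleftrightarrow> cover f \<and> ramified_at f (Fin 0) Q1 e1 \<and> ramified_at f Infty Q2 e2 \<and>
     ramified_at f (Fin 1) Q3 e3 \<and> ramified_at f (Fin l) Q4 n"

text \<open>By the Pluecker relations, the multiples \<open>fA f\<close> and \<open>fB f\<close> of the linear forms at the first two branch
  points are chosen such that their difference and \<open>fA f - mu fB f\<close> are multiples of the forms at the other two,
  where \<open>mu\<close> is the cross ratio.\<close>

definition fA :: "'a ratpair \<Rightarrow> 'a poly" where "fA f = smult (br Q2 Q3) (ell Q1 f)"
definition fB :: "'a ratpair \<Rightarrow> 'a poly" where "fB f = smult (br Q1 Q3) (ell Q2 f)"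

lemma fA_fB: "fA f - fB f = smult (- br Q1 Q2) (ell Q3 f)"
  unfolding fA_def fB_def by (rule plucker)

lemma fourth_fA_fB: "\<exists>k. k \<noteq> 0 \<and> fourth (fA f) (fB f) = smult k (ell Q4 f)"
proof -
  define k where "k = br Q2 Q3 / br Q2 Q4"
  have k: "k * br Q2 Q4 = br Q2 Q3" "k \<noteq> 0" "mu * br Q1 Q3 = k * br Q1 Q4"
    using br_nz by (simp_all add: k_def mu_eq)
  have "fourth (fA f) (fB f) = smult (k * br Q2 Q4) (ell Q1 f) - smult (mu * br Q1 Q3) (ell Q2 f)"
    by (simp add: fourth_def fA_def fB_def k(1))
  also have "\<dots> = smult k (smult (br Q2 Q4) (ell Q1 f) - smult (br Q1 Q4) (ell Q2 f))"
    by (simp add: k(3) smult_diff_right)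
  also have "\<dots> = smult (k * - br Q1 Q2) (ell Q4 f)" unfolding plucker by simp
  finally show ?thesis using k br_nz by (intro exI[of _ "k * - br Q1 Q2"]) auto
qed

lemma wr_fA_fB: "\<exists>k. k \<noteq> 0 \<and> wr (fA f) (fB f) = smult k (wr (fst f) (snd f))"
proof -
  have "wr (fA f) (fB f) = smult (br Q2 Q3 * br Q1 Q3) (wr (ell Q1 f) (ell Q2 f))"
    using wr_linear[of "br Q2 Q3" "ell Q1 f" 0 "ell Q2 f" 0 "br Q1 Q3"] by (simp add: fA_def fB_def)
  also have "\<dots> = smult (br Q2 Q3 * br Q1 Q3 * br Q1 Q2) (wr (fst f) (snd f))"
    by (simp add: wr_ell)
  finally show ?thesis using br_nz by (intro exI[of _ "br Q2 Q3 * br Q1 Q3 * br Q1 Q2"]) auto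
qed

lemma proportional_forms:
  "\<exists>k. k \<noteq> 0 \<and> fA f = smult k (pullback_form f Q1)"
  "\<exists>k. k \<noteq> 0 \<and> fB f = smult k (pullback_form f Q2)"
  "\<exists>k. k \<noteq> 0 \<and> fA f - fB f = smult k (pullback_form f Q3)"
  "\<exists>k. k \<noteq> 0 \<and> fourth (fA f) (fB f) = smult k (pullback_form f Q4)"
proof -
  have *: "\<exists>k. k \<noteq> 0 \<and> smult c (ell Q f) = smult k (pullback_form f Q)" if "c \<noteq> 0" for c Q
  proof -
    obtain k where "k \<noteq> 0" "ell Q f = smult k (pullback_form f Q)" using ell_pullback by blast
    then show ?thesis using that by (intro exI[of _ "c * k"]) simp
  qed
  show "\<exists>k. k \<noteq> 0 \<and> fA f = smult k (pullback_form f Q1)" "\<exists>k. k \<noteq> 0 \<and> fB f = smult k (pullback_form f Q2)"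
    unfolding fA_def fB_def by (rule *, rule br_nz)+
  show "\<exists>k. k \<noteq> 0 \<and> fA f - fB f = smult k (pullback_form f Q3)"
    unfolding fA_fB by (rule *) (simp add: br_nz)
  show "\<exists>k. k \<noteq> 0 \<and> fourth (fA f) (fB f) = smult k (pullback_form f Q4)"
    using fourth_fA_fB[of f] * by metis
qed

lemma ramified_at_dvd:
  assumes "ramified_at f (Fin x) R k"
  shows "[:-x, 1:] ^ k dvd pullback_form f R"
  using assms order_divides[of x k "pullback_form f R"] by (auto simp: ramified_at_def)

lemma cover_wr_nonzero:
  assumes "cover f"
  shows "wr (fst f) (snd f) \<noteq> 0"
proof (rule finite_ramification_imp_wr_nonzero)
  show f: "is_morphism f" "0 < mdegree f" using assms e unfolding cover_iff by auto
  have "{P. ram_index f P \<noteq> 1} \<subseteq> (\<Union>Q\<in>{Q1, Q2, Q3, Q4}. {P. mapply f P = Q})"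
    using assms unfolding cover_iff by auto
  moreover have "finite (\<Union>Q\<in>{Q1, Q2, Q3, Q4}. {P. mapply f P = Q})" using fiber(1)[OF f] by blast
  ultimately show "finite {P. ram_index f P \<noteq> 1}" by (rule finite_subset)
qed

lemma normal_pencil:
  assumes "normal l f"
  shows "l \<noteq> 0" "l \<noteq> 1" "W (fA f) (fB f)" "wr (fA f) (fB f) \<noteq> 0"
    "[:-l, 1:] ^ n dvd fourth (fA f) (fB f)"
proof -
  have f: "is_morphism f" "mdegree f = d" "cover f" using assms by (auto simp: normal_def cover_iff)
  have r: "ramified_at f (Fin 0) Q1 e1" "ramified_at f Infty Q2 e2" "ramified_at f (Fin 1) Q3 e3"
    "ramified_at f (Fin l) Q4 n" using assms by (auto simp: normal_def)
  show "l \<noteq> 0" "l \<noteq> 1" using r Q unfolding ramified_at_def by metis+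
  obtain k1 k2 k3 k4 where k: "fA f = smult k1 (pullback_form f Q1)" "fB f = smult k2 (pullback_form f Q2)"
    "fA f - fB f = smult k3 (pullback_form f Q3)" "fourth (fA f) (fB f) = smult k4 (pullback_form f Q4)"
    using proportional_forms[of f] by metis
  have "mapply f Infty = Q2" "ram_index f Infty = e2" using r(2) unfolding ramified_at_def by blast+
  then have "ordP d (pullback_form f Q2) Infty = e2"
    using ram_index_ordP[of f Infty] f(2) by (simp only:)
  then have "d - degree (pullback_form f Q2) = e2" by simp
  then have "degree (pullback_form f Q2) \<le> d - e2" using e degree_pullback_le[of f Q2] f(2) by linarith
  then show "W (fA f) (fB f)"
    unfolding W_def using ramified_at_dvd[OF r(1)] ramified_at_dvd[OF r(3)] degree_pullback_le[of f Q1] f(2)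
    unfolding k(3) unfolding k(1,2) by (auto intro: dvd_smult order.trans[OF degree_smult_le])
  show "wr (fA f) (fB f) \<noteq> 0" using wr_fA_fB[of f] cover_wr_nonzero[OF f(3)] by auto
  show "[:-l, 1:] ^ n dvd fourth (fA f) (fB f)"
    unfolding k(4) by (rule dvd_smult[OF ramified_at_dvd[OF r(4)]])
qed

lemma smult_left_cancel:
  fixes p q :: "'a poly"
  assumes "k \<noteq> 0" "smult k p = smult k q"
  shows "p = q"
  using arg_cong[OF assms(2), of "smult (inverse k)"] assms(1) by simp

text \<open>Rigidity makes the pairs of two covers with the same \<open>l\<close> proportional; the
  linear forms at \<open>Q1\<close> and \<open>Q2\<close>, and with them the morphisms, are then
  proportional too.\<close>

lemma normal_unique:
  assumes "normal l f" "normal l g"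
  shows "mapply f = mapply g"
proof -
  note f = normal_pencil[OF assms(1)] and g = normal_pencil[OF assms(2)]
  have "[:-l, 1:] ^ (n - 1) dvd fourth (fA g) (fB g)"
    using g(5) by (meson diff_le_self dvd_trans le_imp_power_dvd)
  then obtain c where c: "fA g = smult c (fA f)" "fB g = smult c (fB f)"
    using pencil_unique[OF f(3,4,1,2,5) g(3)] by blast
  have "smult (br Q2 Q3) (ell Q1 g) = smult (br Q2 Q3) (smult c (ell Q1 f))"
    "smult (br Q1 Q3) (ell Q2 g) = smult (br Q1 Q3) (smult c (ell Q2 f))"
    using c by (simp_all add: fA_def fB_def mult.commute)
  then have l: "ell Q1 g = smult c (ell Q1 f)" "ell Q2 g = smult c (ell Q2 f)"
    using br_nz by (blast intro: smult_left_cancel)+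
  have "smult (- br Q1 Q2) (fst g) = smult (- br Q1 Q2) (smult c (fst f))"
    "smult (- br Q1 Q2) (snd g) = smult (- br Q1 Q2) (smult c (snd f))"
    using ell_recover[of Q2 Q1 f] unfolding ell_recover(1,2)[of Q2 Q1 g, symmetric] l
    by (simp_all add: smult_diff_right mult.commute) (simp_all add: mult.commute flip: smult_smult smult_diff_right ell_recover)
  then have fg: "fst g = smult c (fst f)" "snd g = smult c (snd f)"
    using br_nz by (metis smult_left_cancel neg_equal_0_iff_equal)+
  have "c \<noteq> 0" using c g(4) by (auto simp: wr_def)
  have m: "mdegree g = mdegree f" using \<open>c \<noteq> 0\<close> by (simp add: mdegree_def fg)
  have "mapply g P = mapply f P" for P
    using \<open>c \<noteq> 0\<close> m by (cases P) (simp_all add: fg proj_pt_scale)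
  then show ?thesis by auto
qed

text \<open>The orders in \<open>W\<close> are only lower bounds. They are exact, and there is no
  further ramification, because \<open>nondegenerate\<close> leaves no room in the
  Wronskian.\<close>

lemma good_normal:
  assumes "l \<in> good"
  obtains f where "normal l f"
proof -
  obtain A B where l: "l \<noteq> 0" "l \<noteq> 1" and AB: "W A B" "wr A B \<noteq> 0" "[:-l, 1:] ^ n dvd fourth A B"
    using assms by (auto simp: good_def)
  note nd = nondegenerate[OF AB(1,2) l AB(3)]
  obtain f where f: "ell Q1 f = smult (inverse (br Q2 Q3)) A" "ell Q2 f = smult (inverse (br Q1 Q3)) B"
    using ell_solve[OF Q(1)] by blast
  have fAB: "fA f = A" "fB f = B" using f br_nz by (simp_all add: fA_def fB_def)
  have eA: "A = smult (br Q2 Q3) (ell Q1 f)" and eB: "B = smult (br Q1 Q3) (ell Q2 f)"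
    using fAB by (simp_all add: fA_def fB_def)
  have wr: "wr (fst f) (snd f) \<noteq> 0" "\<And>x. poly (wr A B) x \<noteq> 0 \<Longrightarrow> poly (wr (fst f) (snd f)) x \<noteq> 0"
    using wr_fA_fB[of f] AB(2) unfolding fAB by auto
  have mor: "is_morphism f"
    unfolding is_morphism_def
  proof (rule coprime_polyI_root)
    show "fst f \<noteq> 0 \<or> snd f \<noteq> 0" using wr(1) by (auto simp: wr_def)
    fix x assume "poly (fst f) x = 0" "poly (snd f) x = 0"
    then have "poly A x = 0" "poly B x = 0" unfolding eA eB by (simp_all add: ell_def)
    then show False using coprime_poly_no_common_root[OF nd(1)] by blast
  qed
  have rec: "smult (- br Q1 Q2) (fst f) = smult (fst (hcoords Q2)) (ell Q1 f) - smult (fst (hcoords Q1)) (ell Q2 f)"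
    "smult (- br Q1 Q2) (snd f) = smult (snd (hcoords Q2)) (ell Q1 f) - smult (snd (hcoords Q1)) (ell Q2 f)"
    by (simp_all only: ell_recover)
  have dle: "degree (ell Q1 f) \<le> d" "degree (ell Q2 f) \<le> d"
    unfolding f using nd(2,3) by (auto intro: order.trans[OF degree_smult_le])
  have "degree (smult (- br Q1 Q2) (fst f)) \<le> d" "degree (smult (- br Q1 Q2) (snd f)) \<le> d"
    unfolding rec using dle by (auto intro!: degree_diff_le order.trans[OF degree_smult_le])
  then have d1: "degree (fst f) \<le> d" "degree (snd f) \<le> d" using br_nz by simp_all
  have "degree A \<le> mdegree f"
    unfolding eA ell_def using degree_le_mdegree[of f]
    by (intro order.trans[OF degree_smult_le] degree_diff_le) auto
  then have deg: "mdegree f = d" using nd(2) d1 by (simp add: mdegree_def)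
  have pos: "0 < mdegree f" using deg e by simp
  obtain k1 k2 k3 k4 where k: "k1 \<noteq> 0" "A = smult k1 (pullback_form f Q1)" "k2 \<noteq> 0" "B = smult k2 (pullback_form f Q2)"
    "k3 \<noteq> 0" "A - B = smult k3 (pullback_form f Q3)" "k4 \<noteq> 0" "fourth A B = smult k4 (pullback_form f Q4)"
    using proportional_forms[of f] unfolding fAB by metis
  \<comment> \<open>One argument for 0, 1 and \<open>l\<close>: \<open>G\<close> is the member of
    the pencil with the prescribed zero at \<open>x\<close>, and a zero of order
    \<open>m + 1\<close> would make the Wronskian vanish to order \<open>m\<close>.\<close>
  have pt: "mapply f (Fin x) = R \<and> ram_index f (Fin x) = m"
    if G: "G = smult k (pullback_form f R)" "k \<noteq> 0" "[:-x, 1:] ^ m dvd G" "wr G B = wr A B"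
      and nd: "\<not> [:-x, 1:] ^ m dvd wr A B" and m: "0 < m" for x R m G k
  proof -
    have nz: "pullback_form f R \<noteq> 0" by (rule pullback_nonzero[OF mor pos])
    have "\<not> [:-x, 1:] ^ Suc m dvd pullback_form f R"
    proof
      assume "[:-x, 1:] ^ Suc m dvd pullback_form f R"
      then have "[:-x, 1:] ^ Suc m dvd G" unfolding G(1) by (rule dvd_smult)
      from wr_dvd[OF this, of 0 B] nd show False by (simp add: G(4))
    qed
    moreover have "[:-x, 1:] ^ m dvd pullback_form f R" using G(3,2) unfolding G(1) by (simp add: dvd_smult_iff)
    ultimately have o: "order x (pullback_form f R) = m" by (metis order_unique_lemma)
    then have "poly (pullback_form f R) x = 0" using nz m by (metis order_root less_irrefl)
    then have "mapply f (Fin x) = R" using mapply_eq_iff[OF mor, of "Fin x" R] by simp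
    then show ?thesis using o by simp
  qed
  have p0: "mapply f (Fin 0) = Q1" "ram_index f (Fin 0) = e1"
    using pt[OF k(2,1), of 0 e1] AB(1) nd(4) e by (auto simp: W_def)
  have p1: "mapply f (Fin 1) = Q3" "ram_index f (Fin 1) = e3"
    using pt[OF k(6,5), of 1 e3] AB(1) nd(5) e by (auto simp: W_def wr_minus_left)
  have pl: "mapply f (Fin l) = Q4" "ram_index f (Fin l) = n"
    using pt[OF k(8,7) AB(3) _ nd(6)] e by (auto simp: fourth_def wr_pencil'')
  have pi: "mapply f Infty = Q2" "ram_index f Infty = e2"
  proof -
    have dp: "degree (pullback_form f Q2) = d - e2" using nd(3) k(3) unfolding k(4) by simp
    then have "coeff (pullback_form f Q2) d = 0" using e by (intro coeff_eq_0) auto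
    then show "mapply f Infty = Q2" using mapply_eq_iff[OF mor, of Infty Q2] deg by simp
    then show "ram_index f Infty = e2"
      unfolding ram_index_ordP using dp e by (simp add: deg)
  qed
  have rest: "ram_index f P = 1" if "P \<notin> {Fin 0, Infty, Fin 1, Fin l}" for P
  proof -
    show ?thesis
    proof (cases P)
      case (Fin x)
      then have "x \<notin> {0, 1, l}" using that by auto
      then show ?thesis unfolding Fin by (intro wr_nonzero_imp_unramified[OF mor pos wr(2)] nd(7))
    qed (use that in simp)
  qed
  have other: "ram_index f P' = 1" if "mapply f P' = mapply f P" "P' \<noteq> P" "P \<in> {Fin 0, Infty, Fin 1, Fin l}" for P P'
  proof (rule rest)
    show "P' \<notin> {Fin 0, Infty, Fin 1, Fin l}" using that p0 p1 pl pi Q by auto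
  qed
  have ram: "ramified_at f (Fin 0) Q1 e1" "ramified_at f Infty Q2 e2" "ramified_at f (Fin 1) Q3 e3"
    "ramified_at f (Fin l) Q4 n"
    unfolding ramified_at_def using p0 p1 pl pi other[of _ "Fin 0"] other[of _ "Infty"]
      other[of _ "Fin 1"] other[of _ "Fin l"] by auto
  have "ram_index f P = 1" if "mapply f P \<notin> {Q1, Q2, Q3, Q4}" for P
    using that p0 p1 pl pi by (intro rest) auto
  then have "cover f" unfolding cover_iff using mor deg ram by blast
  then show ?thesis using that ram by (auto simp: normal_def)
qed

lemma normal_good: "normal l f \<Longrightarrow> l \<in> good"
  using normal_pencil[of l f] by (auto simp: good_def)

lemma ramified_at_mcomp:
  fixes f s :: "'a ratpair"
  assumes f: "is_morphism f" "0 < mdegree f" and s: "is_morphism s" "mdegree s = 1"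
    and inj: "inj (mapply s)"
  shows "ramified_at f (mapply s P) R k \<Longrightarrow> ramified_at (mcomp f s) P R k"
  using mcomp_morphism(3)[OF f(1) s(1)] ram_index_mcomp[OF f s] injD[OF inj]
  by (auto simp: ramified_at_def)

lemma cover_normalise:
  assumes "cover f"
  obtains l g where "normal l g" "(g, f) \<in> cover_iso"
proof -
  have f: "is_morphism f" "mdegree f = d" "0 < mdegree f" using assms e by (auto simp: cover_iff)
  obtain P1 P2 P3 P4 where P: "ramified_at f P1 Q1 e1" "ramified_at f P2 Q2 e2" "ramified_at f P3 Q3 e3"
    "ramified_at f P4 Q4 n" using assms by (auto simp: cover_iff)
  have "P1 \<noteq> P2" "P1 \<noteq> P3" "P2 \<noteq> P3" "P2 \<noteq> P4" using P Q unfolding ramified_at_def by metis+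
  then obtain s t where st: "is_morphism s" "is_morphism t" "mdegree s = 1"
    "mapply s \<circ> mapply t = id" "mapply t \<circ> mapply s = id"
    "mapply s (Fin 0) = P1" "mapply s Infty = P2" "mapply s (Fin 1) = P3"
    using exists_mobius by metis
  have inj: "inj (mapply s)" using st(5) by (metis inj_on_id inj_on_imageI2)
  have sP4: "mapply s (mapply t P4) = P4" using fun_cong[OF st(4), of P4] by simp
  obtain l where l: "mapply t P4 = Fin l"
    using sP4 st(7) \<open>P2 \<noteq> P4\<close> by (cases "mapply t P4") auto
  define g where "g = mcomp f s"
  have mg: "mapply g = mapply f \<circ> mapply s" "is_morphism g" "mdegree g = d"
    using mcomp_morphism[OF f(1) st(1)] f st(3) by (auto simp: g_def)
  have rg: "ram_index g P = ram_index f (mapply s P)" for P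
    using ram_index_mcomp[OF f(1,3) st(1,3)] by (simp add: g_def)
  have ram: "ramified_at g (Fin 0) Q1 e1" "ramified_at g Infty Q2 e2" "ramified_at g (Fin 1) Q3 e3"
    "ramified_at g (Fin l) Q4 n"
    unfolding g_def using P st sP4 l
    by (auto intro!: ramified_at_mcomp[OF f(1,3) st(1,3) inj])
  have "ram_index g P = 1" if "mapply g P \<notin> {Q1, Q2, Q3, Q4}" for P
    using assms that unfolding cover_iff rg mg by auto
  then have "cover g" unfolding cover_iff using ram mg by blast
  then have "normal l g" using ram by (simp add: normal_def)
  moreover have "(g, f) \<in> cover_iso" unfolding cover_iso_def using mg f st by blast
  ultimately show ?thesis by (rule that)
qed

text \<open>Over each branch point there is just one point of index greater than 1, and an
  isomorphism preserves indices. So it fixes 0, infinity and 1, hence is the identity, and it takes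
  \<open>l\<close> to \<open>l'\<close>.\<close>

lemma normal_iso_eq:
  assumes "normal l f" "normal l' g" "(f, g) \<in> cover_iso"
  shows "l = l'"
proof -
  obtain s t where st: "is_morphism f" "is_morphism g" "is_morphism s" "is_morphism t"
    "mapply s \<circ> mapply t = id" "mapply t \<circ> mapply s = id" "mapply f = mapply g \<circ> mapply s"
    using assms(3) by (auto simp: cover_iso_def)
  have s1: "mdegree s = 1" using inverse_degree_1[OF st(3,4,5)] .
  have g: "0 < mdegree g" using assms(2) e by (auto simp: normal_def cover_iff)
  have "ram_index f = ram_index (mcomp g s)"
    using ram_index_same_map(1)[OF st(1) mcomp_morphism(1)[OF st(2,3)]] mcomp_morphism(3)[OF st(2,3)] st(7) by simp
  then have rf: "ram_index f P = ram_index g (mapply s P)" for P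
    using ram_index_mcomp[OF st(2) g st(3) s1] by simp
  have fx: "mapply s P = P'" if "ramified_at f P R k" "ramified_at g P' R k" "1 < k" for P P' R k
    using that rf[of P] fun_cong[OF st(7), of P] unfolding ramified_at_def by (metis comp_apply less_irrefl)
  have s: "mapply s (Fin 0) = Fin 0" "mapply s Infty = Infty" "mapply s (Fin 1) = Fin 1" "mapply s (Fin l) = Fin l'"
    using assms(1,2) e unfolding normal_def by (blast intro: fx)+
  have c2: "coeff (snd s) 1 = 0" using s(2) s1 by (simp add: proj_pt_def split: if_splits)
  have ds: "degree (fst s) \<le> 1" "degree (snd s) \<le> 1" using degree_le_mdegree[of s] s1 by auto
  have "poly (snd s) x = coeff (snd s) 0" for x
    using c2 ds(2) by (subst poly_altdef) (cases "degree (snd s) = 0"; auto simp: le_Suc_eq)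
  moreover have "poly (fst s) x = coeff (fst s) 0 + coeff (fst s) 1 * x" for x
    using ds(1) by (subst poly_altdef) (cases "degree (fst s) = 0"; auto simp: le_Suc_eq coeff_eq_0)
  ultimately show ?thesis
    using s(1,3,4) by (auto simp: proj_pt_def split: if_splits)
qed

text \<open>Existence of a normal form, its uniqueness for given \<open>l\<close>, and invariance of
  \<open>l\<close> under isomorphism make \<open>l\<close> a complete invariant.\<close>

lemma iso_classes_good:
  defines "Cs \<equiv> map (single_cycle d) [e1, e2, e3, n]"
  shows "finite good \<Longrightarrow> num_covers d Cs [Q1, Q2, Q3, Q4] (card good)"
proof -
  assume fin: "finite good"
  define nf where "nf = (\<lambda>l. SOME f. normal l f)"
  have nf: "normal l (nf l)" if "l \<in> good" for l
    unfolding nf_def using good_normal[OF that] by (metis someI)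
  have mor: "is_morphism f" if "normal l f" for l :: 'a and f using that by (auto simp: normal_def cover_iff)
  let ?c = "\<lambda>l. cover_iso `` {nf l}"
  have eq: "iso_classes d Cs [Q1, Q2, Q3, Q4] = ?c ` good"
  proof (intro equalityI subsetI)
    fix X assume "X \<in> iso_classes d Cs [Q1, Q2, Q3, Q4]"
    then obtain f where f: "cover f" "X = cover_iso `` {f}"
      unfolding iso_classes_def Cs_def quotient_def cover_def[symmetric] by auto
    obtain l g where g: "normal l g" "(g, f) \<in> cover_iso" using cover_normalise[OF f(1)] .
    have l: "l \<in> good" using normal_good[OF g(1)] .
    have "(nf l, g) \<in> cover_iso"
      using mor[OF nf[OF l]] mor[OF g(1)] normal_unique[OF nf[OF l] g(1)] by (rule cover_iso_same_map)
    from cover_iso_class_eq[OF this] cover_iso_class_eq[OF g(2)] have "X = ?c l" using f(2) by simp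
    then show "X \<in> ?c ` good" using l by blast
  next
    fix X assume "X \<in> ?c ` good"
    then obtain l where l: "l \<in> good" "X = ?c l" by blast
    have "cover (nf l)" using nf[OF l(1)] by (simp add: normal_def)
    then show "X \<in> iso_classes d Cs [Q1, Q2, Q3, Q4]"
      unfolding iso_classes_def Cs_def quotient_def cover_def[symmetric] l(2) by blast
  qed
  have "inj_on ?c good"
  proof (rule inj_onI)
    fix l l' assume l: "l \<in> good" "l' \<in> good" "?c l = ?c l'"
    have "nf l' \<in> ?c l" using cover_iso_refl[OF mor[OF nf[OF l(2)]]] l(3) by auto
    then have "(nf l, nf l') \<in> cover_iso" by simp
    then show "l = l'" using normal_iso_eq[OF nf[OF l(1)] nf[OF l(2)]] by blast
  qed
  then show "num_covers d Cs [Q1, Q2, Q3, Q4] (card good)"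
    unfolding num_covers_def eq using fin by (simp add: card_image)
qed

end

section \<open>Multihomogeneous forms\<close>

text \<open>Unlike \<open>multiform\<close>, it is evaluated at arbitrary vectors, as required for
  rescaling coordinates and for moving along a line.\<close>

definition mf :: "nat \<Rightarrow> (nat \<Rightarrow> nat) \<Rightarrow> ((nat \<Rightarrow> nat) \<Rightarrow> 'a::field) \<Rightarrow> (nat \<Rightarrow> 'a \<times> 'a) \<Rightarrow> 'a" where
  "mf r \<delta> c u = (\<Sum>m \<in> (\<Pi>\<^sub>E i\<in>{..<r}. {..\<delta> i}).
     c m * (\<Prod>i<r. fst (u i) ^ m i * snd (u i) ^ (\<delta> i - m i)))"

lemma multiform_mf: "multiform r \<delta> c Qs = mf r \<delta> c (\<lambda>i. hcoords (Qs ! i))"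
  by (simp add: multiform_def mf_def)

definition is_form :: "nat \<Rightarrow> (nat \<Rightarrow> nat) \<Rightarrow> ((nat \<Rightarrow> 'a::field \<times> 'a) \<Rightarrow> 'a) \<Rightarrow> bool" where
  "is_form r \<delta> \<phi> \<longleftrightarrow> (\<exists>c. \<forall>u. \<phi> u = mf r \<delta> c u)"

lemma is_form_product_coefficients:
  assumes "\<And>u. \<phi> u = (\<Prod>i<r. \<Sum>t\<le>\<delta> i. \<gamma> i t * (fst (u i) ^ t * snd (u i) ^ (\<delta> i - t)))"
  shows "is_form r \<delta> \<phi>"
  unfolding is_form_def
proof (intro exI allI)
  fix u
  have "\<phi> u = (\<Sum>m\<in>(\<Pi>\<^sub>E i\<in>{..<r}. {..\<delta> i}). \<Prod>i<r. \<gamma> i (m i) * (fst (u i) ^ m i * snd (u i) ^ (\<delta> i - m i)))"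
    unfolding assms by (subst prod_sum_PiE) auto
  then show "\<phi> u = mf r \<delta> (\<lambda>m. \<Prod>i<r. \<gamma> i (m i)) u"
    by (simp add: mf_def prod.distrib)
qed

abbreviation unit_degree :: "nat \<Rightarrow> nat \<Rightarrow> nat" where
  "unit_degree i \<equiv> (\<lambda>k. if k = i then 1 else 0)"

lemma is_form_coordinates:
  assumes "i < r"
  shows "is_form r (unit_degree i) (\<lambda>u. fst (u i) :: 'a::field)"
    "is_form r (unit_degree i) (\<lambda>u. snd (u i) :: 'a::field)"
proof -
  have *: "(\<Prod>k<r. \<Sum>t\<le>unit_degree i k. (if k = i then g t else 1) * (fst (u k) ^ t * snd (u k) ^ (unit_degree i k - t))) =
      g 0 * snd (u i) + g 1 * fst (u i)" for g :: "nat \<Rightarrow> 'a" and u :: "nat \<Rightarrow> 'a \<times> 'a"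
  proof -
    have "(\<Prod>k<r. \<Sum>t\<le>unit_degree i k. (if k = i then g t else 1) * (fst (u k) ^ t * snd (u k) ^ (unit_degree i k - t))) =
      (\<Prod>k<r. if k = i then g 0 * snd (u i) + g 1 * fst (u i) else 1)"
      by (intro prod.cong) auto
    then show ?thesis using assms by simp
  qed
  show "is_form r (unit_degree i) (\<lambda>u. fst (u i) :: 'a)"
    by (rule is_form_product_coefficients[where \<gamma> = "\<lambda>k t. if k = i then (if t = 1 then 1 else 0) else 1"])
      (subst *, simp)
  show "is_form r (unit_degree i) (\<lambda>u. snd (u i) :: 'a)"
    by (rule is_form_product_coefficients[where \<gamma> = "\<lambda>k t. if k = i then (if t = 0 then 1 else 0) else 1"])
      (subst *, simp)
qed

lemma is_form_one: "is_form r (\<lambda>_. 0) (\<lambda>u. 1)"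
  by (rule is_form_product_coefficients[where \<gamma> = "\<lambda>_ _. 1"]) simp

lemma is_form_linear:
  assumes "is_form r \<delta> \<phi>" "is_form r \<delta> \<psi>"
  shows "is_form r \<delta> (\<lambda>u. \<phi> u - a * \<psi> u)"
proof -
  obtain c c' where "\<And>u. \<phi> u = mf r \<delta> c u" "\<And>u. \<psi> u = mf r \<delta> c' u"
    using assms unfolding is_form_def by metis
  then have "\<phi> u - a * \<psi> u = mf r \<delta> (\<lambda>m. c m - a * c' m) u" for u
    by (simp add: mf_def sum_subtractf sum_distrib_left algebra_simps)
  then show ?thesis unfolding is_form_def by blast
qed

lemma is_form_mult:
  fixes \<phi> \<psi> :: "(nat \<Rightarrow> 'a::field \<times> 'a) \<Rightarrow> 'a"
  assumes "is_form r \<delta> \<phi>" "is_form r \<delta>' \<psi>"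
  shows "is_form r (\<lambda>i. \<delta> i + \<delta>' i) (\<lambda>u. \<phi> u * \<psi> u)"
proof -
  obtain c c' where c: "\<And>u. \<phi> u = mf r \<delta> c u" "\<And>u. \<psi> u = mf r \<delta>' c' u"
    using assms unfolding is_form_def by metis
  define S T where "S = (\<Pi>\<^sub>E i\<in>{..<r}. {..\<delta> i})" and "T = (\<Pi>\<^sub>E i\<in>{..<r}. {..\<delta>' i})"
  define V where "V = (\<Pi>\<^sub>E i\<in>{..<r}. {..\<delta> i + \<delta>' i})"
  define add where "add = (\<lambda>(m, m'). restrict (\<lambda>i. m i + m' i :: nat) {..<r})"
  have fin: "finite S" "finite T" "finite V" unfolding S_def T_def V_def by (intro finite_PiE; simp)+
  have add: "add ` (S \<times> T) \<subseteq> V"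
  proof
    fix x assume "x \<in> add ` (S \<times> T)"
    then obtain m m' where m: "m \<in> S" "m' \<in> T" "x = restrict (\<lambda>i. m i + m' i) {..<r}" by (auto simp: add_def)
    have "m i + m' i \<le> \<delta> i + \<delta>' i" if "i < r" for i
      using PiE_mem[OF m(1)[unfolded S_def], of i] PiE_mem[OF m(2)[unfolded T_def], of i] that
      by (simp add: add_mono)
    then show "x \<in> V" unfolding m(3) V_def restrict_PiE_iff by simp
  qed
  \<comment> \<open>Coefficients are convolved: pairs of exponent tuples are grouped by their
    sum.\<close>
  define c'' where "c'' = (\<lambda>m. \<Sum>q\<in>{q \<in> S \<times> T. add q = m}. c (fst q) * c' (snd q))"
  have "\<phi> u * \<psi> u = mf r (\<lambda>i. \<delta> i + \<delta>' i) c'' u" for u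
  proof -
    define X where "X = (\<lambda>\<delta> m. \<Prod>i<r. fst (u i) ^ m i * snd (u i) ^ (\<delta> i - m i))"
    have XX: "X \<delta> m * X \<delta>' m' = X (\<lambda>i. \<delta> i + \<delta>' i) (add (m, m'))" if "m \<in> S" "m' \<in> T" for m m'
      unfolding X_def prod.distrib[symmetric]
    proof (rule prod.cong)
      fix i assume i: "i \<in> {..<r}"
      then have "m i \<le> \<delta> i" "m' i \<le> \<delta>' i"
        using PiE_mem[OF that(1)[unfolded S_def], of i] PiE_mem[OF that(2)[unfolded T_def], of i] by simp_all
      then have "\<delta> i + \<delta>' i - (m i + m' i) = (\<delta> i - m i) + (\<delta>' i - m' i)" by simp
      then show "fst (u i) ^ m i * snd (u i) ^ (\<delta> i - m i) * (fst (u i) ^ m' i * snd (u i) ^ (\<delta>' i - m' i)) =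
        fst (u i) ^ add (m, m') i * snd (u i) ^ (\<delta> i + \<delta>' i - add (m, m') i)"
        using i by (simp add: add_def power_add mult_ac)
    qed simp
    have "\<phi> u * \<psi> u = (\<Sum>m\<in>S. \<Sum>m'\<in>T. c m * X \<delta> m * (c' m' * X \<delta>' m'))"
      by (simp add: c mf_def X_def S_def T_def sum_product)
    also have "\<dots> = (\<Sum>q\<in>S \<times> T. c (fst q) * c' (snd q) * X (\<lambda>i. \<delta> i + \<delta>' i) (add q))"
      unfolding sum.cartesian_product
      by (intro sum.cong) (auto simp: XX[symmetric] mult_ac)
    also have "\<dots> = (\<Sum>m\<in>V. \<Sum>q\<in>{q \<in> S \<times> T. add q = m}. c (fst q) * c' (snd q) * X (\<lambda>i. \<delta> i + \<delta>' i) (add q))"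
      using fin add by (intro sum.group[symmetric]) auto
    also have "\<dots> = (\<Sum>m\<in>V. c'' m * X (\<lambda>i. \<delta> i + \<delta>' i) m)"
      unfolding c''_def sum_distrib_right by (intro sum.cong) auto
    finally show ?thesis by (simp add: mf_def V_def X_def)
  qed
  then show ?thesis unfolding is_form_def by blast
qed

lemma is_form_prod:
  assumes "finite I" "\<And>x. x \<in> I \<Longrightarrow> \<exists>\<delta>. is_form r \<delta> (\<phi> x)"
  shows "\<exists>\<delta>. is_form r \<delta> (\<lambda>u. \<Prod>x\<in>I. \<phi> x u)"
  using assms
proof (induction I)
  case empty
  then show ?case using is_form_one by auto
next
  case (insert x I)
  then obtain \<delta> \<delta>' where "is_form r \<delta> (\<phi> x)" "is_form r \<delta>' (\<lambda>u. \<Prod>x\<in>I. \<phi> x u)" by blast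
  from is_form_mult[OF this] insert.hyps show ?case by auto
qed

definition bracket :: "nat \<Rightarrow> nat \<Rightarrow> (nat \<Rightarrow> 'a::field \<times> 'a) \<Rightarrow> 'a" where
  "bracket i j u = fst (u i) * snd (u j) - fst (u j) * snd (u i)"

lemma is_form_bracket:
  assumes "i < r" "j < r"
  shows "is_form r (\<lambda>k. unit_degree i k + unit_degree j k) (bracket i j)"
proof -
  have 1: "is_form r (\<lambda>k. unit_degree i k + unit_degree j k) (\<lambda>u. fst (u i) * snd (u j))"
    using assms by (intro is_form_mult is_form_coordinates)
  have "is_form r (\<lambda>k. unit_degree j k + unit_degree i k) (\<lambda>u. fst (u j) * snd (u i))"
    using assms by (intro is_form_mult is_form_coordinates)
  then have 2: "is_form r (\<lambda>k. unit_degree i k + unit_degree j k) (\<lambda>u. fst (u j) * snd (u i))"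
    by (simp add: add.commute)
  from is_form_linear[OF 1 2, of 1] show ?thesis by (simp add: bracket_def[abs_def])
qed

lemma mf_scale: "mf r \<delta> c (\<lambda>i. (k i * fst (u i), k i * snd (u i))) = (\<Prod>i<r. k i ^ \<delta> i) * mf r \<delta> c u"
  unfolding mf_def sum_distrib_left
proof (rule sum.cong)
  fix m assume m: "m \<in> (\<Pi>\<^sub>E i\<in>{..<r}. {..\<delta> i})"
  have "(k i * fst (u i)) ^ m i * (k i * snd (u i)) ^ (\<delta> i - m i) =
      k i ^ \<delta> i * (fst (u i) ^ m i * snd (u i) ^ (\<delta> i - m i))" if "i < r" for i
  proof -
    have "m i \<le> \<delta> i" using PiE_mem[OF m, of i] that by simp
    then have "k i ^ \<delta> i = k i ^ m i * k i ^ (\<delta> i - m i)" by (simp flip: power_add)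
    then show ?thesis by (simp add: power_mult_distrib)
  qed
  then show "c m * (\<Prod>i<r. fst (k i * fst (u i), k i * snd (u i)) ^ m i * snd (k i * fst (u i), k i * snd (u i)) ^ (\<delta> i - m i)) =
      (\<Prod>i<r. k i ^ \<delta> i) * (c m * (\<Prod>i<r. fst (u i) ^ m i * snd (u i) ^ (\<delta> i - m i)))"
    by (simp add: prod.distrib mult_ac)
qed simp

text \<open>Restrict both forms to the line joining the two points.\<close>

lemma forms_common_nonzero:
  fixes u w :: "nat \<Rightarrow> 'a::alg_closed_field \<times> 'a"
  assumes u: "mf r \<delta> c u \<noteq> 0" and w: "mf r \<delta>' c' w \<noteq> 0" and nz: "\<And>i. u i \<noteq> (0, 0)"
  obtains Qs where "length Qs = r" "multiform r \<delta> c Qs \<noteq> 0" "multiform r \<delta>' c' Qs \<noteq> 0"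
proof -
  define U V where "U = (\<lambda>i. [:fst (u i), fst (w i) - fst (u i):])" and "V = (\<lambda>i. [:snd (u i), snd (w i) - snd (u i):])"
  define \<Phi> where "\<Phi> = (\<lambda>\<delta> c. \<Sum>m \<in> (\<Pi>\<^sub>E i\<in>{..<r}. {..\<delta> i}). smult (c m) (\<Prod>i<r. U i ^ m i * V i ^ (\<delta> i - m i)))"
  define v where "v = (\<lambda>t i. (poly (U i) t, poly (V i) t))"
  have P: "poly (\<Phi> \<delta> c) t = mf r \<delta> c (v t)" for \<delta> c t
    by (simp add: \<Phi>_def mf_def v_def poly_sum poly_prod)
  have "v 0 = u" "v 1 = w" by (auto simp: v_def U_def V_def)
  then have "poly (\<Phi> \<delta> c) 0 \<noteq> 0" "poly (\<Phi> \<delta>' c') 1 \<noteq> 0" using u w P by simp_all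
  then have "\<Phi> \<delta> c \<noteq> 0" "\<Phi> \<delta>' c' \<noteq> 0" by auto
  \<comment> \<open>A nonzero coordinate polynomial of the \<open>i\<close>-th point on the line.
    Where it does not vanish, the two coordinates define a point of the projective line.\<close>
  define G where "G = (\<lambda>i. if U i = 0 then V i else U i)"
  have "G i \<noteq> 0" for i
    using nz[of i] by (cases "u i") (auto simp: G_def U_def V_def)
  then have "\<Phi> \<delta> c * \<Phi> \<delta>' c' * (\<Prod>i<r. G i) \<noteq> 0"
    using \<open>\<Phi> \<delta> c \<noteq> 0\<close> \<open>\<Phi> \<delta>' c' \<noteq> 0\<close> by simp
  from exists_not_root[OF this, of "{}"]
  obtain t where t0: "poly (\<Phi> \<delta> c * \<Phi> \<delta>' c' * (\<Prod>i<r. G i)) t \<noteq> 0" by auto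
  then have t: "poly (\<Phi> \<delta> c) t \<noteq> 0" "poly (\<Phi> \<delta>' c') t \<noteq> 0" by auto
  have tG: "poly (G i) t \<noteq> 0" if "i < r" for i
    using t0 that by (auto simp: poly_prod)
  have vnz: "fst (v t i) \<noteq> 0 \<or> snd (v t i) \<noteq> 0" if "i < r" for i
    using tG[OF that] by (auto simp: v_def G_def split: if_splits)
  define Qs where "Qs = map (\<lambda>i. proj_pt (fst (v t i)) (snd (v t i))) [0..<r]"
  have "\<exists>k. v t i = (k * fst (hcoords (Qs ! i)), k * snd (hcoords (Qs ! i)))" if i: "i < r" for i
  proof -
    have Qi: "Qs ! i = proj_pt (fst (v t i)) (snd (v t i))" using i by (simp add: Qs_def)
    obtain k where "fst (v t i) = k * fst (hcoords (Qs ! i))" "snd (v t i) = k * snd (hcoords (Qs ! i))"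
      unfolding Qi using hcoords_proj_pt[OF vnz[OF i]] by blast
    then show ?thesis by (intro exI[of _ k]) (simp add: prod_eq_iff)
  qed
  then obtain k where k: "\<And>i. i < r \<Longrightarrow> v t i = (k i * fst (hcoords (Qs ! i)), k i * snd (hcoords (Qs ! i)))"
    by metis
  have "mf r \<delta> c (v t) = (\<Prod>i<r. k i ^ \<delta> i) * multiform r \<delta> c Qs" for \<delta> c
    unfolding multiform_mf mf_scale[symmetric]
    unfolding mf_def by (intro sum.cong prod.cong refl arg_cong2[where f = "(*)"]) (simp_all add: k)
  then have "multiform r \<delta> c Qs \<noteq> 0" "multiform r \<delta>' c' Qs \<noteq> 0"
    using t(1,2) unfolding P by auto
  moreover have "length Qs = r" by (simp add: Qs_def)
  ultimately show ?thesis by (intro that)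
qed

lemma hcoords_nonzero: "hcoords P \<noteq> (0, 0)"
  by (cases P) auto

text \<open>Two nonempty Zariski open sets meet, by \<open>forms_common_nonzero\<close>. As
  \<open>\<phi>\<close> also forces distinctness, a common tuple carries both counts, which
  determines the number uniquely.\<close>

lemma p_hurwitz_eqI:
  fixes \<phi> :: "(nat \<Rightarrow> 'k::alg_closed_field \<times> 'k) \<Rightarrow> 'k"
  assumes form: "is_form (length Cs) \<delta> \<phi>"
    and nz: "length Qs0 = length Cs" "\<phi> (\<lambda>i. hcoords (Qs0 ! i)) \<noteq> 0"
    and count: "\<And>Qs. length Qs = length Cs \<Longrightarrow> \<phi> (\<lambda>i. hcoords (Qs ! i)) \<noteq> 0 \<Longrightarrow> distinct Qs \<and> num_covers d Cs Qs N"
  shows "p_hurwitz TYPE('k) d Cs = N"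
  unfolding p_hurwitz_def
proof (rule the_equality)
  obtain c where c: "\<And>u. \<phi> u = mf (length Cs) \<delta> c u" using form unfolding is_form_def by blast
  let ?r = "length Cs"
  define U where "U = {Qs :: 'k proj_line list. length Qs = ?r} - {Qs. length Qs = ?r \<and> (\<forall>(\<delta>, c)\<in>{(\<delta>, c)}. multiform ?r \<delta> c Qs = 0)}"
  have "zariski_open ?r U" unfolding zariski_open_def U_def by blast
  moreover have "Qs0 \<in> U" using nz by (simp add: U_def multiform_mf c)
  moreover have "num_covers d Cs Qs N" if "Qs \<in> U" for Qs
    using that count[of Qs] by (simp add: U_def multiform_mf c)
  ultimately show "\<exists>U :: 'k proj_line list set. zariski_open ?r U \<and> U \<noteq> {} \<and> (\<forall>Qs\<in>U. distinct Qs \<longrightarrow> num_covers d Cs Qs N)"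
    by blast
  fix n
  assume "\<exists>U :: 'k proj_line list set. zariski_open ?r U \<and> U \<noteq> {} \<and> (\<forall>Qs\<in>U. distinct Qs \<longrightarrow> num_covers d Cs Qs n)"
  then obtain U :: "'k proj_line list set" and Qa where U: "zariski_open ?r U" "Qa \<in> U"
    "\<And>Qs. Qs \<in> U \<Longrightarrow> distinct Qs \<Longrightarrow> num_covers d Cs Qs n" by blast
  obtain \<F> where \<F>: "U = {Qs. length Qs = ?r} - {Qs. length Qs = ?r \<and> (\<forall>(\<delta>, c)\<in>\<F>. multiform ?r \<delta> c Qs = 0)}"
    using U(1) unfolding zariski_open_def by blast
  obtain \<delta>' c' where f: "(\<delta>', c') \<in> \<F>" "multiform ?r \<delta>' c' Qa \<noteq> 0"
    using U(2) unfolding \<F> by auto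
  obtain Qs :: "'k proj_line list" where Qs: "length Qs = ?r" "multiform ?r \<delta>' c' Qs \<noteq> 0" "multiform ?r \<delta> c Qs \<noteq> 0"
    by (rule forms_common_nonzero[of ?r \<delta>' c' "\<lambda>i. hcoords (Qa ! i)" \<delta> c "\<lambda>i. hcoords (Qs0 ! i)"])
      (use f(2) nz(2) in \<open>simp_all add: multiform_mf c hcoords_nonzero\<close>)
  have "Qs \<in> U" using Qs f(1) unfolding \<F> by auto
  moreover have "distinct Qs \<and> num_covers d Cs Qs N"
    using Qs by (intro count) (simp_all add: multiform_mf c)
  ultimately show "n = N" using U(3) unfolding num_covers_def by blast
qed

section \<open>Counting covers\<close>

text \<open>The count is symmetric in the branch points, so any of the four indices can take the
  distinguished last place.\<close>

lemma num_covers_permute: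
  assumes perm: "{i, j, k, l} = {..<4::nat}" and len: "length es = 4" "length Qs = 4"
  shows "num_covers d (map g [es ! i, es ! j, es ! k, es ! l]) [Qs ! i, Qs ! j, Qs ! k, Qs ! l] N \<longleftrightarrow>
    num_covers d (map g es) Qs N"
proof -
  have all: "(\<forall>x<4. R x) \<longleftrightarrow> R i \<and> R j \<and> R k \<and> R l" for R
  proof -
    have "(\<forall>x<4. R x) \<longleftrightarrow> (\<forall>x\<in>{i, j, k, l}. R x)" unfolding perm by auto
    then show ?thesis by simp
  qed
  have less: "i < 4" "j < 4" "k < 4" "l < 4" using perm by blast+
  have set: "set Qs = {Qs ! i, Qs ! j, Qs ! k, Qs ! l}"
  proof -
    have "set Qs = (!) Qs ` {..<4}" using len by (auto simp: set_conv_nth)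
    then show ?thesis unfolding perm[symmetric] by simp
  qed
  have "is_cover d (map g [es ! i, es ! j, es ! k, es ! l]) [Qs ! i, Qs ! j, Qs ! k, Qs ! l] f \<longleftrightarrow>
    is_cover d (map g es) Qs f" for f
  proof -
    let ?I = "\<lambda>Q. image_mset (ram_index f) (mset_set {P. mapply f P = Q})"
    let ?R = "?I (Qs ! i) = g (es ! i) \<and> ?I (Qs ! j) = g (es ! j) \<and> ?I (Qs ! k) = g (es ! k) \<and> ?I (Qs ! l) = g (es ! l)"
    have "(\<forall>x<length (map g [es ! i, es ! j, es ! k, es ! l]).
        ?I ([Qs ! i, Qs ! j, Qs ! k, Qs ! l] ! x) = map g [es ! i, es ! j, es ! k, es ! l] ! x) \<longleftrightarrow> ?R"
      by (auto simp: less_Suc_eq)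
    moreover have "(\<forall>x<length (map g es). ?I (Qs ! x) = map g es ! x) \<longleftrightarrow> ?R"
      using less len all[of "\<lambda>x. ?I (Qs ! x) = map g es ! x"] by simp
    moreover have "set [Qs ! i, Qs ! j, Qs ! k, Qs ! l] = set Qs" unfolding set by simp
    ultimately show ?thesis unfolding is_cover_def by presburger
  qed
  then have "is_cover d (map g [es ! i, es ! j, es ! k, es ! l]) [Qs ! i, Qs ! j, Qs ! k, Qs ! l] =
      is_cover d (map g es) Qs" by (intro ext)
  then show ?thesis unfolding num_covers_def iso_classes_def by (simp only:)
qed

definition cross_ratio :: "'a::field proj_line \<Rightarrow> 'a proj_line \<Rightarrow> 'a proj_line \<Rightarrow> 'a proj_line \<Rightarrow> 'a" where
  "cross_ratio Q1 Q2 Q3 Q4 = br Q2 Q3 * br Q1 Q4 / (br Q2 Q4 * br Q1 Q3)"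

text \<open>The conditions with \<^term>\<open>max\<close> say that, among the four ramification indices $e$, the last one
  minimises $e (d + 1 - e)$.\<close>

definition admissible :: "nat \<Rightarrow> nat \<Rightarrow> nat \<Rightarrow> nat \<Rightarrow> nat \<Rightarrow> bool" where
  "admissible d e1 e2 e3 n \<longleftrightarrow>
    1 < e1 \<and> 1 < e2 \<and> 1 < e3 \<and> 1 < n \<and> e1 < d \<and> e2 < d \<and> e3 < d \<and> n < d \<and>
    e1 + e2 + e3 + n = 2 * d + 2 \<and>
    d < max e1 n + e2 \<and> d < max e1 n + e3 \<and> d < max e2 n + e1 \<and>
    d < max e2 n + e3 \<and> d < max e3 n + e1 \<and> d < max e3 n + e2"

lemma pencil_coverI:
  fixes Q1 Q2 Q3 Q4 :: "'a::alg_closed_field proj_line"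
  assumes "admissible d e1 e2 e3 n" "CHAR('a) = 0 \<or> CHAR('a) = d \<and> prime d" "distinct [Q1, Q2, Q3, Q4]"
  shows "pencil_cover d e1 e2 e3 n (cross_ratio Q1 Q2 Q3 Q4) Q1 Q2 Q3 Q4"
proof -
  have Q: "Q1 \<noteq> Q2" "Q1 \<noteq> Q3" "Q1 \<noteq> Q4" "Q2 \<noteq> Q3" "Q2 \<noteq> Q4" "Q3 \<noteq> Q4" using assms(3) by auto
  have nz: "br Q1 Q2 \<noteq> 0" "br Q1 Q3 \<noteq> 0" "br Q1 Q4 \<noteq> 0" "br Q2 Q3 \<noteq> 0" "br Q2 Q4 \<noteq> 0" "br Q3 Q4 \<noteq> 0"
    using Q by (auto simp: br_eq_0_iff)
  have 1: "cross_ratio Q1 Q2 Q3 Q4 \<noteq> 0" using nz by (simp add: cross_ratio_def)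
  have "br Q1 Q3 * br Q2 Q4 - br Q1 Q4 * br Q2 Q3 \<noteq> 0" using nz by (simp add: plucker_br)
  then have 2: "cross_ratio Q1 Q2 Q3 Q4 \<noteq> 1" using nz by (simp add: cross_ratio_def mult.commute)
  show ?thesis
    by unfold_locales (use assms(1,2) 1 2 Q in \<open>auto simp: admissible_def cross_ratio_def\<close>)
qed

lemma num_covers_char_0:
  fixes Q1 Q2 Q3 Q4 :: "'a::alg_closed_field proj_line"
  assumes "admissible d e1 e2 e3 n" "CHAR('a) = 0" "distinct [Q1, Q2, Q3, Q4]"
  shows "num_covers d (map (single_cycle d) [e1, e2, e3, n]) [Q1, Q2, Q3, Q4] (n * (d + 1 - n))"
proof -
  interpret pencil_cover d e1 e2 e3 n "cross_ratio Q1 Q2 Q3 Q4" Q1 Q2 Q3 Q4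
    by (rule pencil_coverI) (use assms in auto)
  show ?thesis using iso_classes_good card_good_char_0[OF assms(2)] by simp
qed

text \<open>The exceptional cross ratios are the \<open>d\<close>-th powers of the zeros of
  \<open>phi\<close>, which is given by a nonzero polynomial.\<close>

lemma num_covers_char_d:
  assumes adm: "admissible d e1 e2 e3 n" and chd: "CHAR('a::alg_closed_field) = d" "prime d"
  shows "\<exists>M. finite M \<and> (\<forall>Q1 Q2 Q3 Q4 :: 'a proj_line. distinct [Q1, Q2, Q3, Q4] \<longrightarrow> cross_ratio Q1 Q2 Q3 Q4 \<notin> M \<longrightarrow>
    num_covers d (map (single_cycle d) [e1, e2, e3, n]) [Q1, Q2, Q3, Q4] (n * (d + 1 - n) - d))"
proof -
  \<comment> \<open>\<open>phi\<close> involves only the ramification indices and \<open>l\<close>,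
    so every choice of \<open>m0\<close> gives the same function, and one finite set serves all
    branch points.\<close>
  obtain m0 :: 'a where m0: "m0 \<notin> {0, 1}" using exists_not_root[of 1 "{0, 1 :: 'a}"] by auto
  interpret P0: pencil d e1 e2 e3 n m0
    by unfold_locales (use adm chd m0 in \<open>auto simp: admissible_def\<close>)
  obtain P where P: "P \<noteq> 0" "\<And>l. P0.phi l = poly P l" using P0.phi_polynomial[OF chd(1)] by blast
  define M where "M = (\<lambda>l. l ^ d) ` {l. poly P l = 0}"
  have "finite M" unfolding M_def by (intro finite_imageI poly_roots_finite P)
  moreover have "num_covers d (map (single_cycle d) [e1, e2, e3, n]) [Q1, Q2, Q3, Q4] (n * (d + 1 - n) - d)"
    if Q: "distinct [Q1, Q2, Q3, Q4]" and cross_ratio: "cross_ratio Q1 Q2 Q3 Q4 \<notin> M" for Q1 Q2 Q3 Q4 :: "'a proj_line"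
  proof -
    interpret pencil_cover d e1 e2 e3 n "cross_ratio Q1 Q2 Q3 Q4" Q1 Q2 Q3 Q4
      by (rule pencil_coverI) (use adm chd Q in auto)
    have "P0.phi l \<noteq> 0" if "l ^ d = cross_ratio Q1 Q2 Q3 Q4" for l
    proof
      assume "P0.phi l = 0"
      then have "poly P l = 0" using P(2) by simp
      then have "l ^ d \<in> M" unfolding M_def by blast
      then show False using cross_ratio that by simp
    qed
    from card_good_char_d[OF chd(1) this] have "finite good" "card good = n * (d + 1 - n) - d" by auto
    then show ?thesis using iso_classes_good by metis
  qed
  ultimately show ?thesis by blast
qed

lemma hurwitz_difference:
  assumes p: "prime p" "CHAR('k::alg_closed_field) = p"
    and perm: "{i, j, k, l} = {..<4::nat}" and len: "length es = 4"
    and adm: "admissible p (es ! i) (es ! j) (es ! k) (es ! l)"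
  shows "int (p_hurwitz TYPE('k) p (map (single_cycle p) es)) = int (hurwitz p (map (single_cycle p) es)) - int p"
proof -
  define n where "n = es ! l"
  define N where "N = n * (p + 1 - n)"
  have less: "i < 4" "j < 4" "k < 4" "l < 4" using perm by blast+
  have ne: "i \<noteq> j" "i \<noteq> k" "i \<noteq> l" "j \<noteq> k" "j \<noteq> l" "k \<noteq> l"
  proof -
    have "card {i, j, k, l} = 4" unfolding perm by simp
    then show "i \<noteq> j" "i \<noteq> k" "i \<noteq> l" "j \<noteq> k" "j \<noteq> l" "k \<noteq> l"
      by (auto simp: card_insert_if split: if_splits)
  qed
  have dist: "distinct Qs \<longleftrightarrow> distinct [Qs ! i, Qs ! j, Qs ! k, Qs ! l]" if "length Qs = 4" for Qs :: "'b list"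
  proof
    assume "distinct Qs"
    then show "distinct [Qs ! i, Qs ! j, Qs ! k, Qs ! l]"
      using less ne that by (auto simp: nth_eq_iff_index_eq)
  next
    assume "distinct [Qs ! i, Qs ! j, Qs ! k, Qs ! l]"
    then have "card {Qs ! i, Qs ! j, Qs ! k, Qs ! l} = 4" by auto
    moreover have "set Qs = {Qs ! i, Qs ! j, Qs ! k, Qs ! l}"
    proof -
      have "set Qs = (!) Qs ` {..<4}" using that by (auto simp: set_conv_nth)
      then show ?thesis unfolding perm[symmetric] by simp
    qed
    ultimately show "distinct Qs" using that by (intro card_distinct) simp
  qed
  let ?Cs = "map (single_cycle p) es"
  have h: "hurwitz p ?Cs = N"
    unfolding hurwitz_def
  proof (rule the_equality)
    show *: "\<forall>Qs :: complex proj_line list. length Qs = length ?Cs \<and> distinct Qs \<longrightarrow> num_covers p ?Cs Qs N"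
    proof (intro allI impI)
      fix Qs :: "complex proj_line list" assume Qs: "length Qs = length ?Cs \<and> distinct Qs"
      then have "distinct [Qs ! i, Qs ! j, Qs ! k, Qs ! l]" using dist[of Qs] len by simp
      from num_covers_char_0[OF adm _ this]
      have "num_covers p (map (single_cycle p) [es ! i, es ! j, es ! k, es ! l]) [Qs ! i, Qs ! j, Qs ! k, Qs ! l] N"
        by (simp add: N_def n_def)
      then show "num_covers p ?Cs Qs N" using num_covers_permute[OF perm len, of Qs] Qs len by simp
    qed
    fix m assume m: "\<forall>Qs :: complex proj_line list. length Qs = length ?Cs \<and> distinct Qs \<longrightarrow> num_covers p ?Cs Qs m"
    have "length [Infty, Fin 0, Fin 1, Fin (2 :: complex)] = length ?Cs \<and> distinct [Infty, Fin 0, Fin 1, Fin (2 :: complex)]"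
      using len by simp
    with m * show "m = N" unfolding num_covers_def by blast
  qed
  obtain M :: "'k set" where M: "finite M" "\<And>Q1 Q2 Q3 Q4. distinct [Q1, Q2, Q3, Q4] \<Longrightarrow> cross_ratio Q1 Q2 Q3 Q4 \<notin> M \<Longrightarrow>
    num_covers p (map (single_cycle p) [es ! i, es ! j, es ! k, es ! l]) [Q1, Q2, Q3, Q4] (N - p)"
    using num_covers_char_d[OF adm p(2,1)] unfolding N_def n_def by metis
  \<comment> \<open>Vanishes exactly when two branch points coincide or the cross ratio lies in
    \<open>M\<close>; denominators are cleared to obtain a multihomogeneous form.\<close>
  define \<phi> where "\<phi> = (\<lambda>u :: nat \<Rightarrow> 'k \<times> 'k. (\<Prod>m\<in>M. bracket j k u * bracket i l u - m * (bracket j l u * bracket i k u)) *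
    (\<Prod>(x, y)\<in>{(i, j), (i, k), (i, l), (j, k), (j, l), (k, l)}. bracket x y u))"
  have "\<exists>\<delta>. is_form 4 \<delta> \<phi>"
  proof -
    have 1: "is_form 4 (\<lambda>x. (unit_degree j x + unit_degree k x) + (unit_degree i x + unit_degree l x))
        (\<lambda>u :: nat \<Rightarrow> 'k \<times> 'k. bracket j k u * bracket i l u)"
      using less by (intro is_form_mult is_form_bracket)
    have "is_form 4 (\<lambda>x. (unit_degree j x + unit_degree l x) + (unit_degree i x + unit_degree k x))
        (\<lambda>u :: nat \<Rightarrow> 'k \<times> 'k. bracket j l u * bracket i k u)"
      using less by (intro is_form_mult is_form_bracket)
    then have 2: "is_form 4 (\<lambda>x. (unit_degree j x + unit_degree k x) + (unit_degree i x + unit_degree l x))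
        (\<lambda>u :: nat \<Rightarrow> 'k \<times> 'k. bracket j l u * bracket i k u)"
      by (simp add: add_ac)
    obtain \<delta> where \<delta>: "is_form 4 \<delta> (\<lambda>u :: nat \<Rightarrow> 'k \<times> 'k. \<Prod>m\<in>M. bracket j k u * bracket i l u - m * (bracket j l u * bracket i k u))"
      using is_form_prod[OF M(1), of 4 "\<lambda>m u. bracket j k u * bracket i l u - m * (bracket j l u * bracket i k u)"] is_form_linear[OF 1 2] by blast
    have "\<exists>\<delta>. is_form 4 \<delta> (\<lambda>u :: nat \<Rightarrow> 'k \<times> 'k. \<Prod>q\<in>{(i, j), (i, k), (i, l), (j, k), (j, l), (k, l)}. bracket (fst q) (snd q) u)"
    proof (rule is_form_prod)
      have "\<exists>\<delta>. is_form 4 \<delta> (bracket x y :: (nat \<Rightarrow> 'k \<times> 'k) \<Rightarrow> 'k)" if "x < 4" "y < 4" for x y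
        using is_form_bracket[OF that] by blast
      then show "\<exists>\<delta>. is_form 4 \<delta> (bracket (fst q) (snd q) :: (nat \<Rightarrow> 'k \<times> 'k) \<Rightarrow> 'k)"
        if "q \<in> {(i, j), (i, k), (i, l), (j, k), (j, l), (k, l)}" for q
        using that less by auto
    qed simp
    then obtain \<delta>' where "is_form 4 \<delta>' (\<lambda>u :: nat \<Rightarrow> 'k \<times> 'k. \<Prod>q\<in>{(i, j), (i, k), (i, l), (j, k), (j, l), (k, l)}. bracket (fst q) (snd q) u)"
      by blast
    from is_form_mult[OF \<delta> this] show ?thesis unfolding \<phi>_def case_prod_beta by blast
  qed
  then obtain \<delta> where form: "is_form (length ?Cs) \<delta> \<phi>" using len by auto
  have bracket: "bracket x y (\<lambda>x. hcoords (Qs ! x)) = br (Qs ! x) (Qs ! y)" for x y and Qs :: "'k proj_line list"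
    by (simp add: bracket_def br_def)
  have \<phi>: "\<phi> (\<lambda>x. hcoords (Qs ! x)) \<noteq> 0 \<longleftrightarrow> distinct [Qs ! i, Qs ! j, Qs ! k, Qs ! l] \<and>
      (\<forall>m\<in>M. br (Qs ! j) (Qs ! k) * br (Qs ! i) (Qs ! l) \<noteq> m * (br (Qs ! j) (Qs ! l) * br (Qs ! i) (Qs ! k)))" for Qs
    using M(1) ne by (auto simp: \<phi>_def bracket br_eq_0_iff)
  obtain \<mu> where \<mu>: "\<mu> \<notin> insert 0 (insert 1 M)"
    using exists_not_root[of 1 "insert 0 (insert 1 M)"] M(1) by auto
  \<comment> \<open>For 0, infinity, 1 and \<open>\<mu>\<close> in the positions \<open>i\<close>,
    \<open>j\<close>, \<open>k\<close>, \<open>l\<close> the cross ratio is \<open>\<mu>\<close>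
    itself.\<close>
  define Qs0 where "Qs0 = map (\<lambda>x. if x = i then Fin 0 else if x = j then Infty else if x = k then Fin 1 else Fin \<mu>) [0..<4]"
  have Qs0: "length Qs0 = 4" "Qs0 ! i = Fin 0" "Qs0 ! j = Infty" "Qs0 ! k = Fin 1" "Qs0 ! l = Fin \<mu>"
    using less ne by (auto simp: Qs0_def)
  have ph: "p_hurwitz TYPE('k) p ?Cs = N - p"
  proof (rule p_hurwitz_eqI[OF form])
    show "length Qs0 = length ?Cs" using Qs0 len by simp
    show "\<phi> (\<lambda>x. hcoords (Qs0 ! x)) \<noteq> 0"
      unfolding \<phi> Qs0 using \<mu> by (auto simp: br_def)
    fix Qs :: "'k proj_line list"
    assume Qs: "length Qs = length ?Cs" "\<phi> (\<lambda>i. hcoords (Qs ! i)) \<noteq> 0"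
    then have d: "distinct [Qs ! i, Qs ! j, Qs ! k, Qs ! l]"
      and m: "\<forall>m\<in>M. br (Qs ! j) (Qs ! k) * br (Qs ! i) (Qs ! l) \<noteq> m * (br (Qs ! j) (Qs ! l) * br (Qs ! i) (Qs ! k))"
      unfolding \<phi> by blast+
    have "br (Qs ! j) (Qs ! l) * br (Qs ! i) (Qs ! k) \<noteq> 0" using d by (auto simp: br_eq_0_iff)
    then have "cross_ratio (Qs ! i) (Qs ! j) (Qs ! k) (Qs ! l) \<notin> M"
      using m by (auto simp: cross_ratio_def)
    from M(2)[OF d this] have "num_covers p ?Cs Qs (N - p)"
      using num_covers_permute[OF perm len, of Qs] Qs(1) len by simp
    then show "distinct Qs \<and> num_covers p ?Cs Qs (N - p)" using dist[of Qs] d Qs(1) len by simp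
  qed
  \<comment> \<open>Ensures that the natural number \<open>N - p\<close> is not truncated; for
    \<open>p = n + b\<close> it equals \<open>(n - 1) * b\<close>.\<close>
  have "p \<le> N"
  proof -
    have n: "1 < n" "n < p" using adm by (auto simp: admissible_def n_def)
    obtain b where b: "p = n + b" using n(2) by (metis le_iff_add less_imp_le)
    have "b \<le> n * b" using n by simp
    then show ?thesis unfolding N_def b by simp
  qed
  then show ?thesis using h ph by simp
qed

text \<open>If \<open>n\<close> is the smallest index, each maximum is the other index and the sum
  formula gives the bound; if \<open>n\<close> is the largest, each maximum is \<open>n\<close>
  itself.\<close>

lemma admissibleI:
  fixes e1 e2 e3 n d :: nat
  assumes "1 < e1" "1 < e2" "1 < e3" "1 < n" "e1 < d" "e2 < d" "e3 < d" "n < d" "e1 + e2 + e3 + n = 2 * d + 2"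
    and "n \<le> e1 \<and> n \<le> e2 \<and> n \<le> e3 \<and> n + e1 \<le> d + 1 \<and> n + e2 \<le> d + 1 \<and> n + e3 \<le> d + 1 \<or>
      e1 \<le> n \<and> e2 \<le> n \<and> e3 \<le> n \<and> d + 1 \<le> n + e1 \<and> d + 1 \<le> n + e2 \<and> d + 1 \<le> n + e3"
  shows "admissible d e1 e2 e3 n"
  using assms unfolding admissible_def by (auto simp: max_def)

text \<open>The function \<open>e (d + 1 - e)\<close> is concave and symmetric about half of
  \<open>d + 1\<close>, so it is minimal at the smallest or at the largest index. Comparing
  \<open>lo + hi\<close> with \<open>d + 1\<close> tells which of them is farther from the
  centre.\<close>

lemma admissible_cases:
  fixes e1 e2 e3 e4 d :: nat
  assumes "1 < e1" "1 < e2" "1 < e3" "1 < e4" "e1 < d" "e2 < d" "e3 < d" "e4 < d"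
    "e1 + e2 + e3 + e4 = 2 * d + 2"
  shows "admissible d e1 e2 e3 e4 \<or> admissible d e4 e2 e3 e1 \<or> admissible d e1 e4 e3 e2 \<or> admissible d e1 e2 e4 e3"
proof -
  have sums: "e1 + e2 + e3 + e4 = 2 * d + 2" "e4 + e2 + e3 + e1 = 2 * d + 2" "e1 + e4 + e3 + e2 = 2 * d + 2"
    "e1 + e2 + e4 + e3 = 2 * d + 2" using assms(9) by auto
  note a = admissibleI[OF assms(1,2,3,4,5,6,7,8) sums(1)] admissibleI[OF assms(4,2,3,1,8,6,7,5) sums(2)]
    admissibleI[OF assms(1,4,3,2,5,8,7,6) sums(3)] admissibleI[OF assms(1,2,4,3,5,6,8,7) sums(4)]
  define lo hi where "lo = min e1 (min e2 (min e3 e4))" and "hi = max e1 (max e2 (max e3 e4))"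
  have le: "lo \<le> e1" "lo \<le> e2" "lo \<le> e3" "lo \<le> e4" "e1 \<le> hi" "e2 \<le> hi" "e3 \<le> hi" "e4 \<le> hi"
    by (auto simp: lo_def hi_def)
  have lo: "lo = e4 \<or> lo = e1 \<or> lo = e2 \<or> lo = e3" by (auto simp: lo_def min_def)
  have hi: "hi = e4 \<or> hi = e1 \<or> hi = e2 \<or> hi = e3" by (auto simp: hi_def max_def)
  have "\<exists>x\<in>{e4, e1, e2, e3}. x \<le> lo \<and> x + hi \<le> d + 1 \<or> hi \<le> x \<and> d + 1 \<le> x + lo"
  proof (cases "lo + hi \<le> d + 1")
    case True
    then show ?thesis using lo by (intro bexI[of _ lo]) auto
  next
    case False
    then show ?thesis using hi by (intro bexI[of _ hi]) auto
  qed
  moreover have "e4 \<le> lo \<and> e4 + hi \<le> d + 1 \<or> hi \<le> e4 \<and> d + 1 \<le> e4 + lo \<Longrightarrow> admissible d e1 e2 e3 e4"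
    by (elim disjE conjE, intro a(1) disjI1, use le in linarith, intro a(1) disjI2, use le in linarith)
  moreover have "e1 \<le> lo \<and> e1 + hi \<le> d + 1 \<or> hi \<le> e1 \<and> d + 1 \<le> e1 + lo \<Longrightarrow> admissible d e4 e2 e3 e1"
    by (elim disjE conjE, intro a(2) disjI1, use le in linarith, intro a(2) disjI2, use le in linarith)
  moreover have "e2 \<le> lo \<and> e2 + hi \<le> d + 1 \<or> hi \<le> e2 \<and> d + 1 \<le> e2 + lo \<Longrightarrow> admissible d e1 e4 e3 e2"
    by (elim disjE conjE, intro a(3) disjI1, use le in linarith, intro a(3) disjI2, use le in linarith)
  moreover have "e3 \<le> lo \<and> e3 + hi \<le> d + 1 \<or> hi \<le> e3 \<and> d + 1 \<le> e3 + lo \<Longrightarrow> admissible d e1 e2 e4 e3"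
    by (elim disjE conjE, intro a(4) disjI1, use le in linarith, intro a(4) disjI2, use le in linarith)
  ultimately show ?thesis by blast
qed

theorem theorem1p1:
  fixes p e1 e2 e3 e4 :: nat
  assumes "prime p"
    and "CHAR('k::alg_closed_field) = p"
    and "1 < e1" "1 < e2" "1 < e3" "1 < e4"
    and "e1 < p" "e2 < p" "e3 < p" "e4 < p"
    and "e1 + e2 + e3 + e4 = 2 * p + 2"
  shows "int (p_hurwitz TYPE('k) p (map (single_cycle p) [e1, e2, e3, e4])) =
         int (hurwitz p (map (single_cycle p) [e1, e2, e3, e4])) - int p"
proof -
  let ?es = "[e1, e2, e3, e4]"
  note diff = hurwitz_difference[OF assms(1,2), of _ _ _ _ ?es]
  consider "admissible p e1 e2 e3 e4" | "admissible p e4 e2 e3 e1" | "admissible p e1 e4 e3 e2"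
    | "admissible p e1 e2 e4 e3"
    using admissible_cases[OF assms(3-11)] by blast
  then show ?thesis
  proof cases
    case 1
    then show ?thesis by (intro diff[of 0 1 2 3]) (auto simp: numeral_eq_Suc)
  next
    case 2
    then show ?thesis by (intro diff[of 3 1 2 0]) (auto simp: numeral_eq_Suc)
  next
    case 3
    then show ?thesis by (intro diff[of 0 3 2 1]) (auto simp: numeral_eq_Suc)
  next
    case 4
    then show ?thesis by (intro diff[of 0 1 3 2]) (auto simp: numeral_eq_Suc)
  qed
qed

end
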